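(* Let $(\Lambda,U):(0,\infty)\to(0,\infty)\times C^1_{D,r}(\bar{\mathbb{B}}_1)$ be the continuous curve of radially symmetric solutions, and $s_*$ the parameter value, described in the context. (i) As $s\to\infty$, $$(\Lambda(s),U(s))\to(0,\omega)\quad\text{in}\quad\mathbb{R}\times\big(C(\bar{\mathbb{B}}_1)\cap C^1(\bar{\mathbb{B}}_1\setminus\mathbb{B}_\rho)\big)$$ for each $\rho\in(0,1)$, where $\omega\in C^4(\bar{\mathbb{B}}_1\setminus\{0\})\cap C^1_r(\bar{\mathbb{B}}_1)$ solves $$B\Delta^2\omega(x)-T\Delta\omega(x)=0\quad\text{for }x\in\mathbb{B}_1\setminus\{0\},$$ with boundary conditions $\omega(x)=\partial_\nu\omega(x)=0$ for $x\in\partial\mathbb{B}_1$ and $\omega(0)+1=\nabla\omega(0)=0$, and satisfies $\omega(x)>-1$ for $0<|x|<1$. (ii) For each $\lambda\in(0,\lambda_* )$ there are at least two values $0<s_1<s_*<s_2$ with $\Lambda(s_j)=\lambda$, $U(s_j)\in\mathcal{S}_r^\lambda$ for $j=1,2$, and $U(s_2)\le U(s_1)$ in $\mathbb{B}_1$ with $U(s_2)\neq U(s_1)$.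
   Context: Throughout, $d\in\{1,2\}$, $B>0$, $T\ge0$; $\mathbb{B}_\rho$ is the open ball of radius $\rho$ about $0$ in $\mathbb{R}^d$, $\nu$ is the outward unit normal; $g(\xi):=(1+\xi)^{-2}$ for $\xi>-1$. The subscript $r$ denotes radially symmetric functions and the subscript $D$ denotes functions satisfying $u=\partial_\nu u=0$ on $\partial\mathbb{B}_1$. $\mathcal{S}_r^\lambda$ is the set of radially symmetric classical solutions with parameter $\lambda$: radially symmetric $u\in C^4(\mathbb{B}_1)\cap C^2(\bar{\mathbb{B}}_1)$ with $u>-1$ in $\bar{\mathbb{B}}_1$, $B\Delta^2u-T\Delta u=-\lambda g(u)$ in $\mathbb{B}_1$, $u=\partial_\nu u=0$ on $\partial\mathbb{B}_1$. A radially symmetric classical subsolution is defined likewise with $\le$ in place of $=$ in the differential equation. $\lambda_*:=\sup\{\lambda>0:\mathcal{S}_r^\lambda\ne\emptyset\}\in(0,\infty)$. For $\lambda\in(0,\lambda_* )$, $u_\lambda\in\mathcal{S}_r^\lambda$ is the (known to exist) unique maximal element: $u\le u_\lambda$ for all radially symmetric classical subsolutions $u$ with parameter $\lambda$; $\lambda\mapsto u_\lambda(x)$ is decreasing for each $x\in\mathbb{B}_1$. $u_{\lambda_*}(x):=\inf_{\lambda\in(0,\lambda_* )}u_\lambda(x)$, which belongs to $\mathcal{S}_r^{\lambda_*}$. $A:=B\Delta^2-T\Delta$ with domain $H^4_{D,r}(\mathbb{B}_1)$ is invertible onto $L_{2,r}(\mathbb{B}_1)$. Set $\mathcal{O}:=\{u\in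 C^1_{D,r}(\bar{\mathbb{B}}_1):|u|<1\text{ in }\bar{\mathbb{B}}_1\}$ and $F:\mathbb{R}\times\mathcal{O}\to C^1_{D,r}(\bar{\mathbb{B}}_1)$, $F(\lambda,u):=u+\lambda A^{-1}g(u)$, with partial Fréchet derivative $F_u(\lambda,u)=1+\lambda A^{-1}g'(u)$. Let $S$ be the set of $(\lambda,u)\in(0,\infty)\times\mathcal{O}$ with $F(\lambda,u)=0$ and $F_u(\lambda,u)\in\mathcal{L}(C^1_{D,r}(\bar{\mathbb{B}}_1))$ boundedly invertible, and $\bar S$ its closure. Let $\lambda_0\in(0,\infty]$ be maximal such that there is a real analytic $V:[0,\lambda_0)\to C^1_{D,r}(\bar{\mathbb{B}}_1)$ with $V(0)=0$, $F(\lambda,V(\lambda))=0$ and $F_u(\lambda,V(\lambda))$ boundedly invertible for all $\lambda\in[0,\lambda_0)$, and $\mathcal{A}_0:=\{(\lambda,V(\lambda)):\lambda\in(0,\lambda_0)\}$. One has $\lambda_0=\lambda_*$ and $V(\lambda)=u_\lambda$. The curve $(\Lambda,U):(0,\infty)\to(0,\infty)\times C^1_{D,r}(\bar{\mathbb{B}}_1)$ is a continuous function with the properties: (a) $U(s)\in\mathcal{S}_r^{\Lambda(s)}$ for each $s>0$; (b) $(\Lambda,U)((0,1))\subset\mathcal{A}_0$ and $\lim_{s\to0}(\Lambda(s),U(s))=(0,0)$; (c) $(\Lambda,U)$ is injective on $(\Lambda,U)^{-1}(S)$ and $\lim_{s\to\infty}\min_{\bar{\mathbb{B}}_1}U(s)=-1$;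 (d) at all points $s\in(\Lambda,U)^{-1}(S)$, $(\Lambda,U)$ is real analytic with $\Lambda'(s)\ne0$; (e) $(\Lambda,U)^{-1}(\bar S\setminus S)$ consists of isolated values, and locally near each such $s_0$ there is a (continuous, injective) re-parametrization $\zeta$ of the parameter $s$, with $\zeta(0)=s_0$, such that $(\Lambda,U)\circ\zeta$ is real analytic with derivative vanishing possibly only at $0$. The number $s_*\in[1,\infty)$ is the minimal value such that $(\Lambda(s_* ),U(s_* ))=(\lambda_*,u_{\lambda_*})$ and $\mathcal{A}_0=(\Lambda,U)((0,s_* ))$. *)

theory Defs
  imports "HOL-Analysis.Analysis"
begin

section \<open>Differentiability classes on subsets of a Euclidean space\<close>

text \<open>
  Derivatives are taken within \<open>S\<close>, so that one definition serves for the open ball, the closed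
  ball and the punctured closed ball. On these sets derivatives within \<open>S\<close> are unique, and being
  \<open>C\<^sup>k\<close> in this sense means that all partial derivatives up to order \<open>k\<close> exist in the interior and
  extend continuously to \<open>S\<close>.
\<close>

primrec Ck_on :: "nat \<Rightarrow> 'a::euclidean_space set \<Rightarrow> ('a \<Rightarrow> real) \<Rightarrow> bool" where
  "Ck_on 0 S u \<longleftrightarrow> continuous_on S u"
| "Ck_on (Suc k) S u \<longleftrightarrow>
     (\<exists>p. (\<forall>x\<in>S. (u has_derivative (\<lambda>h. \<Sum>i\<in>Basis. (h \<bullet> i) * p i x)) (at x within S)) \<and>
          (\<forall>i\<in>Basis. Ck_on k S (p i)))"

definition partial :: "'a::euclidean_space \<Rightarrow> ('a \<Rightarrow> real) \<Rightarrow> 'a \<Rightarrow> real" where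
  "partial i u x = frechet_derivative u (at x) i"

definition laplacian :: "('a::euclidean_space \<Rightarrow> real) \<Rightarrow> 'a \<Rightarrow> real" where
  "laplacian u x = (\<Sum>i\<in>Basis. partial i (partial i u) x)"

text \<open>The gradient of a function on the closed unit ball (one-sided at boundary points).\<close>

definition grad :: "('a::euclidean_space \<Rightarrow> real) \<Rightarrow> 'a \<Rightarrow> 'a" where
  "grad u x = (\<Sum>i\<in>Basis. frechet_derivative u (at x within cball 0 1) i *\<^sub>R i)"

text \<open>The outward unit normal of the unit ball at \<open>x \<in> sphere 0 1\<close> is \<open>x\<close> itself.\<close>

definition normal_deriv :: "('a::euclidean_space \<Rightarrow> real) \<Rightarrow> 'a \<Rightarrow> real" where
  "normal_deriv u x = grad u x \<bullet> x"

definition radial :: "('a::euclidean_space \<Rightarrow> real) \<Rightarrow> bool" where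
  "radial u \<longleftrightarrow> (\<forall>x\<in>cball 0 1. \<forall>y\<in>cball 0 1. norm x = norm y \<longrightarrow> u x = u y)"

definition clamped :: "('a::euclidean_space \<Rightarrow> real) \<Rightarrow> bool" where
  "clamped u \<longleftrightarrow> (\<forall>x\<in>sphere 0 1. u x = 0 \<and> normal_deriv u x = 0)"


section \<open>Classical solutions and subsolutions\<close>

definition g :: "real \<Rightarrow> real" where
  "g \<xi> = 1 / (1 + \<xi>)\<^sup>2"

definition solutions :: "real \<Rightarrow> real \<Rightarrow> real \<Rightarrow> ('a::euclidean_space \<Rightarrow> real) set" where
  "solutions B T l = {u. radial u \<and> Ck_on 4 (ball 0 1) u \<and> Ck_on 2 (cball 0 1) u \<and>
     (\<forall>x\<in>cball 0 1. u x > -1) \<and>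
     (\<forall>x\<in>ball 0 1. B * laplacian (laplacian u) x - T * laplacian u x = - l * g (u x)) \<and>
     clamped u}"

definition subsolutions :: "real \<Rightarrow> real \<Rightarrow> real \<Rightarrow> ('a::euclidean_space \<Rightarrow> real) set" where
  "subsolutions B T l = {u. radial u \<and> Ck_on 4 (ball 0 1) u \<and> Ck_on 2 (cball 0 1) u \<and>
     (\<forall>x\<in>cball 0 1. u x > -1) \<and>
     (\<forall>x\<in>ball 0 1. B * laplacian (laplacian u) x - T * laplacian u x \<le> - l * g (u x)) \<and>
     clamped u}"

definition maximal_solution :: "real \<Rightarrow> real \<Rightarrow> real \<Rightarrow> ('a::euclidean_space \<Rightarrow> real) \<Rightarrow> bool" where
  "maximal_solution B T l u \<longleftrightarrow> u \<in> solutions B T l \<and>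
     (\<forall>v\<in>subsolutions B T l. \<forall>x\<in>cball 0 1. v x \<le> u x)"

text \<open>The type argument fixes the space in which the ball lives.\<close>

definition admissible :: "'a::euclidean_space itself \<Rightarrow> real \<Rightarrow> real \<Rightarrow> real set" where
  "admissible _ B T = {l. l > 0 \<and> solutions B T l \<noteq> ({} :: ('a \<Rightarrow> real) set)}"

definition lambda_star :: "'a::euclidean_space itself \<Rightarrow> real \<Rightarrow> real \<Rightarrow> real" where
  "lambda_star A B T = Sup (admissible A B T)"


section \<open>Auxiliary facts about gradients on the closed unit ball\<close>

lemma has_derivative_unique_cball:
  fixes u :: "'a::euclidean_space \<Rightarrow> real"
  assumes D: "(u has_derivative D) (at x within cball 0 1)"
    and D': "(u has_derivative D') (at x within cball 0 1)" and x: "x \<in> cball 0 1"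
  shows "D = D'"
proof -
  define E where "E = (\<lambda>h. D h - D' h)"
  have "((\<lambda>x. u x - u x) has_derivative E) (at x within cball 0 1)"
    unfolding E_def by (rule has_derivative_diff[OF D D'])
  then have E: "((\<lambda>x. 0) has_derivative E) (at x within cball 0 1)" by simp
  then have lin: "linear E" by (rule has_derivative_linear)
  have seg: "E (y - x) = 0" if y: "y \<in> cball 0 1" for y
  proof -
    let ?p = "\<lambda>t::real. x + t *\<^sub>R (y - x)"
    have sub: "?p ` {0..1} \<subseteq> cball 0 1"
    proof
      fix z assume "z \<in> ?p ` {0..1}"
      then obtain t where t: "0 \<le> t" "t \<le> 1" "z = ?p t" by auto
      then have "z = (1 - t) *\<^sub>R x + t *\<^sub>R y" by (simp add: algebra_simps)
      then show "z \<in> cball 0 1"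
        using convex_cball[of "0::'a" 1] x y t unfolding convex_alt by blast
    qed
    have p: "(?p has_derivative (\<lambda>t. t *\<^sub>R (y - x))) (at 0 within {0..1})"
      by (auto intro!: derivative_eq_intros)
    have "((\<lambda>x. 0::real) has_derivative E) (at (?p 0) within ?p ` {0..1})"
      using has_derivative_subset[OF E sub] by simp
    from has_derivative_in_compose[OF p this]
    have "((\<lambda>t. 0::real) has_derivative (\<lambda>t. E (t *\<^sub>R (y - x)))) (at 0 within {0..1})" .
    then have "((\<lambda>t. 0::real) has_vector_derivative E (y - x)) (at 0 within {0..1})"
      by (simp add: has_vector_derivative_def linear_cmul[OF lin])
    moreover have "((\<lambda>t. 0::real) has_vector_derivative 0) (at 0 within {0..1})"
      by (simp add: has_vector_derivative_def)
    ultimately show ?thesis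
      by (intro vector_derivative_unique_within[of 0 "{0..1::real}"])
        (auto simp: trivial_limit_within islimpt_Icc)
  qed
  have Ex: "E x = 0" using seg[of 0] lin by (simp add: linear_neg)
  have E1: "E y = 0" if "y \<in> cball 0 1" for y
    using seg[OF that] Ex lin by (simp add: linear_diff)
  have "E h = 0" for h
  proof (cases "h = 0")
    case True then show ?thesis using lin by (simp add: linear_0)
  next
    case False
    then have "E ((1 / norm h) *\<^sub>R h) = 0" by (intro E1) simp
    then show ?thesis using False lin by (simp add: linear_cmul)
  qed
  then show ?thesis by (auto simp: E_def fun_eq_iff)
qed

lemma inner_sum_Basis:
  "(\<Sum>i\<in>Basis. c i *\<^sub>R i) \<bullet> h = (\<Sum>i\<in>Basis. (h \<bullet> i) * c i)"
  unfolding inner_sum_left by (intro sum.cong refl) (simp add: inner_commute[of h] mult.commute)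

lemma grad_inner:
  assumes D: "(u has_derivative D) (at x within cball 0 1)" and x: "x \<in> cball 0 1"
  shows "D h = grad u x \<bullet> h"
proof -
  have "(u has_derivative frechet_derivative u (at x within cball 0 1)) (at x within cball 0 1)"
    unfolding frechet_derivative_def by (rule someI[of _ D]) (rule D)
  from has_derivative_unique_cball[OF D this x]
  have eq: "frechet_derivative u (at x within cball 0 1) = D" by simp
  have "D h = D (\<Sum>i\<in>Basis. (h \<bullet> i) *\<^sub>R i)" by (simp add: euclidean_representation)
  also have "\<dots> = (\<Sum>i\<in>Basis. (h \<bullet> i) * D i)"
    using has_derivative_linear[OF D] by (simp add: linear_sum linear_cmul)
  also have "\<dots> = grad u x \<bullet> h"
    unfolding grad_def eq by (simp add: inner_sum_Basis)
  finally show ?thesis .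
qed

lemma grad_eqI:
  assumes "(u has_derivative (\<lambda>h. v \<bullet> h)) (at x within cball 0 1)" and "x \<in> cball 0 1"
  shows "grad u x = v"
  using grad_inner[OF assms] by (metis vector_eq_rdot)

lemma Ck_on_1_grad:
  assumes u: "Ck_on 1 (cball 0 1) u"
  shows "x \<in> cball 0 1 \<Longrightarrow> (u has_derivative (\<lambda>h. grad u x \<bullet> h)) (at x within cball 0 1)"
    and "continuous_on (cball 0 1) (grad u)"
    and "continuous_on (cball 0 1) u"
proof -
  from u have "\<exists>p. (\<forall>x\<in>cball 0 1.
        (u has_derivative (\<lambda>h. \<Sum>i\<in>Basis. (h \<bullet> i) * p i x)) (at x within cball 0 1)) \<and>
      (\<forall>i\<in>Basis. continuous_on (cball 0 1) (p i))" by simp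
  then obtain p
    where p: "\<And>x. x\<in>cball 0 1 \<Longrightarrow>
        (u has_derivative (\<lambda>h. \<Sum>i\<in>Basis. (h \<bullet> i) * p i x)) (at x within cball 0 1)"
      and c: "\<And>i. i\<in>Basis \<Longrightarrow> continuous_on (cball 0 1) (p i)" by blast
  have eq: "grad u x = (\<Sum>i\<in>Basis. p i x *\<^sub>R i)" if "x \<in> cball 0 1" for x
    by (rule grad_eqI[OF _ that])
      (use p[OF that] in \<open>simp add: inner_sum_Basis\<close>)
  show *: "(u has_derivative (\<lambda>h. grad u x \<bullet> h)) (at x within cball 0 1)" if "x \<in> cball 0 1" for x
    using p[OF that] by (simp add: eq[OF that] inner_sum_Basis)
  have "continuous_on (cball 0 1) (\<lambda>x. \<Sum>i\<in>Basis. p i x *\<^sub>R i)"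
    by (intro continuous_intros c)
  then show "continuous_on (cball 0 1) (grad u)"
    by (simp add: eq cong: continuous_on_cong_simp)
  show "continuous_on (cball 0 1) u"
    unfolding continuous_on_eq_continuous_within using * has_derivative_continuous by blast
qed

lemma Ck_on_add: "Ck_on k S u \<Longrightarrow> Ck_on k S v \<Longrightarrow> Ck_on k S (\<lambda>x. u x + v x)"
proof (induction k arbitrary: u v)
  case 0 then show ?case by (auto intro: continuous_on_add)
next
  case (Suc k)
  then obtain p q where
    p: "\<forall>x\<in>S. (u has_derivative (\<lambda>h. \<Sum>i\<in>Basis. (h \<bullet> i) * p i x)) (at x within S)"
      "\<forall>i\<in>Basis. Ck_on k S (p i)" and
    q: "\<forall>x\<in>S. (v has_derivative (\<lambda>h. \<Sum>i\<in>Basis. (h \<bullet> i) * q i x)) (at x within S)"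
      "\<forall>i\<in>Basis. Ck_on k S (q i)" unfolding Ck_on.simps by blast
  have "((\<lambda>x. u x + v x) has_derivative (\<lambda>h. \<Sum>i\<in>Basis. (h \<bullet> i) * (p i x + q i x))) (at x within S)"
    if "x \<in> S" for x
    using has_derivative_add[OF p(1)[rule_format, OF that] q(1)[rule_format, OF that]]
    by (simp add: distrib_left sum.distrib)
  moreover have "\<forall>i\<in>Basis. Ck_on k S (\<lambda>x. p i x + q i x)" using p(2) q(2) Suc.IH by blast
  ultimately show ?case
    unfolding Ck_on.simps by (intro exI[of _ "\<lambda>i x. p i x + q i x"]) blast
qed

lemma Ck_on_cmult: "Ck_on k S u \<Longrightarrow> Ck_on k S (\<lambda>x. c * u x)"
proof (induction k arbitrary: u)
  case 0 then show ?case by (auto intro: continuous_on_mult)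
next
  case (Suc k)
  then obtain p where
    p: "\<forall>x\<in>S. (u has_derivative (\<lambda>h. \<Sum>i\<in>Basis. (h \<bullet> i) * p i x)) (at x within S)"
      "\<forall>i\<in>Basis. Ck_on k S (p i)" unfolding Ck_on.simps by blast
  have "((\<lambda>x. c * u x) has_derivative (\<lambda>h. \<Sum>i\<in>Basis. (h \<bullet> i) * (c * p i x))) (at x within S)"
    if "x \<in> S" for x
    using has_derivative_mult_right[OF p(1)[rule_format, OF that], of c]
    by (simp add: sum_distrib_left mult.left_commute)
  moreover have "\<forall>i\<in>Basis. Ck_on k S (\<lambda>x. c * p i x)" using p(2) Suc.IH by blast
  ultimately show ?case
    unfolding Ck_on.simps by (intro exI[of _ "\<lambda>i x. c * p i x"]) blast
qed

lemma Ck_on_zero: "Ck_on k S (\<lambda>x. 0)"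
  by (induction k) (auto intro!: exI[of _ "\<lambda>i x. 0"])

lemma grad_add:
  assumes "Ck_on 1 (cball 0 1) u" "Ck_on 1 (cball 0 1) v" "x \<in> cball 0 1"
  shows "grad (\<lambda>x. u x + v x) x = grad u x + grad v x"
  using has_derivative_add[OF Ck_on_1_grad(1)[OF assms(1,3)] Ck_on_1_grad(1)[OF assms(2,3)]]
  by (intro grad_eqI[OF _ assms(3)]) (simp add: inner_add_left)

lemma grad_cmult:
  assumes "Ck_on 1 (cball 0 1) u" "x \<in> cball 0 1"
  shows "grad (\<lambda>x. c * u x) x = c *\<^sub>R grad u x"
  using has_derivative_mult_right[OF Ck_on_1_grad(1)[OF assms], of c]
  by (intro grad_eqI[OF _ assms(2)]) simp

lemma grad_zero: "x \<in> cball 0 1 \<Longrightarrow> grad (\<lambda>x. 0) x = 0"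
  by (rule grad_eqI) auto


section \<open>The space of radial \<open>C\<^sup>1\<close> functions with clamped boundary conditions\<close>

text \<open>
  Functions on the closed unit ball are represented by total functions vanishing outside of it,
  so that equality in the type is equality on the closed unit ball.
\<close>

typedef (overloaded) 'a C1Dr =
  "{u :: 'a::euclidean_space \<Rightarrow> real. Ck_on 1 (cball 0 1) u \<and> radial u \<and> clamped u \<and>
      (\<forall>x. x \<notin> cball 0 1 \<longrightarrow> u x = 0)}"
  morphisms c1fun Abs_C1Dr
  by (rule exI[of _ "\<lambda>x. 0"])
    (auto simp: Ck_on_zero radial_def clamped_def normal_deriv_def grad_zero simp del: Ck_on.simps)

setup_lifting type_definition_C1Dr

instantiation C1Dr :: (euclidean_space) real_normed_vector
begin

lift_definition zero_C1Dr :: "'a C1Dr" is "\<lambda>x. 0"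
  by (auto simp: Ck_on_zero radial_def clamped_def normal_deriv_def grad_zero simp del: Ck_on.simps)

lift_definition plus_C1Dr :: "'a C1Dr \<Rightarrow> 'a C1Dr \<Rightarrow> 'a C1Dr" is "\<lambda>u v x. u x + v x"
proof -
  fix u v :: "'a \<Rightarrow> real"
  assume u: "Ck_on 1 (cball 0 1) u \<and> radial u \<and> clamped u \<and> (\<forall>x. x \<notin> cball 0 1 \<longrightarrow> u x = 0)"
    and v: "Ck_on 1 (cball 0 1) v \<and> radial v \<and> clamped v \<and> (\<forall>x. x \<notin> cball 0 1 \<longrightarrow> v x = 0)"
  then have "Ck_on 1 (cball 0 1) (\<lambda>x. u x + v x)" by (blast intro: Ck_on_add)
  moreover have "radial (\<lambda>x. u x + v x)"
    using u v unfolding radial_def by metis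
  moreover have "clamped (\<lambda>x. u x + v x)"
    using u v by (auto simp: clamped_def normal_deriv_def grad_add inner_add_left simp del: Ck_on.simps)
  ultimately show "Ck_on 1 (cball 0 1) (\<lambda>x. u x + v x) \<and> radial (\<lambda>x. u x + v x) \<and>
      clamped (\<lambda>x. u x + v x) \<and> (\<forall>x. x \<notin> cball 0 1 \<longrightarrow> u x + v x = 0)"
    using u v by auto
qed

lift_definition scaleR_C1Dr :: "real \<Rightarrow> 'a C1Dr \<Rightarrow> 'a C1Dr" is "\<lambda>c u x. c * u x"
proof -
  fix c :: real and u :: "'a \<Rightarrow> real"
  assume u: "Ck_on 1 (cball 0 1) u \<and> radial u \<and> clamped u \<and> (\<forall>x. x \<notin> cball 0 1 \<longrightarrow> u x = 0)"
  then have "Ck_on 1 (cball 0 1) (\<lambda>x. c * u x)" by (blast intro: Ck_on_cmult)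
  moreover have "radial (\<lambda>x. c * u x)"
    using u unfolding radial_def by metis
  moreover have "clamped (\<lambda>x. c * u x)"
    using u by (auto simp: clamped_def normal_deriv_def grad_cmult simp del: Ck_on.simps)
  ultimately show "Ck_on 1 (cball 0 1) (\<lambda>x. c * u x) \<and> radial (\<lambda>x. c * u x) \<and>
      clamped (\<lambda>x. c * u x) \<and> (\<forall>x. x \<notin> cball 0 1 \<longrightarrow> c * u x = 0)"
    using u by auto
qed

definition uminus_C1Dr :: "'a C1Dr \<Rightarrow> 'a C1Dr" where "uminus_C1Dr u = (-1) *\<^sub>R u"

definition minus_C1Dr :: "'a C1Dr \<Rightarrow> 'a C1Dr \<Rightarrow> 'a C1Dr" where "minus_C1Dr u v = u + (- v)"

lift_definition norm_C1Dr :: "'a C1Dr \<Rightarrow> real" is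
  "\<lambda>u. (SUP x\<in>cball 0 1. \<bar>u x\<bar>) + (SUP x\<in>cball 0 1. norm (grad u x))" .

definition dist_C1Dr :: "'a C1Dr \<Rightarrow> 'a C1Dr \<Rightarrow> real" where "dist_C1Dr u v = norm (u - v)"

definition sgn_C1Dr :: "'a C1Dr \<Rightarrow> 'a C1Dr" where "sgn_C1Dr u = inverse (norm u) *\<^sub>R u"

definition uniformity_C1Dr :: "('a C1Dr \<times> 'a C1Dr) filter" where
  "uniformity_C1Dr = (INF e\<in>{0<..}. principal {(u, v). dist u v < e})"

definition open_C1Dr :: "'a C1Dr set \<Rightarrow> bool" where
  "open_C1Dr S = (\<forall>u\<in>S. \<forall>\<^sub>F (u', v) in uniformity. u' = u \<longrightarrow> v \<in> S)"

instance
proof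
  fix a b :: real and u v w :: "'a C1Dr"
  have bdd: "bdd_above ((\<lambda>x. \<bar>c1fun u x\<bar>) ` cball 0 1)"
    "bdd_above ((\<lambda>x. norm (grad (c1fun u) x)) ` cball 0 1)" for u :: "'a C1Dr"
  proof -
    have C: "Ck_on 1 (cball 0 1) (c1fun u)" using c1fun[of u] by auto
    have "compact ((\<lambda>x. \<bar>c1fun u x\<bar>) ` cball 0 1)"
      by (intro compact_continuous_image continuous_intros Ck_on_1_grad(3)[OF C] compact_cball)
    then show "bdd_above ((\<lambda>x. \<bar>c1fun u x\<bar>) ` cball 0 1)"
      by (intro bounded_imp_bdd_above compact_imp_bounded)
    have "compact ((\<lambda>x. norm (grad (c1fun u) x)) ` cball 0 1)"
      by (intro compact_continuous_image continuous_intros Ck_on_1_grad(2)[OF C] compact_cball)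
    then show "bdd_above ((\<lambda>x. norm (grad (c1fun u) x)) ` cball 0 1)"
      by (intro bounded_imp_bdd_above compact_imp_bounded)
  qed
  have ne: "cball (0::'a) 1 \<noteq> {}" by simp
  have C: "Ck_on 1 (cball 0 1) (c1fun u)" for u :: "'a C1Dr" using c1fun[of u] by auto
  show "u + v + w = u + (v + w)" by transfer (simp add: add.assoc)
  show "u + v = v + u" by transfer (simp add: add.commute)
  show "0 + u = u" by transfer simp
  show "- u + u = 0" unfolding uminus_C1Dr_def by transfer simp
  show "u - v = u + - v" by (rule minus_C1Dr_def)
  show "a *\<^sub>R (u + v) = a *\<^sub>R u + a *\<^sub>R v" by transfer (simp add: distrib_left)
  show "(a + b) *\<^sub>R u = a *\<^sub>R u + b *\<^sub>R u" by transfer (simp add: distrib_right)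
  show "a *\<^sub>R b *\<^sub>R u = (a * b) *\<^sub>R u" by transfer (simp add: mult.assoc)
  show "1 *\<^sub>R u = u" by transfer simp
  show "dist u v = norm (u - v)" by (rule dist_C1Dr_def)
  show "sgn u = inverse (norm u) *\<^sub>R u" by (rule sgn_C1Dr_def)
  show "uniformity = (INF e\<in>{0<..}. principal {(u, v). dist u (v::'a C1Dr) < e})"
    by (rule uniformity_C1Dr_def)
  show "open S \<longleftrightarrow> (\<forall>u\<in>S. \<forall>\<^sub>F (u', v) in uniformity. u' = u \<longrightarrow> v \<in> S)" for S :: "'a C1Dr set"
    by (rule open_C1Dr_def)
  have zero: "norm (0::'a C1Dr) = 0"
    by transfer (simp add: grad_zero)
  have pos: "0 \<le> (SUP x\<in>cball 0 1. norm (grad (c1fun u) x))" for u :: "'a C1Dr"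
    by (rule order_trans[OF norm_ge_zero cSUP_upper[OF _ bdd(2), of 0]]) simp
  have le: "\<bar>c1fun u x\<bar> \<le> norm u" if "x \<in> cball 0 1" for u :: "'a C1Dr" and x
    using cSUP_upper[OF that bdd(1)[of u]] pos[of u] unfolding norm_C1Dr.rep_eq by linarith
  show "norm u = 0 \<longleftrightarrow> u = 0"
  proof
    assume n: "norm u = 0"
    have "c1fun u x = 0" for x
    proof (cases "x \<in> cball 0 1")
      case True then show ?thesis using le[OF True, of u] n by simp
    next
      case False then show ?thesis using c1fun[of u] by simp
    qed
    then show "u = 0" by transfer auto
  qed (simp add: zero)
  show "norm (u + v) \<le> norm u + norm v"
  proof -
    have "(SUP x\<in>cball 0 1. \<bar>c1fun (u + v) x\<bar>)
        \<le> (SUP x\<in>cball 0 1. \<bar>c1fun u x\<bar>) + (SUP x\<in>cball 0 1. \<bar>c1fun v x\<bar>)"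
    proof (rule cSUP_least[OF ne])
      fix x :: 'a assume x: "x \<in> cball 0 1"
      show "\<bar>c1fun (u + v) x\<bar> \<le> (SUP x\<in>cball 0 1. \<bar>c1fun u x\<bar>) + (SUP x\<in>cball 0 1. \<bar>c1fun v x\<bar>)"
        using cSUP_upper[OF x bdd(1)[of u]] cSUP_upper[OF x bdd(1)[of v]]
        by (simp add: plus_C1Dr.rep_eq)
    qed
    moreover have "(SUP x\<in>cball 0 1. norm (grad (c1fun (u + v)) x))
        \<le> (SUP x\<in>cball 0 1. norm (grad (c1fun u) x)) + (SUP x\<in>cball 0 1. norm (grad (c1fun v) x))"
    proof (rule cSUP_least[OF ne])
      fix x :: 'a assume x: "x \<in> cball 0 1"
      show "norm (grad (c1fun (u + v)) x)
        \<le> (SUP x\<in>cball 0 1. norm (grad (c1fun u) x)) + (SUP x\<in>cball 0 1. norm (grad (c1fun v) x))"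
        using cSUP_upper[OF x bdd(2)[of u]] cSUP_upper[OF x bdd(2)[of v]]
          norm_triangle_ineq[of "grad (c1fun u) x" "grad (c1fun v) x"]
        by (simp add: plus_C1Dr.rep_eq grad_add[OF C C x])
    qed
    ultimately show ?thesis unfolding norm_C1Dr.rep_eq by linarith
  qed
  have le_scale: "norm (a *\<^sub>R u) \<le> \<bar>a\<bar> * norm u" for a and u :: "'a C1Dr"
  proof -
    have "(SUP x\<in>cball 0 1. \<bar>c1fun (a *\<^sub>R u) x\<bar>) \<le> \<bar>a\<bar> * (SUP x\<in>cball 0 1. \<bar>c1fun u x\<bar>)"
      by (rule cSUP_least[OF ne])
        (auto simp: scaleR_C1Dr.rep_eq abs_mult intro!: mult_left_mono cSUP_upper bdd(1))
    moreover have "(SUP x\<in>cball 0 1. norm (grad (c1fun (a *\<^sub>R u)) x))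
        \<le> \<bar>a\<bar> * (SUP x\<in>cball 0 1. norm (grad (c1fun u) x))"
    proof (rule cSUP_least[OF ne])
      fix x :: 'a assume x: "x \<in> cball 0 1"
      show "norm (grad (c1fun (a *\<^sub>R u)) x)
        \<le> \<bar>a\<bar> * (SUP x\<in>cball 0 1. norm (grad (c1fun u) x))"
        using cSUP_upper[OF x bdd(2)[of u]]
        by (simp add: scaleR_C1Dr.rep_eq grad_cmult[OF C x] mult_left_mono)
    qed
    ultimately show ?thesis unfolding norm_C1Dr.rep_eq by (simp add: distrib_left)
  qed
  show "norm (a *\<^sub>R u) = \<bar>a\<bar> * norm u"
  proof (cases "a = 0")
    case True
    have "0 *\<^sub>R u = 0" by transfer simp
    then show ?thesis using True zero by simp
  next
    case False
    have "inverse a *\<^sub>R (a *\<^sub>R u) = u"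
      using False by (simp add: c1fun_inject[symmetric] scaleR_C1Dr.rep_eq fun_eq_iff)
    then have "norm u \<le> \<bar>inverse a\<bar> * norm (a *\<^sub>R u)"
      using le_scale[of "inverse a" "a *\<^sub>R u"] by simp
    then have "\<bar>a\<bar> * norm u \<le> norm (a *\<^sub>R u)"
      using False by (simp add: field_simps)
    then show ?thesis using le_scale[of a u] by simp
  qed
qed

end


section \<open>Sobolev spaces on the unit ball and the operator \<open>A = B \<Delta>\<^sup>2 - T \<Delta>\<close>\<close>

definition L2_ball :: "('a::euclidean_space \<Rightarrow> real) \<Rightarrow> bool" where
  "L2_ball f \<longleftrightarrow> f \<in> borel_measurable (lebesgue_on (ball 0 1)) \<and>
     integrable (lebesgue_on (ball 0 1)) (\<lambda>x. (f x)\<^sup>2)"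

definition test_function :: "('a::euclidean_space \<Rightarrow> real) \<Rightarrow> bool" where
  "test_function \<phi> \<longleftrightarrow> (\<forall>k. Ck_on k UNIV \<phi>) \<and>
     (\<exists>K. compact K \<and> K \<subseteq> ball 0 1 \<and> (\<forall>x. x \<notin> K \<longrightarrow> \<phi> x = 0))"

text \<open>\<open>w\<close> is the weak partial derivative of \<open>u\<close> in direction \<open>i\<close>, both lying in \<open>L\<^sub>2\<close>.\<close>

definition weak_partial :: "'a::euclidean_space \<Rightarrow> ('a \<Rightarrow> real) \<Rightarrow> ('a \<Rightarrow> real) \<Rightarrow> bool" where
  "weak_partial i u w \<longleftrightarrow> L2_ball u \<and> L2_ball w \<and>
     (\<forall>\<phi>. test_function \<phi> \<longrightarrow>
        (LINT x|lebesgue_on (ball 0 1). u x * partial i \<phi> x) =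
        - (LINT x|lebesgue_on (ball 0 1). w x * \<phi> x))"

primrec Sobolev :: "nat \<Rightarrow> ('a::euclidean_space \<Rightarrow> real) \<Rightarrow> bool" where
  "Sobolev 0 u \<longleftrightarrow> L2_ball u"
| "Sobolev (Suc k) u \<longleftrightarrow> L2_ball u \<and> (\<forall>i\<in>Basis. \<exists>w. weak_partial i u w \<and> Sobolev k w)"

definition weak_laplacian :: "('a::euclidean_space \<Rightarrow> real) \<Rightarrow> ('a \<Rightarrow> real) \<Rightarrow> bool" where
  "weak_laplacian u w \<longleftrightarrow>
     (\<exists>p q. (\<forall>i\<in>Basis. weak_partial i u (p i) \<and> weak_partial i (p i) (q i)) \<and>
            w = (\<lambda>x. \<Sum>i\<in>Basis. q i x))"

definition A_eq :: "real \<Rightarrow> real \<Rightarrow> ('a::euclidean_space \<Rightarrow> real) \<Rightarrow> ('a \<Rightarrow> real) \<Rightarrow> bool" where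
  "A_eq B T v f \<longleftrightarrow> (\<exists>w z. weak_laplacian v w \<and> weak_laplacian w z \<and>
     (AE x in lebesgue_on (ball 0 1). B * z x - T * w x = f x))"

text \<open>
  \<open>A\<inverse>\<close> maps \<open>L\<^sub>2\<^sub>,\<^sub>r\<close> onto \<open>H\<^sup>4\<^sub>D\<^sub>,\<^sub>r\<close>. Since the dimension is at most 2, \<open>H\<^sup>4\<close> embeds into
  \<open>C\<^sup>1\<close>, so \<open>H\<^sup>4\<^sub>D\<^sub>,\<^sub>r\<close> consists of those elements of \<open>C\<^sup>1\<^sub>D\<^sub>,\<^sub>r\<close> that lie in \<open>H\<^sup>4\<close>.
\<close>

definition A_inv :: "real \<Rightarrow> real \<Rightarrow> ('a::euclidean_space \<Rightarrow> real) \<Rightarrow> 'a C1Dr" where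
  "A_inv B T f = (THE v. Sobolev 4 (c1fun v) \<and> A_eq B T (c1fun v) f)"


section \<open>The nonlinear map \<open>F\<close> and its nonsingular zeros\<close>

definition dom_O :: "'a::euclidean_space C1Dr set" where
  "dom_O = {u. \<forall>x\<in>cball 0 1. \<bar>c1fun u x\<bar> < 1}"

definition F_map :: "real \<Rightarrow> real \<Rightarrow> real \<Rightarrow> 'a::euclidean_space C1Dr \<Rightarrow> 'a C1Dr" where
  "F_map B T l u = u + l *\<^sub>R A_inv B T (\<lambda>x. g (c1fun u x))"

text \<open>The partial Frechet derivative of \<open>F\<close> with respect to \<open>u\<close>.\<close>

definition F_u :: "real \<Rightarrow> real \<Rightarrow> real \<Rightarrow> 'a::euclidean_space C1Dr \<Rightarrow> 'a C1Dr \<Rightarrow> 'a C1Dr" where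
  "F_u B T l u w = w + l *\<^sub>R A_inv B T (\<lambda>x. deriv g (c1fun u x) * c1fun w x)"

definition boundedly_invertible :: "('v::real_normed_vector \<Rightarrow> 'v) \<Rightarrow> bool" where
  "boundedly_invertible L \<longleftrightarrow> bounded_linear L \<and>
     (\<exists>M. bounded_linear M \<and> L \<circ> M = id \<and> M \<circ> L = id)"

definition nonsingular_zeros :: "real \<Rightarrow> real \<Rightarrow> (real \<times> 'a::euclidean_space C1Dr) set" where
  "nonsingular_zeros B T = {(l, u). 0 < l \<and> u \<in> dom_O \<and> F_map B T l u = 0 \<and>
     boundedly_invertible (F_u B T l u)}"


section \<open>Real analytic curves and the primary branch\<close>

text \<open>Near \<open>t \<in> I\<close> the curve is given on \<open>I\<close> by a power series about \<open>t\<close>; if \<open>t\<close> is an endpoint of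
  the interval \<open>I\<close>, this means analytic extendability across \<open>t\<close>.\<close>

definition real_analytic_at :: "(real \<Rightarrow> 'v::real_normed_vector) \<Rightarrow> real set \<Rightarrow> real \<Rightarrow> bool" where
  "real_analytic_at f I t \<longleftrightarrow>
     (\<exists>a r. 0 < r \<and> (\<forall>x\<in>I. \<bar>x - t\<bar> < r \<longrightarrow> (\<lambda>n. (x - t) ^ n *\<^sub>R a n) sums f x))"

definition real_analytic_on :: "(real \<Rightarrow> 'v::real_normed_vector) \<Rightarrow> real set \<Rightarrow> bool" where
  "real_analytic_on f I \<longleftrightarrow> (\<forall>t\<in>I. real_analytic_at f I t)"

definition branch_on :: "real \<Rightarrow> real \<Rightarrow> ereal \<Rightarrow> (real \<Rightarrow> 'a::euclidean_space C1Dr) \<Rightarrow> bool" where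
  "branch_on B T l0 V \<longleftrightarrow> 0 < l0 \<and> real_analytic_on V {l. 0 \<le> l \<and> ereal l < l0} \<and> V 0 = 0 \<and>
     (\<forall>l. 0 \<le> l \<and> ereal l < l0 \<longrightarrow>
        V l \<in> dom_O \<and> F_map B T l (V l) = 0 \<and> boundedly_invertible (F_u B T l (V l)))"

definition maximal_branch :: "real \<Rightarrow> real \<Rightarrow> ereal \<Rightarrow> (real \<Rightarrow> 'a::euclidean_space C1Dr) \<Rightarrow> bool" where
  "maximal_branch B T l0 V \<longleftrightarrow> branch_on B T l0 V \<and>
     (\<forall>l1 (V1 :: real \<Rightarrow> 'a C1Dr). branch_on B T l1 V1 \<longrightarrow> l1 \<le> l0)"

definition branch_graph :: "ereal \<Rightarrow> (real \<Rightarrow> 'v) \<Rightarrow> (real \<times> 'v) set" where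
  "branch_graph l0 V = {(l, V l) | l. 0 < l \<and> ereal l < l0}"

end

theory Submission
  imports Defs
begin

text \<open>
  Everything rests on lowering the order of the problem. Let \<open>u\<close> be a radial solution with
  parameter \<open>\<lambda>\<close> and profile \<open>\<phi>\<close>, so that \<open>u x = \<phi> (norm x)\<close>, and let \<open>d\<close> be the dimension. Integrating
  the equation once over balls gives, for the function \<open>\<phi>'\<close>, the second-order Dirichlet problem
  \<open>L \<phi>' = m r / r ^ (d - 1)\<close> with \<open>\<phi>' 0 = \<phi>' 1 = 0\<close>, where
  \<open>L z = - B (z'' + (d - 1) (z' / r - z / r\<^sup>2)) + T z\<close> and \<open>m r\<close> is the integral of
  \<open>\<lambda> g (\<phi> t) t ^ (d - 1)\<close> over \<open>0 \<le> t \<le> r\<close>: up to the area of the unit sphere, the total load on the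
  ball of radius \<open>r\<close>. The operator \<open>L\<close> satisfies the maximum principle, and
  \<open>sqrt r\<close> is a barrier for every right-hand side bounded by a multiple of \<open>r ^ (- 3 / 2)\<close>
  (lemma \<open>sqrt_barrier\<close>), in particular for \<open>1 / r ^ (d - 1)\<close> in dimensions one and two.

  Hence \<open>\<phi>\<close> is nondecreasing, the load density \<open>\<lambda> g (\<phi> r)\<close> is nonincreasing, and \<open>m\<close> is controlled
  everywhere by its value \<open>M\<close> at one fixed radius. Comparing \<open>\<phi>'\<close> from below with a multiple of
  \<open>r\<^sup>2 - r ^ 3\<close> and using \<open>\<phi> > -1\<close> bounds \<open>M\<close> independently of \<open>\<lambda>\<close>; comparing from above
  with the barrier shows \<open>\<phi> r \<le> \<phi> 0 + C r ^ (3 / 2)\<close>. If \<open>\<phi> 0\<close> is close to \<open>-1\<close>, the density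
  \<open>\<lambda> / (1 + \<phi> r)\<^sup>2\<close> would therefore be too large near the centre for the bounded mass \<open>m\<close>, unless
  \<open>\<lambda>\<close> is small: touchdown forces \<open>\<lambda>\<close> to \<open>0\<close> (lemma \<open>parameter_le\<close>). The lower bound keeps
  \<open>\<phi>\<close> away from \<open>-1\<close> off the centre, so the density tends to zero there and the load concentrates
  at the centre: \<open>m\<close> is nearly the constant \<open>M\<close> outside a small ball, and \<open>\<phi>'\<close> is uniformly close to
  \<open>M G\<close>, where \<open>L G = 1 / r ^ (d - 1)\<close> and \<open>G 0 = G 1 = 0\<close> (lemma \<open>phi1_approx\<close>). The factor \<open>M\<close> is
  determined in the limit because \<open>\<phi>'\<close> has integral \<open>- \<phi> 0\<close>, which tends to \<open>1\<close>. So \<open>\<omega>\<close> is the radial function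
  with profile \<open>-1\<close> plus the normalised primitive of \<open>G\<close>. The function \<open>G\<close> is obtained by reduction
  of order from the power series solution of the homogeneous equation, for all \<open>T \<ge> 0\<close> at once.

  The second assertion follows from the first. The point with parameter \<open>\<lambda>\<close> on the primary branch
  gives \<open>s\<^sub>1 < s\<^sub>*\<close>. Since \<open>\<Lambda>\<close> equals \<open>\<lambda>\<^sub>*\<close> at \<open>s\<^sub>*\<close> and tends to \<open>0\<close>, it takes the value \<open>\<lambda>\<close> again at
  some \<open>s\<^sub>2 > s\<^sub>*\<close>. Maximality of the primary branch orders the two solutions, and injectivity of the
  curve on nonsingular points makes them distinct.
\<close>

section \<open>Functions of class \<open>C\<^sup>k\<close> and Laplacians of radial functions\<close>

lemma Ck_on_cong:
  assumes "\<And>x. x \<in> S \<Longrightarrow> u x = v x" "Ck_on k S u"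
  shows "Ck_on k S v"
proof (cases k)
  case 0
  then show ?thesis using assms continuous_on_cong[OF refl assms(1)] by simp
next
  case (Suc k')
  with assms(2) obtain p where
    p: "\<forall>x\<in>S. (u has_derivative (\<lambda>h. \<Sum>i\<in>Basis. (h \<bullet> i) * p i x)) (at x within S)"
      "\<forall>i\<in>Basis. Ck_on k' S (p i)" by auto
  have "\<forall>x\<in>S. (v has_derivative (\<lambda>h. \<Sum>i\<in>Basis. (h \<bullet> i) * p i x)) (at x within S)"
    using p(1) assms(1) by (intro ballI has_derivative_transform[OF _ _ bspec[OF p(1)]]) auto
  then show ?thesis using p(2) Suc by auto
qed

lemma Ck_on_SucD: "Ck_on (Suc k) S u \<Longrightarrow> Ck_on k S u"
proof (induction k arbitrary: u)
  case 0
  then show ?case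
    unfolding Ck_on.simps continuous_on_eq_continuous_within using has_derivative_continuous by blast
next
  case (Suc k)
  from Suc.prems obtain p where
    p: "\<forall>x\<in>S. (u has_derivative (\<lambda>h. \<Sum>i\<in>Basis. (h \<bullet> i) * p i x)) (at x within S)"
      "\<forall>i\<in>Basis. Ck_on (Suc k) S (p i)" unfolding Ck_on.simps(2)[of "Suc k"] by blast
  then have "\<forall>i\<in>Basis. Ck_on k S (p i)" using Suc.IH by blast
  with p(1) show ?case by auto
qed

lemma Ck_on_const: "Ck_on k S (\<lambda>x. c)"
proof (cases k)
  case (Suc k')
  then show ?thesis
    unfolding Suc Ck_on.simps by (intro exI[of _ "\<lambda>i x. 0"]) (simp add: Ck_on_zero)
qed simp

lemma Ck_on_inner: "Ck_on k S (\<lambda>x. x \<bullet> j)"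
proof (cases k)
  case 0
  then show ?thesis by (simp add: continuous_on_inner)
next
  case (Suc k')
  have "((\<lambda>x. x \<bullet> j) has_derivative (\<lambda>h. \<Sum>i\<in>Basis. (h \<bullet> i) * (j \<bullet> i))) (at x within S)" for x
  proof -
    have "(\<Sum>i\<in>Basis. (h \<bullet> i) * (j \<bullet> i)) = h \<bullet> j" for h
      by (rule euclidean_inner[symmetric])
    then show ?thesis using has_derivative_inner_left[OF has_derivative_ident, of j] by simp
  qed
  then show ?thesis
    unfolding Suc Ck_on.simps by (intro exI[of _ "\<lambda>i x. j \<bullet> i"]) (auto simp: Ck_on_const)
qed

lemma Ck_on_sum: "finite I \<Longrightarrow> (\<And>i. i \<in> I \<Longrightarrow> Ck_on k S (u i)) \<Longrightarrow> Ck_on k S (\<lambda>x. \<Sum>i\<in>I. u i x)"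
  by (induction I rule: finite_induct) (auto intro: Ck_on_add simp: Ck_on_zero)

lemma Ck_on_mult: "Ck_on k S u \<Longrightarrow> Ck_on k S v \<Longrightarrow> Ck_on k S (\<lambda>x. u x * v x)"
proof (induction k arbitrary: u v)
  case 0 then show ?case by (auto intro: continuous_on_mult)
next
  case (Suc k)
  note uv = Ck_on_SucD[OF Suc.prems(1)] Ck_on_SucD[OF Suc.prems(2)]
  from Suc.prems obtain p q where
    p: "\<forall>x\<in>S. (u has_derivative (\<lambda>h. \<Sum>i\<in>Basis. (h \<bullet> i) * p i x)) (at x within S)"
      "\<forall>i\<in>Basis. Ck_on k S (p i)" and
    q: "\<forall>x\<in>S. (v has_derivative (\<lambda>h. \<Sum>i\<in>Basis. (h \<bullet> i) * q i x)) (at x within S)"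
      "\<forall>i\<in>Basis. Ck_on k S (q i)" unfolding Ck_on.simps by blast
  have "((\<lambda>x. u x * v x) has_derivative
      (\<lambda>h. \<Sum>i\<in>Basis. (h \<bullet> i) * (u x * q i x + p i x * v x))) (at x within S)"
    if "x \<in> S" for x
    using has_derivative_mult[OF p(1)[rule_format, OF that] q(1)[rule_format, OF that]]
    by (simp add: distrib_left sum.distrib sum_distrib_left sum_distrib_right mult_ac)
  moreover have "\<forall>i\<in>Basis. Ck_on k S (\<lambda>x. u x * q i x + p i x * v x)"
    using p(2) q(2) Suc.IH uv by (auto intro!: Ck_on_add)
  ultimately show ?case
    unfolding Ck_on.simps by (intro exI[of _ "\<lambda>i x. u x * q i x + p i x * v x"]) blast
qed

lemma Ck_on_inverse:
  assumes "\<And>x. x \<in> S \<Longrightarrow> u x \<noteq> 0"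
  shows "Ck_on k S u \<Longrightarrow> Ck_on k S (\<lambda>x. inverse (u x))"
proof (induction k)
  case 0 then show ?case using assms by (auto intro: continuous_on_inverse)
next
  case (Suc k)
  have inv: "Ck_on k S (\<lambda>x. inverse (u x))" by (rule Suc.IH[OF Ck_on_SucD[OF Suc.prems]])
  from Suc.prems obtain p where
    p: "\<forall>x\<in>S. (u has_derivative (\<lambda>h. \<Sum>i\<in>Basis. (h \<bullet> i) * p i x)) (at x within S)"
      "\<forall>i\<in>Basis. Ck_on k S (p i)" unfolding Ck_on.simps by blast
  let ?q = "\<lambda>i x. - 1 * (inverse (u x) * inverse (u x) * p i x)"
  have "((\<lambda>x. inverse (u x)) has_derivative (\<lambda>h. \<Sum>i\<in>Basis. (h \<bullet> i) * ?q i x)) (at x within S)"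
    if "x \<in> S" for x
    by (rule has_derivative_eq_rhs[OF Deriv.has_derivative_inverse[OF assms[OF that] p(1)[rule_format, OF that]]])
      (simp add: sum_distrib_left sum_distrib_right mult_ac sum_negf)
  moreover have "\<forall>i\<in>Basis. Ck_on k S (?q i)"
    by (intro ballI, rule Ck_on_cmult) (auto intro!: Ck_on_mult inv p(2)[rule_format])
  ultimately show ?case
    unfolding Ck_on.simps by (intro exI[of _ ?q]) blast
qed

lemma Ck_on_SucI_real:
  fixes u :: "real \<Rightarrow> real"
  assumes "\<And>x. x \<in> S \<Longrightarrow> (u has_real_derivative u' x) (at x)" "Ck_on k S u'"
  shows "Ck_on (Suc k) S u"
proof -
  have "(u has_derivative (\<lambda>h. \<Sum>i\<in>Basis. (h \<bullet> i) * u' x)) (at x within S)" if "x \<in> S" for x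
    using has_field_derivative_at_within[OF assms(1)[OF that], of S]
    by (simp add: has_field_derivative_def mult_commute_abs)
  then show ?thesis using assms(2) by (auto intro!: exI[of _ "\<lambda>i. u'"])
qed

lemma has_derivative_radial:
  fixes x :: "'a::euclidean_space"
  assumes "(\<phi> has_real_derivative c) (at (norm x) within norm ` S)" "x \<noteq> 0"
  shows "((\<lambda>y. \<phi> (norm y)) has_derivative (\<lambda>h. (c / norm x) * (x \<bullet> h))) (at x within S)"
proof -
  have "(norm has_derivative (\<lambda>h. x \<bullet> h / norm x)) (at x within S)"
    using has_derivative_norm[OF assms(2)]
    by (auto intro: has_derivative_at_withinI simp: sgn_div_norm inner_commute divide_inverse mult.commute)
  from has_derivative_in_compose[OF this assms(1)[unfolded has_field_derivative_def]]
  show ?thesis by simp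
qed

text \<open>
  One derivative of \<open>\<phi> (norm x)\<close> produces the radial factor \<open>\<phi>' r / r\<close>, which is as smooth as \<open>\<phi>'\<close> away
  from the centre; hence the induction runs over all profiles at once.
\<close>

lemma Ck_on_radial:
  fixes S :: "'a::euclidean_space set"
  assumes "0 \<notin> S"
  shows "Ck_on k {0<..} \<phi> \<Longrightarrow> Ck_on k S (\<lambda>x. \<phi> (norm x))"
proof (induction k arbitrary: \<phi>)
  case 0
  have "continuous_on S (\<phi> \<circ> norm)"
    using 0 assms by (intro continuous_on_compose continuous_intros) (auto elim!: continuous_on_subset)
  then show ?case by (simp add: o_def)
next
  case (Suc k)
  from Suc.prems obtain p where
    p: "\<forall>r\<in>{0<..}. (\<phi> has_derivative (\<lambda>h. \<Sum>i\<in>Basis. (h \<bullet> i) * p i r)) (at r within {0<..})"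
      "\<forall>i\<in>Basis. Ck_on k {0<..} (p i)" unfolding Ck_on.simps by blast
  let ?\<psi> = "\<lambda>r. p 1 r * inverse r"
  have d: "(\<phi> has_real_derivative p 1 r) (at r)" if "0 < r" for r
    using bspec[OF p(1), of r] that at_within_open[of r "{0<..}"]
    by (simp add: has_field_derivative_def mult_commute_abs)
  have id: "Ck_on k {0<..} (\<lambda>r::real. r)" using Ck_on_inner[of k "{0<..}" "1::real"] by simp
  have "Ck_on k {0<..} ?\<psi>"
    using p(2) id by (intro Ck_on_mult Ck_on_inverse) auto
  then have \<psi>: "Ck_on k S (\<lambda>x. ?\<psi> (norm x))" by (rule Suc.IH)
  have "((\<lambda>x. \<phi> (norm x)) has_derivative (\<lambda>h. \<Sum>i\<in>Basis. (h \<bullet> i) * (?\<psi> (norm x) * (x \<bullet> i)))) (at x within S)"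
    if "x \<in> S" for x
  proof -
    have "x \<noteq> 0" using that assms by auto
    then have "((\<lambda>x. \<phi> (norm x)) has_derivative (\<lambda>h. (p 1 (norm x) / norm x) * (x \<bullet> h))) (at x within S)"
      by (intro has_derivative_radial has_field_derivative_at_within[OF d]) auto
    moreover have "(p 1 (norm x) / norm x) * (x \<bullet> h) = (\<Sum>i\<in>Basis. (h \<bullet> i) * (?\<psi> (norm x) * (x \<bullet> i)))" for h
      by (subst euclidean_inner) (simp add: sum_distrib_left divide_inverse mult_ac)
    ultimately show ?thesis by simp
  qed
  moreover have "\<forall>i\<in>Basis. Ck_on k S (\<lambda>x. ?\<psi> (norm x) * (x \<bullet> i))"
    by (intro ballI Ck_on_mult \<psi> Ck_on_inner)
  ultimately show ?case
    unfolding Ck_on.simps by (intro exI[of _ "\<lambda>i x. ?\<psi> (norm x) * (x \<bullet> i)"]) blast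
qed

lemma partial_eqI: "(u has_derivative D) (at x) \<Longrightarrow> partial i u x = D i"
  unfolding partial_def by (metis frechet_derivative_at)

lemma partial_cong_open:
  assumes "open S" "x \<in> S" "\<And>y. y \<in> S \<Longrightarrow> u y = v y"
  shows "partial i u x = partial i v x"
proof -
  have "(u has_derivative D) (at x) \<longleftrightarrow> (v has_derivative D) (at x)" for D
    by (auto elim!: has_derivative_transform_within_open[OF _ assms(1,2)] simp: assms(3))
  then show ?thesis unfolding partial_def frechet_derivative_def by simp
qed

lemma Ck_on_open_partial:
  assumes "open S" "Ck_on (Suc k) S u"
  shows "x \<in> S \<Longrightarrow> (u has_derivative (\<lambda>h. \<Sum>i\<in>Basis. (h \<bullet> i) * partial i u x)) (at x)"
    and "i \<in> Basis \<Longrightarrow> Ck_on k S (partial i u)"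
proof -
  from assms(2) obtain p where
    p: "\<forall>x\<in>S. (u has_derivative (\<lambda>h. \<Sum>i\<in>Basis. (h \<bullet> i) * p i x)) (at x within S)"
      "\<forall>i\<in>Basis. Ck_on k S (p i)" unfolding Ck_on.simps by blast
  have D: "(u has_derivative (\<lambda>h. \<Sum>i\<in>Basis. (h \<bullet> i) * p i x)) (at x)" if "x \<in> S" for x
    using bspec[OF p(1) that] at_within_open[OF that assms(1)] by simp
  have eq: "partial i u x = p i x" if "x \<in> S" "i \<in> Basis" for x i
  proof -
    have "(\<Sum>j\<in>Basis. (i \<bullet> j) * p j x) = (\<Sum>j\<in>Basis. if j = i then p j x else 0)"
      using that(2) by (intro sum.cong) (auto simp: inner_Basis)
    then show ?thesis using partial_eqI[OF D[OF that(1)], of i] that(2) by simp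
  qed
  show "(u has_derivative (\<lambda>h. \<Sum>i\<in>Basis. (h \<bullet> i) * partial i u x)) (at x)" if "x \<in> S"
    using D[OF that] by (simp add: eq[OF that])
  show "Ck_on k S (partial i u)" if "i \<in> Basis"
    by (rule Ck_on_cong[OF _ p(2)[rule_format, OF that]]) (rule eq[OF _ that, symmetric])
qed

lemma Ck_on_laplacian:
  assumes "open S" "Ck_on (Suc (Suc k)) S u"
  shows "Ck_on k S (laplacian u)"
proof -
  have "Ck_on k S (partial i (partial i u))" if i: "i \<in> Basis" for i
  proof -
    have "Ck_on (Suc k) S (partial i u)" by (rule Ck_on_open_partial(2)[OF assms i])
    then show ?thesis by (rule Ck_on_open_partial(2)[OF assms(1) _ i])
  qed
  then have "Ck_on k S (\<lambda>x. \<Sum>i\<in>Basis. partial i (partial i u) x)"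
    by (rule Ck_on_sum[OF finite_Basis])
  moreover have "laplacian u = (\<lambda>x. \<Sum>i\<in>Basis. partial i (partial i u) x)"
    by (rule ext) (rule laplacian_def)
  ultimately show ?thesis by (simp only:)
qed

text \<open>
  On a set avoiding the centre, \<open>u\<close> agrees with \<open>\<phi> (norm x)\<close>, whose partial derivatives are
  \<open>\<phi>1 (norm x) / norm x\<close> times the coordinates. Asking for this only on an open set allows the
  lemma to be applied twice, to \<open>u\<close> and to its Laplacian, and yields the fourth-order equation.
\<close>

lemma laplacian_radial:
  fixes u :: "'a::euclidean_space \<Rightarrow> real"
  assumes S: "open S" "0 \<notin> S" and x: "x \<in> S"
    and u: "\<And>y. y \<in> S \<Longrightarrow> u y = \<phi> (norm y)"
    and d1: "\<And>y. y \<in> S \<Longrightarrow> (\<phi> has_real_derivative \<phi>1 (norm y)) (at (norm y))"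
    and d2: "(\<phi>1 has_real_derivative c) (at (norm x))"
  shows "laplacian u x = c + (real DIM('a) - 1) * (\<phi>1 (norm x) / norm x)"
proof -
  let ?n = "norm x"
  have n: "?n > 0" using S x by auto
  have p: "partial i u y = (\<phi>1 (norm y) / norm y) * (y \<bullet> i)" if "y \<in> S" for i y
  proof -
    have "partial i u y = partial i (\<lambda>y. \<phi> (norm y)) y"
      by (rule partial_cong_open[OF S(1) that u])
    moreover have "y \<noteq> 0" using that S by auto
    ultimately show ?thesis
      using partial_eqI[OF has_derivative_radial[where S=UNIV, OF has_field_derivative_at_within[OF d1[OF that]]]]
      by auto
  qed
  have pp: "partial i (partial i u) x = ((c * ?n - \<phi>1 ?n) / ?n\<^sup>2 / ?n) * (x \<bullet> i)\<^sup>2 + \<phi>1 ?n / ?n"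
    if i: "i \<in> Basis" for i
  proof -
    have "((\<lambda>r. \<phi>1 r / r) has_real_derivative (c * ?n - \<phi>1 ?n) / ?n\<^sup>2) (at ?n)"
      using n by (auto intro!: derivative_eq_intros d2 simp: field_simps power2_eq_square)
    then have "((\<lambda>y. \<phi>1 (norm y) / norm y) has_derivative
        (\<lambda>h. ((c * ?n - \<phi>1 ?n) / ?n\<^sup>2 / ?n) * (x \<bullet> h))) (at x)"
      using n by (intro has_derivative_radial[where \<phi>="\<lambda>r. \<phi>1 r / r"])
        (auto intro: has_field_derivative_at_within)
    from has_derivative_mult[OF this has_derivative_inner_left[OF has_derivative_ident, of i]]
    have "((\<lambda>y. \<phi>1 (norm y) / norm y * (y \<bullet> i)) has_derivative
        (\<lambda>h. \<phi>1 ?n / ?n * (h \<bullet> i) + ((c * ?n - \<phi>1 ?n) / ?n\<^sup>2 / ?n) * (x \<bullet> h) * (x \<bullet> i))) (at x)" .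
    from partial_eqI[OF this, of i]
    have "partial i (\<lambda>y. \<phi>1 (norm y) / norm y * (y \<bullet> i)) x =
        ((c * ?n - \<phi>1 ?n) / ?n\<^sup>2 / ?n) * (x \<bullet> i)\<^sup>2 + \<phi>1 ?n / ?n"
      using i by (simp add: power2_eq_square)
    moreover have "partial i (partial i u) x = partial i (\<lambda>y. \<phi>1 (norm y) / norm y * (y \<bullet> i)) x"
      by (rule partial_cong_open[OF S(1) x p])
    ultimately show ?thesis by simp
  qed
  have "(\<Sum>i\<in>Basis. (x \<bullet> i)\<^sup>2) = ?n\<^sup>2"
    using euclidean_inner[of x x] by (simp add: power2_eq_square dot_square_norm)
  moreover have "laplacian u x =
      (\<Sum>i\<in>Basis. ((c * ?n - \<phi>1 ?n) / ?n\<^sup>2 / ?n) * (x \<bullet> i)\<^sup>2 + \<phi>1 ?n / ?n)"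
    unfolding laplacian_def by (rule sum.cong[OF refl pp])
  ultimately have "laplacian u x = ((c * ?n - \<phi>1 ?n) / ?n\<^sup>2 / ?n) * ?n\<^sup>2 + DIM('a) * (\<phi>1 ?n / ?n)"
    by (simp only: sum.distrib sum_distrib_left[symmetric] sum_constant)
  also have "\<dots> = c + (real DIM('a) - 1) * (\<phi>1 ?n / ?n)"
    using n by (simp add: field_simps power2_eq_square)
  finally show ?thesis .
qed

section \<open>A comparison principle for the radial operator\<close>

text \<open>
  The operator satisfied by the radial derivative of a solution, evaluated at \<open>r\<close> on the values
  \<open>z\<close>, \<open>z1\<close>, \<open>z2\<close> of a function and its first two derivatives. For \<open>d = 2\<close> it is, up to
  scaling, the modified Bessel operator of order one.
\<close>

definition radial_op :: "nat \<Rightarrow> real \<Rightarrow> real \<Rightarrow> real \<Rightarrow> real \<Rightarrow> real \<Rightarrow> real \<Rightarrow> real" where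
  "radial_op d B T r z z1 z2 = - B * (z2 + (real d - 1) * (z1 / r - z / r\<^sup>2)) + T * z"

lemma radial_op_diff:
  "radial_op d B T r (a * z - b * y) (a * z1 - b * y1) (a * z2 - b * y2) =
     a * radial_op d B T r z z1 z2 - b * radial_op d B T r y y1 y2"
  unfolding radial_op_def by (simp add: algebra_simps diff_divide_distrib add_divide_distrib)

lemma second_derivative_at_max:
  fixes y y1 :: "real \<Rightarrow> real"
  assumes x: "a < x" "x < b"
    and y: "\<And>r. a < r \<Longrightarrow> r < b \<Longrightarrow> (y has_real_derivative y1 r) (at r)"
    and y1: "(y1 has_real_derivative c) (at x)"
    and max: "\<And>r. a < r \<Longrightarrow> r < b \<Longrightarrow> y r \<le> y x"
  shows "y1 x = 0" "c \<le> 0"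
proof -
  define e where "e = min (x - a) (b - x)"
  have e: "e > 0" using x by (simp add: e_def)
  have "y r \<le> y x" if "\<bar>x - r\<bar> < e" for r
    using that by (intro max) (auto simp: e_def)
  then show 0: "y1 x = 0"
    using DERIV_local_max[OF y[OF x] e] by simp
  show "c \<le> 0"
  proof (rule ccontr)
    assume "\<not> c \<le> 0"
    then obtain d where d: "d > 0" "\<And>h. 0 < h \<Longrightarrow> h < d \<Longrightarrow> y1 x < y1 (x + h)"
      using DERIV_pos_inc_right[OF y1] by (metis not_le)
    define k where "k = min d e / 2"
    have k: "0 < k" "k < d" "k < e" using d(1) e by (auto simp: k_def)
    obtain z where z: "x < z" "z < x + k" "y (x + k) - y x = k * y1 z"
      using MVT2[of x "x + k" y y1] k y x by (auto simp: e_def)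
    have "y1 z > 0" using d(2)[of "z - x"] z k 0 by auto
    then have "y (x + k) > y x" using z(3) k(1) by (metis diff_gt_0_iff_gt mult_pos_pos)
    moreover have "y (x + k) \<le> y x" using max[of "x + k"] k x by (auto simp: e_def)
    ultimately show False by simp
  qed
qed

text \<open>
  The maximum principle with an explicit barrier. Here \<open>radial_op\<close> maps \<open>sqrt r\<close> to at least
  \<open>B / 4 * r powr (- 3 / 2)\<close>, so for \<open>C' > C\<close> the difference \<open>z - 4 * C' / B * sqrt r\<close> is a strict
  subsolution and cannot have a positive interior maximum. Working with strict inequalities covers \<open>T = 0\<close>,
  and \<open>C = 0\<close> gives the usual comparison principle.
\<close>

lemma sqrt_barrier:
  fixes z z1 z2 :: "real \<Rightarrow> real"
  assumes d: "1 \<le> d" and B: "0 < B" and T: "0 \<le> T" and C: "0 \<le> C"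
    and cont: "continuous_on {0..1} z" and bc: "z 0 \<le> 0" "z 1 \<le> 0"
    and z: "\<And>r. 0 < r \<Longrightarrow> r < 1 \<Longrightarrow> (z has_real_derivative z1 r) (at r)"
    and z1: "\<And>r. 0 < r \<Longrightarrow> r < 1 \<Longrightarrow> (z1 has_real_derivative z2 r) (at r)"
    and L: "\<And>r. 0 < r \<Longrightarrow> r < 1 \<Longrightarrow> radial_op d B T r (z r) (z1 r) (z2 r) \<le> C / (r * sqrt r)"
    and r: "r \<in> {0..1}"
  shows "z r \<le> 4 * C / B * sqrt r"
proof -
  have strict: "z r \<le> 4 * C' / B * sqrt r" if C': "C < C'" for C'
  proof (rule ccontr)
    assume neg: "\<not> z r \<le> 4 * C' / B * sqrt r"
    define K where "K = 4 * C' / B"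
    have K: "K > 0" "B * K = 4 * C'" using B C C' by (auto simp: K_def)
    define y where "y = (\<lambda>r. z r - K * sqrt r)"
    have "continuous_on {0..1} y" unfolding y_def by (intro continuous_intros cont)
    then obtain x where x: "x \<in> {0..1}" "\<And>t. t \<in> {0..1} \<Longrightarrow> y t \<le> y x"
      using continuous_attains_sup[of "{0..1::real}" y] by auto
    have pos: "y x > 0"
      using x(2)[OF r] neg by (simp add: y_def K_def)
    have x01: "0 < x" "x < 1"
      using x(1) pos bc K by (auto simp: y_def less_eq_real_def)
    \<comment> \<open>In terms of \<open>s = sqrt x\<close> all quantities at the maximum point are rational.\<close>
    define s where "s = sqrt x"
    have s: "s > 0" "x = s\<^sup>2" using x01 by (auto simp: s_def)
    have dy: "(y has_real_derivative z1 r - K / (2 * sqrt r)) (at r)" if "0 < r" "r < 1" for r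
      unfolding y_def using that by (auto intro!: derivative_eq_intros z simp: field_simps)
    have dy1: "((\<lambda>r. z1 r - K / (2 * sqrt r)) has_real_derivative z2 x + K / (4 * s^3)) (at x)"
      using x01 s by (auto intro!: derivative_eq_intros z1 simp: s_def[symmetric])
        (simp add: field_simps power2_eq_square power3_eq_cube)
    have "z1 x - K / (2 * sqrt x) = 0" "z2 x + K / (4 * s^3) \<le> 0"
      by (rule second_derivative_at_max[OF x01 dy dy1]; use x in simp)+
    then have e1: "z1 x = K / (2 * s)" and e2: "z2 x \<le> - K / (4 * s^3)"
      by (auto simp: s_def)
    have e0: "z x \<ge> K * s" using pos by (simp add: y_def s_def)
    have "z1 x / x - z x / x\<^sup>2 \<le> z1 x / x - K * s / x\<^sup>2"
      using e0 x01 by (simp add: divide_right_mono)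
    also have "\<dots> = - K / (2 * s^3)"
      unfolding e1 using s by (simp add: field_simps eval_nat_numeral)
    also have "\<dots> \<le> 0" using K s by simp
    finally have "(real d - 1) * (z1 x / x - z x / x\<^sup>2) \<le> 0"
      using d by (simp add: mult_nonneg_nonpos)
    then have "z2 x + (real d - 1) * (z1 x / x - z x / x\<^sup>2) \<le> - K / (4 * s^3)" using e2 by simp
    from mult_left_mono[OF this, of B] B
    have "B * (z2 x + (real d - 1) * (z1 x / x - z x / x\<^sup>2)) \<le> - (C' / s^3)"
      using K(2) by simp
    moreover have "T * z x \<ge> 0" using e0 K s T by (smt (verit) mult_nonneg_nonneg)
    ultimately have "radial_op d B T x (z x) (z1 x) (z2 x) \<ge> C' / s^3"
      unfolding radial_op_def by simp
    moreover have "x * sqrt x = s^3"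
      using s by (simp add: s_def[symmetric] power2_eq_square power3_eq_cube)
    ultimately have "C' / s^3 \<le> C / s^3" using L[OF x01] by simp
    then show False using C' s by (simp add: divide_le_cancel)
  qed
  have "\<forall>\<^sub>F e in at_right 0. z r \<le> 4 * (C + e) / B * sqrt r"
    by (rule eventually_mono[OF eventually_at_right_less[of "0::real"]]) (rule strict, simp)
  moreover have "((\<lambda>e. 4 * (C + e) / B * sqrt r) \<longlongrightarrow> 4 * (C + 0) / B * sqrt r) (at_right 0)"
    by (intro tendsto_intros) (use B in auto)
  ultimately show ?thesis
    using tendsto_lowerbound[OF _ _ trivial_limit_at_right_real, of "\<lambda>e. 4 * (C + e) / B * sqrt r"]
    by simp
qed

lemma abs_increment_le:
  fixes f f' :: "real \<Rightarrow> real"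
  assumes "a \<le> b" "continuous_on {a..b} f"
    and "\<And>x. a < x \<Longrightarrow> x < b \<Longrightarrow> (f has_real_derivative f' x) (at x)"
    and "\<And>x. a < x \<Longrightarrow> x < b \<Longrightarrow> \<bar>f' x\<bar> \<le> K"
  shows "\<bar>f b - f a\<bar> \<le> K * (b - a)"
proof (cases "a = b")
  case False
  then obtain x where x: "a < x" "x < b" "f b - f a = (b - a) * f' x"
    using MVT[of a b f] assms(1-3) by (metis DERIV_unique real_differentiable_def order_le_less)
  then show ?thesis using assms(1) assms(4)[OF x(1,2)]
    by (simp add: abs_mult mult.commute mult_right_mono)
qed simp

lemma nondecreasing_open:
  fixes f f' :: "real \<Rightarrow> real"
  assumes "a \<le> b" "continuous_on {a..b} f"
    and "\<And>x. a < x \<Longrightarrow> x < b \<Longrightarrow> (f has_real_derivative f' x) (at x)"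
    and "\<And>x. a < x \<Longrightarrow> x < b \<Longrightarrow> 0 \<le> f' x"
  shows "f a \<le> f b"
proof (cases "a = b")
  case False
  then show ?thesis
    using assms by (intro DERIV_nonneg_imp_increasing_open[of a b f]) (auto intro: assms)
qed simp

section \<open>Estimates for a single radial profile\<close>

lemma g_antimono: "-1 < x \<Longrightarrow> x \<le> y \<Longrightarrow> g y \<le> g x"
  unfolding g_def by (intro divide_left_mono power_mono) auto

lemma g_pos: "-1 < x \<Longrightarrow> 0 < g x"
  unfolding g_def by simp

text \<open>
  Below this radius \<open>radial_op\<close> is nonpositive on \<open>r\<^sup>2 - r ^ 3\<close>, in both dimensions; the radius
  depends on \<open>B\<close> and \<open>T\<close> alone, which makes all later bounds uniform in the parameter.
\<close>

definition subsolution_radius :: "real \<Rightarrow> real \<Rightarrow> real" where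
  "subsolution_radius B T = B / (4 * B + T)"

text \<open>The a priori bound for the mass \<open>m\<close> of every profile, uniform in the parameter.\<close>

definition mass_bound :: "real \<Rightarrow> real \<Rightarrow> real" where
  "mass_bound B T = 12 * (8 * B + T) / (subsolution_radius B T)\<^sup>2"

text \<open>
  The radial form of the boundary value problem after one integration: \<open>\<phi>\<close> is the profile of a
  solution, \<open>\<phi>1\<close>, \<open>\<phi>2\<close>, \<open>\<phi>3\<close> are its derivatives, and \<open>m r\<close> is, up to a constant factor, the
  total load on the ball of radius \<open>r\<close>.
\<close>

locale radial_profile =
  fixes d :: nat and B T l :: real and \<phi> \<phi>1 \<phi>2 \<phi>3 m :: "real \<Rightarrow> real"
  assumes d: "d = 1 \<or> d = 2" and B: "0 < B" and T: "0 \<le> T" and l: "0 < l"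
    and deriv: "\<And>r. r \<in> {0..1} \<Longrightarrow> (\<phi> has_real_derivative \<phi>1 r) (at r within {0..1})"
    and deriv1: "\<And>r. 0 < r \<Longrightarrow> r < 1 \<Longrightarrow> (\<phi>1 has_real_derivative \<phi>2 r) (at r)"
    and deriv2: "\<And>r. 0 < r \<Longrightarrow> r < 1 \<Longrightarrow> (\<phi>2 has_real_derivative \<phi>3 r) (at r)"
    and cont1: "continuous_on {0..1} \<phi>1"
    and bc: "\<phi>1 0 = 0" "\<phi> 1 = 0" "\<phi>1 1 = 0"
    and above: "\<And>r. r \<in> {0..1} \<Longrightarrow> -1 < \<phi> r"
    and eq: "\<And>r. 0 < r \<Longrightarrow> r < 1 \<Longrightarrow>
      radial_op d B T r (\<phi>1 r) (\<phi>2 r) (\<phi>3 r) = m r / r ^ (d - 1)"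
    and cont_m: "continuous_on {0..<1} m" and m_0: "m 0 = 0"
    and deriv_m: "\<And>r. 0 < r \<Longrightarrow> r < 1 \<Longrightarrow> (m has_real_derivative l * g (\<phi> r) * r ^ (d - 1)) (at r)"
begin

abbreviation "\<delta>\<^sub>0 \<equiv> subsolution_radius B T"
abbreviation "m_max \<equiv> mass_bound B T"
definition "M = m \<delta>\<^sub>0"

lemma \<delta>\<^sub>0: "0 < \<delta>\<^sub>0" "\<delta>\<^sub>0 < 1"
  using B T by (auto simp: subsolution_radius_def)

lemma cont: "continuous_on {0..1} \<phi>"
  by (rule DERIV_continuous_on) (rule deriv)

lemma deriv_at: "0 < r \<Longrightarrow> r < 1 \<Longrightarrow> (\<phi> has_real_derivative \<phi>1 r) (at r)"
  using deriv[of r] at_within_Icc_at[of 0 r 1] by simp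

lemma m_mono: "0 \<le> r \<Longrightarrow> r \<le> s \<Longrightarrow> s < 1 \<Longrightarrow> m r \<le> m s"
proof (rule nondecreasing_open[of r s m "\<lambda>r. l * g (\<phi> r) * r ^ (d - 1)"])
  fix x assume a: "0 \<le> r" "r \<le> s" "s < 1" and x: "r < x" "x < s"
  show "(m has_real_derivative l * g (\<phi> x) * x ^ (d - 1)) (at x)"
    using a x by (intro deriv_m) auto
  show "0 \<le> l * g (\<phi> x) * x ^ (d - 1)"
    using a x l g_pos[OF above[of x]] by simp
qed (auto intro!: continuous_on_subset[OF cont_m])

lemma m_nonneg: "0 \<le> r \<Longrightarrow> r < 1 \<Longrightarrow> 0 \<le> m r"
  using m_mono[of 0 r] m_0 by simp

lemma phi1_nonneg:
  assumes "r \<in> {0..1}" shows "0 \<le> \<phi>1 r"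
proof -
  have "- \<phi>1 r \<le> 4 * 0 / B * sqrt r"
  proof (rule sqrt_barrier[where d = d and T = T and z = "\<lambda>r. - \<phi>1 r"
        and ?z1.0 = "\<lambda>r. - \<phi>2 r" and ?z2.0 = "\<lambda>r. - \<phi>3 r", OF _ B T _ _ _ _ _ _ _ assms])
    fix r :: real assume r: "0 < r" "r < 1"
    show "((\<lambda>r. - \<phi>1 r) has_real_derivative - \<phi>2 r) (at r)"
      by (intro DERIV_minus deriv1 r)
    show "((\<lambda>r. - \<phi>2 r) has_real_derivative - \<phi>3 r) (at r)"
      by (intro DERIV_minus deriv2 r)
    have "radial_op d B T r (- \<phi>1 r) (- \<phi>2 r) (- \<phi>3 r) = - (m r / r ^ (d - 1))"
      using radial_op_diff[of d B T r 0 0 1 "\<phi>1 r" 0 "\<phi>2 r" 0 "\<phi>3 r"] eq[OF r] by simp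
    then show "radial_op d B T r (- \<phi>1 r) (- \<phi>2 r) (- \<phi>3 r) \<le> 0 / (r * sqrt r)"
      using m_nonneg[of r] r by simp
  qed (use d bc in \<open>auto intro: continuous_on_minus cont1\<close>)
  then show ?thesis by simp
qed

lemma phi_mono: "0 \<le> r \<Longrightarrow> r \<le> s \<Longrightarrow> s \<le> 1 \<Longrightarrow> \<phi> r \<le> \<phi> s"
  by (rule nondecreasing_open[of r s \<phi> \<phi>1])
    (auto intro!: continuous_on_subset[OF cont] deriv_at phi1_nonneg)

text \<open>
  Since \<open>\<phi>\<close> increases, the density \<open>l * g (\<phi> r)\<close> decreases. The next two lemmas compare \<open>m\<close> with the
  mass of the constant density frozen at \<open>\<eta>\<close>, inside and outside the ball of radius \<open>\<eta>\<close>.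
\<close>

lemma m_lower:
  assumes "0 < \<eta>" "\<eta> < 1"
  shows "l * g (\<phi> \<eta>) * \<eta> ^ d / d \<le> m \<eta>"
proof -
  let ?c = "l * g (\<phi> \<eta>)"
  have "m 0 - ?c * 0 ^ d / d \<le> m \<eta> - ?c * \<eta> ^ d / d"
  proof (rule nondecreasing_open[where f = "\<lambda>r. m r - ?c * r ^ d / d"
        and f' = "\<lambda>r. l * g (\<phi> r) * r ^ (d - 1) - ?c * r ^ (d - 1)"])
    fix r assume r: "0 < r" "r < \<eta>"
    show "((\<lambda>r. m r - ?c * r ^ d / d) has_real_derivative l * g (\<phi> r) * r ^ (d - 1) - ?c * r ^ (d - 1)) (at r)"
      using r assms d by (auto intro!: derivative_eq_intros deriv_m)
    have "g (\<phi> \<eta>) \<le> g (\<phi> r)" using r assms by (intro g_antimono phi_mono above) auto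
    then show "0 \<le> l * g (\<phi> r) * r ^ (d - 1) - ?c * r ^ (d - 1)"
      using r l by (simp add: mult_right_mono)
  qed (use assms d in \<open>auto intro!: continuous_intros continuous_on_subset[OF cont_m]\<close>)
  then show ?thesis using d m_0 by auto
qed

lemma m_increment:
  assumes "0 < \<eta>" "\<eta> \<le> s" "s < 1"
  shows "m s - m \<eta> \<le> l * g (\<phi> \<eta>) * (s ^ d - \<eta> ^ d) / d"
proof -
  let ?c = "l * g (\<phi> \<eta>)"
  have "?c * \<eta> ^ d / d - m \<eta> \<le> ?c * s ^ d / d - m s"
  proof (rule nondecreasing_open[where f = "\<lambda>r. ?c * r ^ d / d - m r"
        and f' = "\<lambda>r. ?c * r ^ (d - 1) - l * g (\<phi> r) * r ^ (d - 1)"])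
    fix r assume r: "\<eta> < r" "r < s"
    show "((\<lambda>r. ?c * r ^ d / d - m r) has_real_derivative ?c * r ^ (d - 1) - l * g (\<phi> r) * r ^ (d - 1)) (at r)"
      using r assms d by (auto intro!: derivative_eq_intros deriv_m)
    have "g (\<phi> r) \<le> g (\<phi> \<eta>)" using r assms by (intro g_antimono phi_mono above) auto
    then show "0 \<le> ?c * r ^ (d - 1) - l * g (\<phi> r) * r ^ (d - 1)"
      using r l assms by (simp add: mult_right_mono)
  qed (use assms d in \<open>auto intro!: continuous_intros continuous_on_subset[OF cont_m]\<close>)
  then show ?thesis by (simp add: right_diff_distrib diff_divide_distrib)
qed

lemma M_nonneg: "0 \<le> M"
  unfolding M_def using m_nonneg \<delta>\<^sub>0 by simp

text \<open>
  The mean density over a ball decreases with its radius, so the mass beyond \<open>\<delta>\<^sub>0\<close> is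
  controlled by the mass within.
\<close>

lemma m_le_M:
  assumes "0 \<le> r" "r < 1" shows "m r \<le> M / \<delta>\<^sub>0\<^sup>2"
proof -
  have pos: "0 < \<delta>\<^sub>0 ^ d" "\<delta>\<^sub>0\<^sup>2 \<le> \<delta>\<^sub>0 ^ d" "\<delta>\<^sub>0 ^ d \<le> 1"
    using \<delta>\<^sub>0 d by (auto simp: power_le_one power2_eq_square mult_le_one mult_left_le)
  have M: "M \<le> M / \<delta>\<^sub>0 ^ d" using pos M_nonneg by (simp add: pos_le_divide_eq mult_left_le)
  have "m r \<le> M / \<delta>\<^sub>0 ^ d"
  proof (cases "r \<le> \<delta>\<^sub>0")
    case True
    then have "m r \<le> M" unfolding M_def using assms \<delta>\<^sub>0 by (intro m_mono) auto
    then show ?thesis using M by simp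
  next
    case False
    let ?c = "l * g (\<phi> \<delta>\<^sub>0) / d"
    have c: "0 \<le> ?c" using l g_pos[OF above[of \<delta>\<^sub>0]] \<delta>\<^sub>0 by simp
    have cM: "?c * \<delta>\<^sub>0 ^ d \<le> M" using m_lower[OF \<delta>\<^sub>0] by (simp add: M_def)
    have "m r - M \<le> ?c * (r ^ d - \<delta>\<^sub>0 ^ d)"
      using m_increment[of \<delta>\<^sub>0 r] False \<delta>\<^sub>0 assms by (simp add: M_def)
    also have "\<dots> \<le> ?c * (1 - \<delta>\<^sub>0 ^ d)"
      using c assms by (intro mult_left_mono) (auto simp: power_le_one)
    also have "\<dots> \<le> M / \<delta>\<^sub>0 ^ d * (1 - \<delta>\<^sub>0 ^ d)"
      using cM pos by (intro mult_right_mono) (auto simp: pos_le_divide_eq)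
    also have "\<dots> = M / \<delta>\<^sub>0 ^ d - M" using \<delta>\<^sub>0 by (simp add: right_diff_distrib)
    finally show ?thesis by simp
  qed
  also have "\<dots> \<le> M / \<delta>\<^sub>0\<^sup>2"
    using pos M_nonneg \<delta>\<^sub>0 by (intro divide_left_mono) auto
  finally show ?thesis .
qed

text \<open>
  The multiple of \<open>r\<^sup>2 - r ^ 3\<close> is a subsolution: its image is nonpositive up to \<open>\<delta>\<^sub>0\<close>, and beyond
  \<open>\<delta>\<^sub>0\<close> it is at most \<open>M\<close>, whereas \<open>m r\<close> is at least \<open>M\<close> there.
\<close>

lemma phi1_lower:
  assumes "r \<in> {0..1}"
  shows "M / (8 * B + T) * (r\<^sup>2 - r^3) \<le> \<phi>1 r"
proof -
  define \<kappa> where "\<kappa> = M / (8 * B + T)"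
  have \<kappa>: "0 \<le> \<kappa>" "\<kappa> * (8 * B + T) = M" using M_nonneg B T by (auto simp: \<kappa>_def)
  have "\<kappa> * (r\<^sup>2 - r^3) - 1 * \<phi>1 r \<le> 4 * 0 / B * sqrt r"
  proof (rule sqrt_barrier[where d = d and T = T and z = "\<lambda>r. \<kappa> * (r\<^sup>2 - r^3) - 1 * \<phi>1 r"
        and ?z1.0 = "\<lambda>r. \<kappa> * (2 * r - 3 * r\<^sup>2) - 1 * \<phi>2 r" and ?z2.0 = "\<lambda>r. \<kappa> * (2 - 6 * r) - 1 * \<phi>3 r",
        OF _ B T _ _ _ _ _ _ _ assms])
    fix r :: real assume r: "0 < r" "r < 1"
    show "((\<lambda>r. \<kappa> * (r\<^sup>2 - r^3) - 1 * \<phi>1 r) has_real_derivative \<kappa> * (2 * r - 3 * r\<^sup>2) - 1 * \<phi>2 r) (at r)"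
      using r by (auto intro!: derivative_eq_intros deriv1)
    show "((\<lambda>r. \<kappa> * (2 * r - 3 * r\<^sup>2) - 1 * \<phi>2 r) has_real_derivative \<kappa> * (2 - 6 * r) - 1 * \<phi>3 r) (at r)"
      using r by (auto intro!: derivative_eq_intros deriv2)
    have "(2 * r - 3 * r\<^sup>2) / r - (r\<^sup>2 - r^3) / r\<^sup>2 = 1 - 2 * r"
      using r by (simp add: field_simps power2_eq_square power3_eq_cube)
    then have Lh: "radial_op d B T r (r\<^sup>2 - r^3) (2 * r - 3 * r\<^sup>2) (2 - 6 * r) =
        - B * (2 - 6 * r + (real d - 1) * (1 - 2 * r)) + T * (r\<^sup>2 - r^3)"
      unfolding radial_op_def by (simp only:)
    have r2: "0 \<le> r^3" "r\<^sup>2 \<le> r" "r\<^sup>2 - r^3 \<le> 1"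
      using r by (auto simp: power2_eq_square power3_eq_cube mult_left_le mult_le_one)
        (smt (verit) mult_le_one mult_nonneg_nonneg)
    have bulk: "- B * (2 - 6 * r + (real d - 1) * (1 - 2 * r)) \<le> - (2 * B) + 8 * (B * r)"
      using d B r by (auto simp: algebra_simps)
    have m_le: "m r \<le> m r / r ^ (d - 1)"
      using r m_nonneg[of r] by (simp add: pos_le_divide_eq mult_left_le power_le_one)
    have "\<kappa> * radial_op d B T r (r\<^sup>2 - r^3) (2 * r - 3 * r\<^sup>2) (2 - 6 * r) \<le> m r / r ^ (d - 1)"
    proof (cases "r \<le> \<delta>\<^sub>0")
      case True
      then have "r * (4 * B + T) \<le> B" using B T by (simp add: subsolution_radius_def pos_le_divide_eq)
      moreover note bulk
      moreover have "0 \<le> T * r" using T r by simp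
      moreover have "T * (r\<^sup>2 - r^3) \<le> T * r" using r2 T by (intro mult_left_mono) linarith+
      ultimately have "radial_op d B T r (r\<^sup>2 - r^3) (2 * r - 3 * r\<^sup>2) (2 - 6 * r) \<le> 0"
        unfolding Lh distrib_left mult.left_commute[of r] mult.commute[of r] by linarith
      then have "\<kappa> * radial_op d B T r (r\<^sup>2 - r^3) (2 * r - 3 * r\<^sup>2) (2 - 6 * r) \<le> 0"
        using \<kappa> by (simp add: mult_nonneg_nonpos)
      then show ?thesis using m_le m_nonneg[of r] r by linarith
    next
      case False
      have "T * (r\<^sup>2 - r^3) \<le> T * 1" using r2 T by (intro mult_left_mono) auto
      moreover have "B * r \<le> B" using r B by simp
      ultimately have "radial_op d B T r (r\<^sup>2 - r^3) (2 * r - 3 * r\<^sup>2) (2 - 6 * r) \<le> 8 * B + T"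
        unfolding Lh using bulk B by linarith
      then have "\<kappa> * radial_op d B T r (r\<^sup>2 - r^3) (2 * r - 3 * r\<^sup>2) (2 - 6 * r) \<le> M"
        using \<kappa> mult_left_mono by metis
      also have "M \<le> m r" unfolding M_def using False r \<delta>\<^sub>0 by (intro m_mono) auto
      finally show ?thesis using m_le by simp
    qed
    then show "radial_op d B T r (\<kappa> * (r\<^sup>2 - r^3) - 1 * \<phi>1 r) (\<kappa> * (2 * r - 3 * r\<^sup>2) - 1 * \<phi>2 r)
        (\<kappa> * (2 - 6 * r) - 1 * \<phi>3 r) \<le> 0 / (r * sqrt r)"
      unfolding radial_op_diff eq[OF r] by simp
  qed (use d bc in \<open>auto intro!: continuous_intros cont1\<close>)
  then show ?thesis by (simp add: \<kappa>_def)
qed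

lemma phi_lower:
  assumes "r \<in> {0..1}"
  shows "M / (8 * B + T) * (r^3 / 12) \<le> \<phi> r - \<phi> 0"
proof -
  define \<kappa> where "\<kappa> = M / (8 * B + T)"
  have \<kappa>: "0 \<le> \<kappa>" using M_nonneg B T by (auto simp: \<kappa>_def)
  have "\<phi> 0 - \<kappa> * (0^3 / 3 - 0^4 / 4) \<le> \<phi> r - \<kappa> * (r^3 / 3 - r^4 / 4)"
  proof (rule nondecreasing_open[where f = "\<lambda>r. \<phi> r - \<kappa> * (r^3 / 3 - r^4 / 4)"
        and f' = "\<lambda>r. \<phi>1 r - \<kappa> * (r\<^sup>2 - r^3)"])
    fix x assume x: "0 < x" "x < r"
    show "((\<lambda>r. \<phi> r - \<kappa> * (r^3 / 3 - r^4 / 4)) has_real_derivative \<phi>1 x - \<kappa> * (x\<^sup>2 - x^3)) (at x)"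
      using x assms by (auto intro!: derivative_eq_intros deriv_at)
    show "0 \<le> \<phi>1 x - \<kappa> * (x\<^sup>2 - x^3)"
      using phi1_lower[of x] x assms by (simp add: \<kappa>_def)
  qed (use assms in \<open>auto intro!: continuous_intros continuous_on_subset[OF cont]\<close>)
  moreover have "r^3 / 12 \<le> r^3 / 3 - r^4 / 4"
    using assms power_decreasing[of 3 4 r] by auto
  ultimately show ?thesis
    using mult_left_mono[OF _ \<kappa>, of "r^3 / 12" "r^3 / 3 - r^4 / 4"] by (simp add: \<kappa>_def)
qed

text \<open>The profile rises by less than \<open>1\<close>, from \<open>\<phi> 0 > -1\<close> to \<open>0\<close>, which limits the load.\<close>

lemma M_le: "M \<le> 12 * (8 * B + T)"
proof -
  have "M / (8 * B + T) * (1 / 12) \<le> 1"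
    using phi_lower[of 1] above[of 0] bc by simp
  then show ?thesis using B T by (simp add: pos_divide_le_eq)
qed

lemma m_max: "0 < m_max" "M \<le> m_max" "0 \<le> r \<Longrightarrow> r < 1 \<Longrightarrow> m r \<le> m_max"
proof -
  show *: "m r \<le> m_max" if "0 \<le> r" "r < 1" for r
    using m_le_M[OF that] M_le \<delta>\<^sub>0 unfolding mass_bound_def
    by (meson divide_right_mono order_trans zero_le_power2)
  show "M \<le> m_max" using *[of \<delta>\<^sub>0] \<delta>\<^sub>0 by (simp add: M_def)
  show "0 < m_max" using B T \<delta>\<^sub>0 by (simp add: mass_bound_def)
qed

lemma inverse_power_le:
  assumes "0 < r" "r < 1" shows "1 / r ^ (d - 1) \<le> 1 / r" "1 / r \<le> 1 / (r * sqrt r)"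
  using d assms by (auto simp: divide_simps mult_left_le)

lemma phi1_upper:
  assumes "r \<in> {0..1}"
  shows "\<phi>1 r \<le> 4 * (M / \<delta>\<^sub>0\<^sup>2) / B * sqrt r"
proof (rule sqrt_barrier[where d = d and T = T and z = "\<phi>1"
        and ?z1.0 = "\<phi>2" and ?z2.0 = "\<phi>3", OF _ B T _ cont1 _ _ deriv1 deriv2 _ assms])
  fix r :: real assume r: "0 < r" "r < 1"
  have "radial_op d B T r (\<phi>1 r) (\<phi>2 r) (\<phi>3 r) = m r * (1 / r ^ (d - 1))"
    by (simp add: eq[OF r])
  also have "\<dots> \<le> M / \<delta>\<^sub>0\<^sup>2 * (1 / (r * sqrt r))"
    using inverse_power_le[OF r] m_le_M[of r] m_nonneg[of r] r M_nonneg by (intro mult_mono) auto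
  finally show "radial_op d B T r (\<phi>1 r) (\<phi>2 r) (\<phi>3 r) \<le> M / \<delta>\<^sub>0\<^sup>2 / (r * sqrt r)" by simp
qed (use d bc M_nonneg in auto)

lemma phi_upper:
  assumes "r \<in> {0..1}"
  shows "\<phi> r \<le> \<phi> 0 + 4 * (M / \<delta>\<^sub>0\<^sup>2) / B * (r * sqrt r)"
proof -
  let ?C = "4 * (M / \<delta>\<^sub>0\<^sup>2) / B"
  have "\<bar>\<phi> r - \<phi> 0\<bar> \<le> (?C * sqrt r) * (r - 0)"
  proof (rule abs_increment_le[where f' = \<phi>1])
    fix x assume x: "0 < x" "x < r"
    have "\<phi>1 x \<le> ?C * sqrt x" by (rule phi1_upper) (use x assms in auto)
    also have "\<dots> \<le> ?C * sqrt r" using x M_nonneg B by (intro mult_left_mono) auto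
    finally show "\<bar>\<phi>1 x\<bar> \<le> ?C * sqrt r" using phi1_nonneg[of x] x assms by simp
  qed (use assms in \<open>auto intro!: continuous_on_subset[OF cont] deriv_at\<close>)
  then show ?thesis by (simp add: mult.commute mult.left_commute)
qed

text \<open>Conversely, a profile that comes down to \<open>- 1 / 2\<close> needs a load that is bounded from below.\<close>

lemma M_lower:
  assumes "\<phi> 0 \<le> - 1 / 2"
  shows "B * \<delta>\<^sub>0\<^sup>2 / 8 \<le> M"
proof -
  have "1 / 2 \<le> 4 * (M / \<delta>\<^sub>0\<^sup>2) / B" using phi_upper[of 1] bc assms by simp
  then show ?thesis using B \<delta>\<^sub>0 by (simp add: field_simps)
qed

text \<open>
  Touchdown forces the parameter to zero. At a radius \<open>r\<close> with \<open>1 + \<phi> 0 \<le> r * sqrt r\<close>, the upper bound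
  for \<open>\<phi>\<close> makes the density at least a multiple of \<open>l / r ^ 3\<close>, while the bounded mass allows at most a
  multiple of \<open>1 / r ^ d\<close>; here \<open>d \<le> 2\<close> is decisive.
\<close>

lemma parameter_le:
  assumes "0 < r" "r < 1" "1 + \<phi> 0 \<le> r * sqrt r"
  shows "l \<le> 2 * m_max * (1 + 4 * m_max / B)\<^sup>2 * r"
proof -
  define C where "C = 1 + 4 * m_max / B"
  have C: "C > 0" using m_max B by (simp add: C_def add_pos_pos)
  have p: "0 < 1 + \<phi> r" using above[of r] assms by simp
  have "M / \<delta>\<^sub>0\<^sup>2 \<le> m_max"
    unfolding mass_bound_def using M_le by (simp add: divide_right_mono)
  then have "4 * (M / \<delta>\<^sub>0\<^sup>2) / B * (r * sqrt r) \<le> 4 * m_max / B * (r * sqrt r)"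
    using assms B by (intro mult_right_mono divide_right_mono) auto
  then have "1 + \<phi> r \<le> C * (r * sqrt r)"
    using phi_upper[of r] assms by (simp add: C_def distrib_right)
  then have "(1 + \<phi> r)\<^sup>2 \<le> (C * (r * sqrt r))\<^sup>2" using p by (intro power_mono) auto
  also have "\<dots> = C\<^sup>2 * r^3" using assms by (simp add: power_mult_distrib power2_eq_square power3_eq_cube)
  finally have sq: "(1 + \<phi> r)\<^sup>2 \<le> C\<^sup>2 * r^3" .
  have "l * r ^ d / d \<le> m_max * (1 + \<phi> r)\<^sup>2"
  proof -
    have "l * r ^ d / d / (1 + \<phi> r)\<^sup>2 = l * g (\<phi> r) * r ^ d / d" by (simp add: g_def)
    also have "\<dots> \<le> m_max" using m_lower[OF assms(1,2)] m_max(3)[of r] assms by simp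
    finally show ?thesis by (rule pos_divide_le_eq[THEN iffD1, rotated]) (use p in simp)
  qed
  also have "\<dots> \<le> m_max * (C\<^sup>2 * r^3)" using sq m_max by (intro mult_left_mono) auto
  finally have "l * r ^ d \<le> d * (m_max * (C\<^sup>2 * r^3))" using d by (auto simp: field_simps)
  moreover have "l * r\<^sup>2 \<le> l * r ^ d" "d * (m_max * (C\<^sup>2 * r^3)) \<le> 2 * (m_max * (C\<^sup>2 * r^3))"
    using d assms l m_max C by (auto simp: power2_eq_square mult_left_le)
  ultimately have "l * r\<^sup>2 \<le> (2 * m_max * C\<^sup>2 * r) * r\<^sup>2"
    by (simp add: power2_eq_square power3_eq_cube mult_ac)
  then show ?thesis using assms by (simp add: C_def)
qed

text \<open>
  Replacing \<open>m\<close> by the constant \<open>M\<close> costs little: on the ball of radius \<open>\<delta>\<close> the defect is of order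
  one, but weighted against the admissible singularity \<open>r powr (- 3 / 2)\<close> it contributes only
  \<open>sqrt \<delta>\<close>; outside that ball, \<open>m\<close> varies by at most the density at \<open>\<delta>\<close>.
\<close>

lemma phi1_approx:
  assumes G: "continuous_on {0..1} G" "G 0 = 0" "G 1 = 0"
      "\<And>r. 0 < r \<Longrightarrow> r < 1 \<Longrightarrow> (G has_real_derivative G1 r) (at r)"
      "\<And>r. 0 < r \<Longrightarrow> r < 1 \<Longrightarrow> (G1 has_real_derivative G2 r) (at r)"
      "\<And>r. 0 < r \<Longrightarrow> r < 1 \<Longrightarrow> radial_op d B T r (G r) (G1 r) (G2 r) = 1 / r ^ (d - 1)"
    and \<delta>: "0 < \<delta>" "\<delta> \<le> \<delta>\<^sub>0" and r: "r \<in> {0..1}"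
  shows "\<bar>\<phi>1 r - M * G r\<bar> \<le> 4 * (m_max * sqrt \<delta> + l * g (\<phi> \<delta>)) / B"
proof -
  define C where "C = m_max * sqrt \<delta> + l * g (\<phi> \<delta>)"
  have g\<delta>: "0 \<le> l * g (\<phi> \<delta>)" using l g_pos[OF above[of \<delta>]] \<delta> \<delta>\<^sub>0 by simp
  have C: "0 \<le> C" using m_max \<delta> g\<delta> by (simp add: C_def)
  have inc: "m s - m \<delta> \<le> l * g (\<phi> \<delta>)" if "\<delta> \<le> s" "s < 1" for s
  proof -
    have "s ^ d - \<delta> ^ d \<le> 1" using power_le_one[of s d] that \<delta> zero_le_power[of \<delta> d] by linarith
    then have "(s ^ d - \<delta> ^ d) / d \<le> 1" using d by auto
    from mult_left_mono[OF this g\<delta>] m_increment[OF \<delta>(1) that] show ?thesis by simp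
  qed
  have mM: "\<bar>m r - M\<bar> / r ^ (d - 1) \<le> C / (r * sqrt r)" if r: "0 < r" "r < 1" for r
  proof (cases "r < \<delta>")
    case True
    then have "m r \<le> M" unfolding M_def using r \<delta> \<delta>\<^sub>0 by (intro m_mono) auto
    then have "\<bar>m r - M\<bar> \<le> m_max" using m_nonneg[of r] r m_max(2) by simp
    then have "\<bar>m r - M\<bar> * (1 / r ^ (d - 1)) \<le> m_max * (1 / r)"
      using inverse_power_le[OF r] r by (intro mult_mono) auto
    also have "\<dots> = m_max * sqrt r / (r * sqrt r)" using r by simp
    also have "\<dots> \<le> C / (r * sqrt r)"
      using r True g\<delta> m_max by (intro divide_right_mono) (auto simp: C_def intro!: add_increasing2)
    finally show ?thesis by simp
  next
    case False
    have "M - m \<delta> \<le> l * g (\<phi> \<delta>)" "m \<delta> \<le> M" "m \<delta> \<le> m r"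
      using inc[OF \<delta>(2) \<delta>\<^sub>0(2)] m_mono[of \<delta> \<delta>\<^sub>0] m_mono[of \<delta> r] \<delta> \<delta>\<^sub>0 False r by (auto simp: M_def)
    then have "\<bar>m r - M\<bar> \<le> l * g (\<phi> \<delta>)" using inc[of r] False r by auto
    also have "\<dots> \<le> C" using m_max \<delta> by (simp add: C_def)
    finally have "\<bar>m r - M\<bar> * (1 / r ^ (d - 1)) \<le> C * (1 / (r * sqrt r))"
      using order_trans[OF inverse_power_le[OF r]] r C by (intro mult_mono) auto
    then show ?thesis by simp
  qed
  have sq: "4 * C / B * sqrt r \<le> 4 * C / B"
    using r C B by (intro mult_left_le) auto
  have "1 * \<phi>1 r - M * G r \<le> 4 * C / B * sqrt r"
  proof (rule sqrt_barrier[where d = d and T = T and z = "\<lambda>r. 1 * \<phi>1 r - M * G r"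
        and ?z1.0 = "\<lambda>r. 1 * \<phi>2 r - M * G1 r" and ?z2.0 = "\<lambda>r. 1 * \<phi>3 r - M * G2 r",
        OF _ B T C _ _ _ _ _ _ r])
    fix r :: real assume r: "0 < r" "r < 1"
    have "(m r - M) / r ^ (d - 1) \<le> \<bar>m r - M\<bar> / r ^ (d - 1)"
      using r by (intro divide_right_mono) auto
    with mM[OF r] show "radial_op d B T r (1 * \<phi>1 r - M * G r) (1 * \<phi>2 r - M * G1 r)
        (1 * \<phi>3 r - M * G2 r) \<le> C / (r * sqrt r)"
      unfolding radial_op_diff eq[OF r] G(6)[OF r] by (simp add: diff_divide_distrib)
  qed (use d bc G in \<open>auto intro!: continuous_intros cont1 derivative_eq_intros deriv1 deriv2\<close>)
  moreover have "M * G r - 1 * \<phi>1 r \<le> 4 * C / B * sqrt r"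
  proof (rule sqrt_barrier[where d = d and T = T and z = "\<lambda>r. M * G r - 1 * \<phi>1 r"
        and ?z1.0 = "\<lambda>r. M * G1 r - 1 * \<phi>2 r" and ?z2.0 = "\<lambda>r. M * G2 r - 1 * \<phi>3 r",
        OF _ B T C _ _ _ _ _ _ r])
    fix r :: real assume r: "0 < r" "r < 1"
    have "(M - m r) / r ^ (d - 1) \<le> \<bar>m r - M\<bar> / r ^ (d - 1)"
      using r by (intro divide_right_mono) auto
    with mM[OF r] show "radial_op d B T r (M * G r - 1 * \<phi>1 r) (M * G1 r - 1 * \<phi>2 r)
        (M * G2 r - 1 * \<phi>3 r) \<le> C / (r * sqrt r)"
      unfolding radial_op_diff eq[OF r] G(6)[OF r] by (simp add: diff_divide_distrib)
  qed (use d bc G in \<open>auto intro!: continuous_intros cont1 derivative_eq_intros deriv1 deriv2\<close>)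
  ultimately show ?thesis using sq by (simp add: C_def abs_le_iff)
qed

end

section \<open>The derivative of the limit profile\<close>

definition powser :: "(nat \<Rightarrow> real) \<Rightarrow> real \<Rightarrow> real" where
  "powser c t = (\<Sum>n. c n * t ^ n)"

definition entire_coeffs :: "(nat \<Rightarrow> real) \<Rightarrow> bool" where
  "entire_coeffs c \<longleftrightarrow> (\<forall>t. summable (\<lambda>n. c n * t ^ n))"

lemma entire_coeffs_diffs: "entire_coeffs c \<Longrightarrow> entire_coeffs (diffs c)"
  unfolding entire_coeffs_def using termdiff_converges_all by blast

lemma powser_deriv:
  "entire_coeffs c \<Longrightarrow> (powser c has_real_derivative powser (diffs c) t) (at t)"
  unfolding entire_coeffs_def powser_def[abs_def]
  by (rule termdiffs_strong_converges_everywhere) blast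

lemma powser_square_deriv:
  assumes "entire_coeffs c"
  shows "((\<lambda>r. powser c (r\<^sup>2)) has_real_derivative 2 * r * powser (diffs c) (r\<^sup>2)) (at r)"
  using DERIV_chain2[OF powser_deriv[OF assms] DERIV_power[OF DERIV_ident, of 2]]
  by (simp add: mult_ac)

lemma Ck_on_powser_square:
  "entire_coeffs c \<Longrightarrow> Ck_on k S (\<lambda>r. powser c (r\<^sup>2))"
proof (induction k arbitrary: c)
  case 0
  show ?case
    by (simp, intro continuous_at_imp_continuous_on ballI DERIV_isCont[OF powser_square_deriv[OF 0]])
next
  case (Suc k)
  have "Ck_on k S (\<lambda>r::real. r)" using Ck_on_inner[of k S "1::real"] by simp
  then have "Ck_on k S (\<lambda>r. 2 * r * powser (diffs c) (r\<^sup>2))"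
    by (intro Ck_on_mult Ck_on_const Suc.IH entire_coeffs_diffs Suc.prems)
  then show ?case
    by (rule Ck_on_SucI_real[OF powser_square_deriv[OF Suc.prems]])
qed

lemma powser_mono_term:
  assumes "entire_coeffs c" "\<And>n. 0 \<le> c n" "0 \<le> t"
  shows "c n * t ^ n \<le> powser c t"
  using sum_le_suminf[of "\<lambda>n. c n * t ^ n" "{n}"] assms
  by (simp add: powser_def entire_coeffs_def)

text \<open>
  Coefficients, in powers of \<open>r\<^sup>2\<close>, of the radial solution \<open>I\<close> of \<open>\<Delta> I = 1 + k I\<close> with \<open>I = 0\<close> at the
  centre. The inhomogeneity \<open>1\<close> covers \<open>k = 0\<close>, where \<open>I = r\<^sup>2 / (2 d)\<close>; otherwise \<open>1 + k I\<close> is a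
  hyperbolic cosine for \<open>d = 1\<close> and a modified Bessel function for \<open>d = 2\<close>.
\<close>

primrec torsion_coeff :: "nat \<Rightarrow> real \<Rightarrow> nat \<Rightarrow> real" where
  "torsion_coeff d k 0 = 0"
| "torsion_coeff d k (Suc j) =
     (if j = 0 then 1 else k * torsion_coeff d k j) / ((2 * real j + 2) * (2 * real j + real d))"

lemma torsion_coeff_bounds:
  assumes "1 \<le> d" "0 \<le> k"
  shows "0 \<le> torsion_coeff d k j \<and> torsion_coeff d k j \<le> (k + 1) ^ j / fact j"
proof (induction j)
  case 0 then show ?case by simp
next
  case (Suc j)
  let ?D = "(2 * real j + 2) * (2 * real j + real d)"
  let ?N = "if j = 0 then 1 else k * torsion_coeff d k j"
  have "(real j + 1) * 1 \<le> ?D" using assms by (intro mult_mono) auto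
  then have D: "real j + 1 \<le> ?D" by simp
  have N: "0 \<le> ?N" using Suc assms by simp
  have "k * torsion_coeff d k j \<le> (k + 1) * ((k + 1) ^ j / fact j)"
    using Suc assms by (intro mult_mono) auto
  then have "?N \<le> (k + 1) * ((k + 1) ^ j / fact j)" using assms by auto
  then have "?N / ?D \<le> (k + 1) * ((k + 1) ^ j / fact j) / (real j + 1)"
    using D N assms by (intro frac_le) auto
  also have "\<dots> = (k + 1) ^ Suc j / fact (Suc j)" by (simp add: field_simps)
  finally show ?case using N D by simp
qed

lemma entire_torsion_coeff:
  assumes "1 \<le> d" "0 \<le> k"
  shows "entire_coeffs (torsion_coeff d k)"
  unfolding entire_coeffs_def
proof
  fix t :: real
  show "summable (\<lambda>n. torsion_coeff d k n * t ^ n)"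
  proof (rule summable_comparison_test'[where N=0])
    show "summable (\<lambda>n. inverse (fact n) * ((k + 1) * \<bar>t\<bar>) ^ n)" by (rule summable_exp)
    fix n
    have "\<bar>torsion_coeff d k n\<bar> * \<bar>t\<bar> ^ n \<le> (k + 1) ^ n / fact n * \<bar>t\<bar> ^ n"
      using torsion_coeff_bounds[OF assms, of n] by (intro mult_right_mono) auto
    then show "norm (torsion_coeff d k n * t ^ n) \<le> inverse (fact n) * ((k + 1) * \<bar>t\<bar>) ^ n"
      by (simp add: abs_mult power_abs power_mult_distrib divide_inverse mult_ac)
  qed
qed

text \<open>
  This is \<open>\<Delta> I = 1 + k I\<close> in the variable \<open>t = r\<^sup>2\<close>, where the radial Laplacian becomes
  \<open>2 d S' + 4 t S''\<close>.
\<close>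

lemma torsion_powser_ode:
  assumes d: "1 \<le> d" "0 \<le> k"
  defines "c \<equiv> torsion_coeff d k"
  shows "2 * real d * powser (diffs c) t + 4 * t * powser (diffs (diffs c)) t = 1 + k * powser c t"
proof -
  note e = entire_torsion_coeff[OF d, folded c_def]
  note e1 = entire_coeffs_diffs[OF e] note e2 = entire_coeffs_diffs[OF e1]
  have sums: "(\<lambda>n. a n * t ^ n) sums powser a t" if "entire_coeffs a" for a
    using that unfolding entire_coeffs_def powser_def by (simp add: summable_sums)
  have "summable (\<lambda>n. diffs (diffs c) n * t ^ n)" using e2 by (simp add: entire_coeffs_def)
  note euler = sums_mult[OF diffs_equiv[OF this], of "4 * t", folded powser_def]
  have "4 * t * (n * diffs c n * t ^ (n - Suc 0)) = 4 * (n * diffs c n * t ^ n)" for n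
    by (cases n) auto
  with euler have "(\<lambda>n. 4 * (n * diffs c n * t ^ n)) sums (4 * t * powser (diffs (diffs c)) t)"
    by (simp only:)
  from sums_add[OF sums_mult[OF sums[OF e1], of "2 * real d"] this]
  have 1: "(\<lambda>n. 2 * real d * (diffs c n * t ^ n) + 4 * (n * diffs c n * t ^ n)) sums
    (2 * real d * powser (diffs c) t + 4 * t * powser (diffs (diffs c)) t)" .
  have "(\<lambda>n. if n = 0 then t ^ n else 0) sums (t ^ 0)" by (rule sums_single)
  from sums_add[OF this sums_mult[OF sums[OF e], of k]]
  have 2: "(\<lambda>n. (if n = 0 then t ^ n else 0) + k * (c n * t ^ n)) sums (1 + k * powser c t)" by simp
  have eq: "2 * real d * (diffs c n * t ^ n) + 4 * (n * diffs c n * t ^ n) =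
      (if n = 0 then t ^ n else 0) + k * (c n * t ^ n)" for n
  proof -
    have D: "(2 * real n + 2) * (2 * real n + real d) \<noteq> 0" using d by simp
    have "(2 * real d + 4 * n) * diffs c n = (2 * real n + 2) * (2 * real n + real d) * c (Suc n)"
      by (simp add: diffs_def algebra_simps)
    also have "\<dots> = (if n = 0 then 1 else k * c n)" using D by (simp add: c_def)
    finally have "(2 * real d + 4 * n) * diffs c n * t ^ n = (if n = 0 then 1 else k * c n) * t ^ n" by simp
    then show ?thesis by (auto simp: algebra_simps c_def split: if_splits)
  qed
  show ?thesis by (rule sums_unique2[OF 1[unfolded eq] 2])
qed

text \<open>The primitive is needed on both sides of \<open>1\<close>, so that it is smooth at the boundary point.\<close>

lemma antiderivative_pos:
  fixes f :: "real \<Rightarrow> real"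
  assumes "continuous_on {0<..} f"
  shows "\<exists>F. F 1 = 0 \<and> (\<forall>r>0. (F has_real_derivative f r) (at r))"
proof (intro exI[of _ "\<lambda>u. LBINT y=ereal 1..ereal u. f y"] conjI allI impI)
  let ?F = "\<lambda>u. LBINT y=ereal 1..ereal u. f y"
  show "?F 1 = 0" by simp
  fix r :: real assume r: "0 < r"
  let ?a = "min r 1 / 2" and ?b = "max r 1 + 1"
  have ab: "?a \<le> 1" "1 \<le> ?b" "?a \<le> r" "r \<le> ?b" "r \<in> interior {?a..?b}" using r by auto
  have "continuous_on {?a..?b} f" using r by (intro continuous_on_subset[OF assms]) auto
  from interval_integral_FTC2[OF ab(1,2) this ab(3,4)]
  have "(?F has_vector_derivative f r) (at r)" by (simp only: at_within_interior[OF ab(5)])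
  then show "(?F has_real_derivative f r) (at r)"
    by (simp add: has_real_derivative_iff_has_vector_derivative)
qed

text \<open>
  Reduction of order. With \<open>\<Delta> I = 1 + k I\<close>, \<open>k = T / B\<close>, the function \<open>P = I'\<close> solves the
  homogeneous equation and is positive for \<open>r > 0\<close>. Inserting \<open>G = P q\<close> into the equation turns it into
  \<open>(r ^ (d - 1) * P\<^sup>2 * q')' = - P / B\<close>, which \<open>q' = - I / (B * r ^ (d - 1) * P\<^sup>2)\<close> satisfies. With
  \<open>q 1 = 0\<close> the boundary value at \<open>1\<close> and the positivity of \<open>G\<close> are immediate; at the centre
  \<open>q\<close> grows at most like \<open>1 / sqrt r\<close>, which the factor \<open>P\<close>, of order \<open>r\<close>, outweighs.
\<close>

lemma green_profile_exists:
  assumes d: "d = 1 \<or> d = 2" and B: "0 < B" and T: "0 \<le> T"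
  obtains G G1 G2 :: "real \<Rightarrow> real" where
    "continuous_on {0..} G" "G 0 = 0" "G 1 = 0" "\<And>r. 0 < r \<Longrightarrow> r < 1 \<Longrightarrow> 0 < G r"
    "\<And>r. 0 < r \<Longrightarrow> (G has_real_derivative G1 r) (at r)"
    "\<And>r. 0 < r \<Longrightarrow> (G1 has_real_derivative G2 r) (at r)"
    "\<And>r. 0 < r \<Longrightarrow> radial_op d B T r (G r) (G1 r) (G2 r) = 1 / r ^ (d - 1)"
    "\<And>k. Ck_on k {0<..} G"
proof -
  define k where "k = T / B"
  have k: "0 \<le> k" "T = B * k" using B T by (auto simp: k_def)
  have d1: "1 \<le> d" using d by auto
  define c where "c = torsion_coeff d k"
  have c0: "0 \<le> c n" for n using torsion_coeff_bounds[OF d1 k(1)] by (simp add: c_def)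
  then have c: "0 \<le> c n" "0 \<le> diffs c n" "0 \<le> diffs (diffs c) n" for n
    by (auto simp: diffs_def)
  have e: "entire_coeffs c" unfolding c_def by (rule entire_torsion_coeff[OF d1 k(1)])
  note e1 = entire_coeffs_diffs[OF e] note e2 = entire_coeffs_diffs[OF e1]
  define S0 where "S0 = powser c" define S1 where "S1 = powser (diffs c)"
  define S2 where "S2 = powser (diffs (diffs c))"
  define S3 where "S3 = powser (diffs (diffs (diffs c)))"
  have D0: "(S0 has_real_derivative S1 t) (at t)" and D1: "(S1 has_real_derivative S2 t) (at t)"
    and D2: "(S2 has_real_derivative S3 t) (at t)" for t
    unfolding S0_def S1_def S2_def S3_def by (rule powser_deriv e e1 e2)+
  have D0': "((\<lambda>r. S0 (r\<^sup>2)) has_real_derivative 2 * r * S1 (r\<^sup>2)) (at r)"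
    and D1': "((\<lambda>r. S1 (r\<^sup>2)) has_real_derivative 2 * r * S2 (r\<^sup>2)) (at r)"
    and D2': "((\<lambda>r. S2 (r\<^sup>2)) has_real_derivative 2 * r * S3 (r\<^sup>2)) (at r)" for r
    unfolding S0_def S1_def S2_def S3_def by (rule powser_square_deriv e e1 e2)+
  have ode: "2 * real d * S1 t + 4 * t * S2 t = 1 + k * S0 t" for t
    unfolding S0_def S1_def S2_def c_def by (rule torsion_powser_ode[OF d1 k(1)])
  have ode': "(2 * real d + 4) * S2 t + 4 * t * S3 t = k * S1 t" for t
  proof -
    have "((\<lambda>t. 2 * real d * S1 t + 4 * t * S2 t) has_real_derivative (2 * real d + 4) * S2 t + 4 * t * S3 t) (at t)"
      by (auto intro!: derivative_eq_intros D1 D2 simp: algebra_simps)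
    moreover have "((\<lambda>t. 1 + k * S0 t) has_real_derivative k * S1 t) (at t)"
      by (auto intro!: derivative_eq_intros D0)
    ultimately show ?thesis using DERIV_unique by (simp add: ode)
  qed
  have S0_pos: "0 < S0 t" if "0 < t" for t
  proof -
    have "c 1 * t ^ 1 \<le> S0 t" unfolding S0_def by (rule powser_mono_term[OF e c(1)]) (use that in simp)
    moreover have "0 < c 1 * t" using that d by (auto simp: c_def)
    ultimately show ?thesis by simp
  qed
  have S1_lower: "1 / (2 * real d) \<le> S1 t" if "0 \<le> t" for t
  proof -
    have "diffs c 0 * t ^ 0 \<le> S1 t" unfolding S1_def by (rule powser_mono_term[OF e1 c(2) that])
    then show ?thesis by (simp add: c_def diffs_def)
  qed
  have S1_pos: "0 < S1 t" if "0 \<le> t" for t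
    by (rule less_le_trans[OF _ S1_lower[OF that]]) (use d1 in simp)
  have S2_nonneg: "0 \<le> S2 t" if "0 \<le> t" for t
    using powser_mono_term[OF e2 c(3) that, of 0] c(3)[of 0] by (simp add: S2_def)
  have S1_mono: "S1 s \<le> S1 t" if "0 \<le> s" "s \<le> t" for s t
    by (rule DERIV_nonneg_imp_nondecreasing[OF that(2)]) (use D1 S2_nonneg that in force)
  have S0_le: "S0 t \<le> t * S1 t" if t: "0 < t" for t
  proof -
    obtain z where z: "0 < z" "z < t" "S0 t - S0 0 = (t - 0) * S1 z"
      using MVT2[OF t, of S0 S1] D0 by blast
    moreover have "S0 0 = 0" unfolding S0_def powser_def powser_zero by (simp add: c_def)
    ultimately show ?thesis using S1_mono[of z t] t by simp
  qed
  \<comment> \<open>Now \<open>I r = S0 (r\<^sup>2)\<close>; \<open>P\<close>, \<open>P1\<close>, \<open>P2\<close> are its first three derivatives.\<close>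
  define P where "P = (\<lambda>r. 2 * r * S1 (r\<^sup>2))"
  define P1 where "P1 = (\<lambda>r. 2 * S1 (r\<^sup>2) + 4 * r\<^sup>2 * S2 (r\<^sup>2))"
  define P2 where "P2 = (\<lambda>r. 12 * r * S2 (r\<^sup>2) + 8 * r^3 * S3 (r\<^sup>2))"
  have P_pos: "0 < P r" if "0 < r" for r using that S1_pos[of "r\<^sup>2"] by (simp add: P_def)
  have dP: "(P has_real_derivative P1 r) (at r)" for r
    unfolding P_def P1_def by (rule derivative_eq_intros D1' refl | simp add: power2_eq_square)+
  have D0P: "((\<lambda>r. S0 (r\<^sup>2)) has_real_derivative P r) (at r)" for r
    unfolding P_def by (rule D0')
  have dP1: "(P1 has_real_derivative P2 r) (at r)" for r
    unfolding P1_def P2_def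
    by (rule derivative_eq_intros D1' D2' refl | simp add: power2_eq_square power3_eq_cube algebra_simps)+
  have P_ode: "P2 r + (real d - 1) * (P1 r / r - P r / r\<^sup>2) = k * P r" if "0 < r" for r
  proof -
    have "P1 r / r - P r / r\<^sup>2 = 4 * r * S2 (r\<^sup>2)"
      using that by (simp add: P1_def P_def field_simps power2_eq_square)
    then have "P2 r + (real d - 1) * (P1 r / r - P r / r\<^sup>2) = 2 * r * ((2 * real d + 4) * S2 (r\<^sup>2) + 4 * r\<^sup>2 * S3 (r\<^sup>2))"
      by (simp add: P2_def algebra_simps power2_eq_square power3_eq_cube)
    then show ?thesis by (simp only: ode') (simp add: P_def)
  qed
  \<comment> \<open>\<open>R = - P q'\<close> is the contribution of \<open>q'\<close> to the derivative of \<open>G = P q\<close>.\<close>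
  define R where "R = (\<lambda>r. S0 (r\<^sup>2) * inverse (B * r ^ (d - 1) * P r))"
  have R_pos: "0 < R r" if "0 < r" for r
    using S0_pos[of "r\<^sup>2"] P_pos that B by (simp add: R_def)
  have dR: "(R has_real_derivative 1 / (B * r ^ (d - 1)) - R r * P1 r / P r - (real d - 1) * R r / r) (at r)"
    if r: "0 < r" for r
    using d
  proof
    assume "d = 1"
    then show ?thesis
      unfolding R_def using r B P_pos[OF r]
      by (auto intro!: derivative_eq_intros D0P dP) (simp add: field_simps power2_eq_square)
  next
    assume "d = 2"
    then show ?thesis
      unfolding R_def using r B P_pos[OF r]
      by (auto intro!: derivative_eq_intros D0P dP) (simp add: field_simps power2_eq_square)
  qed
  define Q where "Q = (\<lambda>r. - 1 * (R r * inverse (P r)))"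
  have Ck_id: "Ck_on n {0<..} (\<lambda>r::real. r)" for n
    using Ck_on_inner[of n "{0<..}" "1::real"] by simp
  have CkP: "Ck_on n {0<..} P" for n
    unfolding P_def S1_def by (intro Ck_on_mult Ck_on_const Ck_id Ck_on_powser_square e1)
  have CkQ: "Ck_on n {0<..} Q" for n
  proof -
    have "Ck_on n {0<..} (\<lambda>r::real. r ^ (d - 1))"
      using d Ck_on_const Ck_id by auto
    then have "Ck_on n {0<..} (\<lambda>r. inverse (B * r ^ (d - 1) * P r))"
      using B P_pos by (intro Ck_on_inverse Ck_on_mult Ck_on_const CkP) force+
    moreover have "Ck_on n {0<..} (\<lambda>r. inverse (P r))"
      using P_pos by (intro Ck_on_inverse CkP) force
    ultimately show ?thesis
      unfolding Q_def R_def S0_def by (intro Ck_on_mult Ck_on_const Ck_on_powser_square e)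
  qed
  obtain q where q: "q 1 = 0" "\<And>r. 0 < r \<Longrightarrow> (q has_real_derivative Q r) (at r)"
    using antiderivative_pos[of Q] CkQ[of 0] by auto
  have Ckq: "Ck_on n {0<..} q" for n
    by (rule Ck_on_SucD, rule Ck_on_SucI_real[OF q(2) CkQ]) auto
  define G where "G = (\<lambda>r. P r * q r)"
  define G1 where "G1 = (\<lambda>r. P1 r * q r - R r)"
  define G2 where "G2 = (\<lambda>r. P2 r * q r - 1 / (B * r ^ (d - 1)) + (real d - 1) * R r / r)"
  have dG: "(G has_real_derivative G1 r) (at r)" if "0 < r" for r
    unfolding G_def G1_def using P_pos[OF that]
    by (auto intro!: derivative_eq_intros dP q(2) that simp: Q_def field_simps)
  have dG1: "(G1 has_real_derivative G2 r) (at r)" if "0 < r" for r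
    unfolding G1_def G2_def using P_pos[OF that]
    by (auto intro!: derivative_eq_intros dP1 dR q(2) that simp: Q_def field_simps)
  have G_eq: "radial_op d B T r (G r) (G1 r) (G2 r) = 1 / r ^ (d - 1)" if r: "0 < r" for r
  proof -
    have "G2 r + (real d - 1) * (G1 r / r - G r / r\<^sup>2) =
        (P2 r + (real d - 1) * (P1 r / r - P r / r\<^sup>2)) * q r - 1 / (B * r ^ (d - 1))"
      unfolding G_def G1_def G2_def by (simp add: algebra_simps diff_divide_distrib)
    also have "\<dots> = k * G r - 1 / (B * r ^ (d - 1))" by (simp add: P_ode[OF r] G_def)
    finally have *: "G2 r + (real d - 1) * (G1 r / r - G r / r\<^sup>2) = k * G r - 1 / (B * r ^ (d - 1))" .
    show ?thesis unfolding radial_op_def * using B k by (simp add: algebra_simps)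
  qed
  have Q_neg: "Q r < 0" if "0 < r" for r using R_pos[OF that] P_pos[OF that] by (simp add: Q_def)
  have q_pos: "0 < q r" if "0 < r" "r < 1" for r
    using DERIV_neg_imp_decreasing[OF that(2), of q] q Q_neg that by (metis less_le_trans)
  have Q_lower: "- 1 / (B * (r * sqrt r)) \<le> Q r" if r: "0 < r" "r < 1" for r
  proof -
    have S: "0 < S1 (r\<^sup>2)" using S1_pos by simp
    have "R r / P r \<le> (r\<^sup>2 * S1 (r\<^sup>2)) * inverse (B * r ^ (d - 1) * P r) / P r"
      unfolding R_def using S0_le[of "r\<^sup>2"] r B P_pos[of r]
      by (intro divide_right_mono mult_right_mono) auto
    also have "\<dots> = 1 / (4 * S1 (r\<^sup>2)) * (1 / (B * r ^ (d - 1)))"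
      unfolding P_def using r S B by (simp add: field_simps power2_eq_square)
    also have "\<dots> \<le> 1 * (1 / (B * r ^ (d - 1)))"
      using S1_lower[of "r\<^sup>2"] r B S d by (intro mult_right_mono) (auto simp: field_simps)
    also have "\<dots> \<le> 1 / (B * (r * sqrt r))"
      using d r B by (auto simp: divide_simps mult_left_le mult_le_one)
    finally show ?thesis by (simp add: Q_def divide_inverse)
  qed
  have q_upper: "q r \<le> 2 / B / sqrt r" if r: "0 < r" "r < 1" for r
  proof -
    have "q r - 2 / B / sqrt r \<le> q 1 - 2 / B / sqrt 1"
    proof (rule nondecreasing_open[where f = "\<lambda>x. q x - 2 / B / sqrt x"
          and f' = "\<lambda>x. Q x + 1 / (B * (x * sqrt x))"])
      show D: "((\<lambda>x. q x - 2 / B / sqrt x) has_real_derivative Q x + 1 / (B * (x * sqrt x))) (at x)"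
        if "r < x" "x < 1" for x
        using r that B by (auto intro!: derivative_eq_intros q(2) simp: field_simps)
      have "isCont q x" if "0 < x" for x using q(2)[OF that] DERIV_isCont by blast
      then show "continuous_on {r..1} (\<lambda>x. q x - 2 / B / sqrt x)"
        using r B by (intro continuous_intros continuous_at_imp_continuous_on) auto
      show "0 \<le> Q x + 1 / (B * (x * sqrt x))" if "r < x" "x < 1" for x
        using Q_lower[of x] r that by simp
    qed (use r in simp)
    then have "q r - 2 / B / sqrt r \<le> 0 - 2 / B" by (simp only: q(1) real_sqrt_one div_by_1)
    moreover have "0 \<le> 2 / B" using B by simp
    ultimately show ?thesis by linarith
  qed
  have G0: "G 0 = 0" by (simp add: G_def P_def)
  have G_pos: "0 < G r" if "0 < r" "r < 1" for r using P_pos[of r] q_pos that by (simp add: G_def)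
  have G_le: "G r \<le> 4 / B * S1 1 * sqrt r" if r: "0 < r" "r < 1" for r
  proof -
    have "G r \<le> (2 * r * S1 1) * (2 / B / sqrt r)"
      unfolding G_def P_def using r S1_mono[of "r\<^sup>2" 1] S1_pos[of 1] S1_pos[of "r\<^sup>2"] q_upper[OF r] q_pos[OF r]
      by (intro mult_mono) (auto simp: power_le_one)
    also have "\<dots> = 4 / B * S1 1 * sqrt r"
      using r B by (simp add: field_simps)
    finally show ?thesis .
  qed
  have contG: "continuous_on {0..} G"
  proof (rule continuous_on_eq_continuous_within[THEN iffD2], rule ballI)
    fix x :: real assume x: "x \<in> {0..}"
    show "continuous (at x within {0..}) G"
    proof (cases "x = 0")
      case True
      have "((\<lambda>r. 4 / B * S1 1 * sqrt r) \<longlongrightarrow> 4 / B * S1 1 * sqrt 0) (at 0 within {0..})"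
        by (intro tendsto_intros)
      then have "((\<lambda>r. 4 / B * S1 1 * sqrt r) \<longlongrightarrow> 0) (at 0 within {0..})" by simp
      moreover have "\<forall>\<^sub>F r in at 0 within {0..}. norm (G r) \<le> 4 / B * S1 1 * sqrt r"
      proof -
        have "norm (G r) \<le> 4 / B * S1 1 * sqrt r" if "r \<in> {0..}" "r \<noteq> 0" "dist r 0 < 1 / 2" for r
          using G_le[of r] G_pos[of r] that by (simp add: dist_real_def)
        then show ?thesis unfolding eventually_at by (intro exI[of _ "1 / 2"]) simp
      qed
      ultimately have "(G \<longlongrightarrow> 0) (at 0 within {0..})" by (rule Lim_null_comparison[rotated])
      then show ?thesis using True G0 by (simp add: continuous_within)
    next
      case False
      then have "0 < x" using x by simp
      then show ?thesis by (rule continuous_at_imp_continuous_within[OF DERIV_isCont[OF dG]])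
    qed
  qed
  have G_1: "G 1 = 0" by (simp add: G_def q)
  have CkG: "Ck_on n {0<..} G" for n unfolding G_def by (intro Ck_on_mult CkP Ckq)
  show thesis by (rule that[OF contG G0 G_1 G_pos dG dG1 G_eq CkG])
qed

section \<open>Profiles of radial solutions\<close>

lemma line_derivative:
  fixes u :: "'a::euclidean_space \<Rightarrow> real"
  assumes u: "Ck_on (Suc k) (ball 0 1) u" and e: "e \<in> Basis" and r: "\<bar>r\<bar> < 1"
  shows "((\<lambda>r. u (r *\<^sub>R e)) has_real_derivative partial e u (r *\<^sub>R e)) (at r)"
proof -
  have x: "r *\<^sub>R e \<in> ball 0 1" using e r by simp
  have "((\<lambda>r. r *\<^sub>R e) has_derivative (\<lambda>h. h *\<^sub>R e)) (at r)"
    by (auto intro!: derivative_eq_intros)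
  from has_derivative_compose[OF this Ck_on_open_partial(1)[OF open_ball u x]]
  have D: "((\<lambda>r. u (r *\<^sub>R e)) has_derivative
      (\<lambda>h. \<Sum>i\<in>Basis. (h *\<^sub>R e \<bullet> i) * partial i u (r *\<^sub>R e))) (at r)" .
  have "(\<Sum>i\<in>Basis. (h *\<^sub>R e \<bullet> i) * partial i u (r *\<^sub>R e)) = partial e u (r *\<^sub>R e) * h" for h
  proof -
    have "(\<Sum>i\<in>Basis. (h *\<^sub>R e \<bullet> i) * partial i u (r *\<^sub>R e)) =
        (\<Sum>i\<in>Basis. if i = e then h * partial i u (r *\<^sub>R e) else 0)"
      using e by (intro sum.cong) (auto simp: inner_Basis)
    then show ?thesis using e by simp
  qed
  with D show ?thesis by (simp add: has_field_derivative_def)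
qed

text \<open>
  Used for the Laplacian of a radial solution along a line through the centre: it removes the constant
  of integration when the equation is integrated once.
\<close>

lemma even_derivative_zero:
  fixes F :: "real \<Rightarrow> real"
  assumes D: "(F has_real_derivative c) (at 0)" and even: "\<And>r. \<bar>r\<bar> < 1 \<Longrightarrow> F (- r) = F r"
  shows "c = 0"
proof -
  have "((\<lambda>r. F (- r)) has_real_derivative c * (- 1)) (at 0)"
  proof (rule DERIV_chain2[where f = F and g = uminus])
    show "(F has_real_derivative c) (at (- 0))" using D by simp
    show "((\<lambda>r. - r) has_real_derivative (- 1 :: real)) (at 0)" by (rule DERIV_minus[OF DERIV_ident])
  qed
  then have "(F has_real_derivative c * (- 1)) (at 0)"
  proof (rule has_field_derivative_transform_within_open)
    show "F (- r) = F r" if "r \<in> {-1<..<1}" for r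
      by (rule even) (use that in auto)
  qed auto
  from DERIV_unique[OF D this] show ?thesis by simp
qed

lemma grad_radial_zero:
  fixes u :: "'a::euclidean_space \<Rightarrow> real"
  assumes u: "Ck_on 1 (cball 0 1) u" "radial u"
  shows "grad u 0 = 0"
proof -
  let ?G = "grad u 0"
  have D: "(u has_derivative (\<lambda>h. ?G \<bullet> h)) (at 0 within cball 0 1)"
    by (rule Ck_on_1_grad(1)[OF u(1)]) simp
  have "((\<lambda>x::'a. - x) has_derivative (\<lambda>h. - h)) (at 0 within cball 0 1)"
    by (auto intro!: derivative_eq_intros)
  moreover have "(u has_derivative (\<lambda>h. ?G \<bullet> h)) (at (- 0) within uminus ` cball 0 1)"
    using D by (auto intro: has_derivative_subset)
  ultimately have "((\<lambda>x. u (- x)) has_derivative (\<lambda>h. ?G \<bullet> (- h))) (at 0 within cball 0 1)"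
    by (rule has_derivative_in_compose)
  note D' = this
  have even: "u x = u (- x)" if "x \<in> cball 0 1" for x
  proof -
    have "- x \<in> cball 0 1" "norm x = norm (- x)" using that by auto
    with u(2) that show ?thesis unfolding radial_def by blast
  qed
  have "(u has_derivative (\<lambda>h. ?G \<bullet> (- h))) (at 0 within cball 0 1)"
    by (rule has_derivative_transform[OF _ even D']) auto
  from fun_cong[OF has_derivative_unique_cball[OF D this], of ?G]
  have "?G \<bullet> ?G = - (?G \<bullet> ?G)" unfolding inner_minus_right by simp
  then have "?G \<bullet> ?G = 0" by linarith
  then show ?thesis by (simp only: inner_eq_zero_iff)
qed

text \<open>
  The passage to the second-order problem. If \<open>\<psi>\<close> is the profile of the Laplacian of \<open>u\<close>, the
  equation reads \<open>(r ^ (d - 1) * (B * \<psi>' - T * \<phi>'))' = - l * g \<phi> * r ^ (d - 1)\<close>. As \<open>\<psi>\<close> and \<open>\<phi>\<close> have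
  vanishing derivative at the centre, \<open>m = - r ^ (d - 1) * (B * \<psi>' - T * \<phi>')\<close> starts from
  \<open>0\<close>; expressing \<open>\<psi>'\<close> through \<open>\<phi>\<close> gives the equation for \<open>\<phi>1\<close>.
\<close>

lemma radial_profile_of_solution:
  fixes u :: "'a::euclidean_space \<Rightarrow> real"
  assumes dim: "DIM('a) = 1 \<or> DIM('a) = 2" and B: "0 < B" and T: "0 \<le> T" and l: "0 < l"
    and u: "u \<in> solutions B T l" and e: "e \<in> Basis"
  obtains \<phi>1 \<phi>2 \<phi>3 m where "radial_profile DIM('a) B T l (\<lambda>r. u (r *\<^sub>R e)) \<phi>1 \<phi>2 \<phi>3 m"
    "\<And>x. x \<in> cball 0 1 \<Longrightarrow> grad u x = (\<phi>1 (norm x) / norm x) *\<^sub>R x"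
proof -
  let ?d = "DIM('a)"
  from u have rad: "radial u" and C4: "Ck_on 4 (ball 0 1) u" and C2: "Ck_on 2 (cball 0 1) u"
    and above: "\<And>x. x \<in> cball 0 1 \<Longrightarrow> -1 < u x"
    and pde: "\<And>x. x \<in> ball 0 1 \<Longrightarrow> B * laplacian (laplacian u) x - T * laplacian u x = - l * g (u x)"
    and cl: "clamped u" by (auto simp: solutions_def)
  have C1: "Ck_on 1 (cball 0 1) u" using Ck_on_SucD[of 1] C2 by (simp only: numeral_2_eq_2 One_nat_def)
  have four: "(4::nat) = Suc (Suc (Suc (Suc 0)))" by simp
  have c4: "Ck_on (Suc (Suc (Suc (Suc 0)))) (ball 0 1) u" 
    using C4 by (simp only: four)
  define u1 where "u1 = partial e u" define u2 where "u2 = partial e u1" define u3 where "u3 = partial e u2"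
  have c3: "Ck_on (Suc (Suc (Suc 0))) (ball 0 1) u1"
    unfolding u1_def by (rule Ck_on_open_partial(2)[OF open_ball c4 e])
  have c2: "Ck_on (Suc (Suc 0)) (ball 0 1) u2"
    unfolding u2_def by (rule Ck_on_open_partial(2)[OF open_ball c3 e])
  define w where "w = laplacian u"
  have w2: "Ck_on (Suc (Suc 0)) (ball 0 1) w"
    unfolding w_def by (rule Ck_on_laplacian[OF open_ball c4])
  define w1 where "w1 = partial e w"
  have w1C: "Ck_on (Suc 0) (ball 0 1) w1"
    unfolding w1_def by (rule Ck_on_open_partial(2)[OF open_ball w2 e])
  have e1: "norm e = 1" "e \<noteq> 0" using e by auto
  define \<phi> where "\<phi> = (\<lambda>r. u (r *\<^sub>R e))"
  define \<phi>1 where "\<phi>1 = (\<lambda>r. grad u (r *\<^sub>R e) \<bullet> e)"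
  define \<phi>2 where "\<phi>2 = (\<lambda>r. u2 (r *\<^sub>R e))"
  define \<phi>3 where "\<phi>3 = (\<lambda>r. u3 (r *\<^sub>R e))"
  define \<psi> where "\<psi> = (\<lambda>r. w (r *\<^sub>R e))"
  define \<psi>1 where "\<psi>1 = (\<lambda>r. w1 (r *\<^sub>R e))"
  define \<psi>2 where "\<psi>2 = (\<lambda>r. partial e w1 (r *\<^sub>R e))"
  have u_\<phi>: "u x = \<phi> (norm x)" if "x \<in> cball 0 1" for x
  proof -
    have "norm x *\<^sub>R e \<in> cball 0 1" "norm x = norm (norm x *\<^sub>R e)" using that e1 by auto
    with rad that show ?thesis unfolding radial_def \<phi>_def by blast
  qed
  have deriv: "(\<phi> has_real_derivative \<phi>1 r) (at r within {0..1})" if r: "r \<in> {0..1}" for r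
  proof -
    have "((\<lambda>r. r *\<^sub>R e) has_derivative (\<lambda>h. h *\<^sub>R e)) (at r within {0..1})"
      by (auto intro!: derivative_eq_intros)
    moreover have "(u has_derivative (\<lambda>h. grad u (r *\<^sub>R e) \<bullet> h)) (at (r *\<^sub>R e) within (\<lambda>r. r *\<^sub>R e) ` {0..1})"
      by (rule has_derivative_subset[OF Ck_on_1_grad(1)[OF C1]]) (use r e1 in auto)
    ultimately have "((\<lambda>r. u (r *\<^sub>R e)) has_derivative (\<lambda>h. grad u (r *\<^sub>R e) \<bullet> (h *\<^sub>R e))) (at r within {0..1})"
      by (rule has_derivative_in_compose)
    then show ?thesis
      unfolding has_field_derivative_def \<phi>_def \<phi>1_def by (simp add: mult.commute[of _ "_ \<bullet> _"])
  qed
  have deriv_at: "(\<phi> has_real_derivative \<phi>1 r) (at r)" if "0 < r" "r < 1" for r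
    using deriv[of r] at_within_Icc_at[of 0 r 1] that by simp
  have \<phi>1_eq: "\<phi>1 r = u1 (r *\<^sub>R e)" if "0 < r" "r < 1" for r
    unfolding u1_def using DERIV_unique[OF deriv_at[OF that] line_derivative[OF c4 e, folded \<phi>_def]] that by simp
  have deriv1: "(\<phi>1 has_real_derivative \<phi>2 r) (at r)" if r: "0 < r" "r < 1" for r
  proof (rule has_field_derivative_transform_within_open)
    show "((\<lambda>r. u1 (r *\<^sub>R e)) has_real_derivative \<phi>2 r) (at r)"
      unfolding \<phi>2_def u2_def using r by (intro line_derivative[OF c3 e]) auto
    show "u1 (x *\<^sub>R e) = \<phi>1 x" if "x \<in> {0<..<1}" for x using \<phi>1_eq that by simp
  qed (use r in auto)
  have deriv2: "(\<phi>2 has_real_derivative \<phi>3 r) (at r)" if r: "0 < r" "r < 1" for r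
    unfolding \<phi>3_def \<phi>2_def u3_def using r by (intro line_derivative[OF c2 e]) auto
  have dpsi: "(\<psi> has_real_derivative \<psi>1 r) (at r)" if r: "\<bar>r\<bar> < 1" for r
    unfolding \<psi>_def \<psi>1_def w1_def by (rule line_derivative[OF w2 e r])
  have dpsi1: "(\<psi>1 has_real_derivative \<psi>2 r) (at r)" if r: "\<bar>r\<bar> < 1" for r
    unfolding \<psi>1_def \<psi>2_def by (rule line_derivative[OF w1C e r])
  have w_formula: "w x = \<phi>2 (norm x) + (real ?d - 1) * (\<phi>1 (norm x) / norm x)"
    if x: "x \<in> ball 0 1 - {0}" for x
    unfolding w_def
    by (rule laplacian_radial[of "ball 0 1 - {0}" x u \<phi> \<phi>1]) (use x u_\<phi> deriv_at deriv1 in auto)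
  have \<psi>_eq: "\<psi> r = \<phi>2 r + (real ?d - 1) * (\<phi>1 r / r)" if "0 < r" "r < 1" for r
    unfolding \<psi>_def using w_formula[of "r *\<^sub>R e"] that e1 e by auto
  have w_\<psi>: "w x = \<psi> (norm x)" if "x \<in> ball 0 1 - {0}" for x
    using w_formula[OF that] \<psi>_eq[of "norm x"] that by simp
  have \<psi>_even: "\<psi> (- r) = \<psi> r" if "\<bar>r\<bar> < 1" for r
  proof (cases "r = 0")
    case False
    then have "w (- r *\<^sub>R e) = w (r *\<^sub>R e)"
      using w_\<psi>[of "- r *\<^sub>R e"] w_\<psi>[of "r *\<^sub>R e"] that e1 e by auto
    then show ?thesis by (simp add: \<psi>_def)
  qed simp
  have \<psi>1_0: "\<psi>1 0 = 0" by (rule even_derivative_zero[OF dpsi \<psi>_even]) auto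
  have lap_w: "laplacian w (r *\<^sub>R e) = \<psi>2 r + (real ?d - 1) * (\<psi>1 r / r)" if r: "0 < r" "r < 1" for r
  proof -
    have n: "norm (r *\<^sub>R e) = r" using r e1 by simp
    have "laplacian w (r *\<^sub>R e) = \<psi>2 r + (real ?d - 1) * (\<psi>1 (norm (r *\<^sub>R e)) / norm (r *\<^sub>R e))"
      by (rule laplacian_radial[of "ball 0 1 - {0}" _ w \<psi> \<psi>1]) (use r e1 e w_\<psi> dpsi dpsi1 in auto)
    then show ?thesis using n by simp
  qed
  have ode: "B * (\<psi>2 r + (real ?d - 1) * (\<psi>1 r / r)) - T * (\<phi>2 r + (real ?d - 1) * (\<phi>1 r / r)) = - l * g (\<phi> r)"
    if r: "0 < r" "r < 1" for r
    using pde[of "r *\<^sub>R e"] lap_w[OF r] \<psi>_eq[OF r] r e1 unfolding w_def[symmetric] \<psi>_def \<phi>_def by simp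
  have \<psi>1_eq: "\<psi>1 r = \<phi>3 r + (real ?d - 1) * (\<phi>2 r / r - \<phi>1 r / r\<^sup>2)" if r: "0 < r" "r < 1" for r
  proof -
    have "((\<lambda>r. \<phi>2 r + (real ?d - 1) * (\<phi>1 r / r)) has_real_derivative
        \<phi>3 r + (real ?d - 1) * (\<phi>2 r / r - \<phi>1 r / r\<^sup>2)) (at r)"
      using r by (auto intro!: derivative_eq_intros deriv1 deriv2 simp: field_simps power2_eq_square)
    then have "(\<psi> has_real_derivative \<phi>3 r + (real ?d - 1) * (\<phi>2 r / r - \<phi>1 r / r\<^sup>2)) (at r)"
      by (rule has_field_derivative_transform_within_open[of _ _ _ "{0<..<1}"]) (use r \<psi>_eq in auto)
    then show ?thesis using DERIV_unique dpsi[of r] r by auto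
  qed
  define m where "m = (\<lambda>r. - (r ^ (?d - 1) * (B * \<psi>1 r - T * \<phi>1 r)))"
  have grad0: "grad u 0 = 0" by (rule grad_radial_zero[OF C1 rad])
  have \<phi>1_0: "\<phi>1 0 = 0" by (simp add: \<phi>1_def grad0)
  have cont1: "continuous_on {0..1} \<phi>1"
    unfolding \<phi>1_def
    by (intro continuous_intros continuous_on_compose2[OF Ck_on_1_grad(2)[OF C1]]) (use e1 in auto)
  have "radial_profile ?d B T l \<phi> \<phi>1 \<phi>2 \<phi>3 m"
  proof
    show "\<phi> 1 = 0" "\<phi>1 1 = 0"
      using cl e1 unfolding clamped_def normal_deriv_def \<phi>_def \<phi>1_def by auto
    show "-1 < \<phi> r" if "r \<in> {0..1}" for r using that above[of "r *\<^sub>R e"] e1 by (simp add: \<phi>_def)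
    show "continuous_on {0..<1} m"
    proof -
      have "continuous_on {0..<1} \<psi>1"
        by (intro continuous_at_imp_continuous_on ballI DERIV_isCont[OF dpsi1]) auto
      moreover have "continuous_on {0..<1} \<phi>1" by (rule continuous_on_subset[OF cont1]) auto
      ultimately show ?thesis unfolding m_def by (intro continuous_intros)
    qed
    show "m 0 = 0" by (simp add: m_def \<psi>1_0 \<phi>1_0)
    fix r :: real assume r: "0 < r" "r < 1"
    show "radial_op ?d B T r (\<phi>1 r) (\<phi>2 r) (\<phi>3 r) = m r / r ^ (?d - 1)"
      using r unfolding radial_op_def \<psi>1_eq[OF r, symmetric] m_def by simp
    show "(m has_real_derivative l * g (\<phi> r) * r ^ (?d - 1)) (at r)"
      using dim
    proof
      assume d: "?d = 1"
      have "(m has_real_derivative - (B * \<psi>2 r - T * \<phi>2 r)) (at r)"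
        unfolding m_def d using r by (auto intro!: derivative_eq_intros dpsi1 deriv1)
      moreover have "- (B * \<psi>2 r - T * \<phi>2 r) = l * g (\<phi> r) * r ^ (?d - 1)"
        using ode[OF r] d by simp
      ultimately show ?thesis by (simp only:)
    next
      assume d: "?d = 2"
      have "(m has_real_derivative - ((B * \<psi>1 r - T * \<phi>1 r) + r * (B * \<psi>2 r - T * \<phi>2 r))) (at r)"
        unfolding m_def d using r by (auto intro!: derivative_eq_intros dpsi1 deriv1)
      moreover have "r * (B * (\<psi>2 r + \<psi>1 r / r) - T * (\<phi>2 r + \<phi>1 r / r)) = r * (- l * g (\<phi> r))"
        using ode[OF r] d by simp
      then have "- ((B * \<psi>1 r - T * \<phi>1 r) + r * (B * \<psi>2 r - T * \<phi>2 r)) = l * g (\<phi> r) * r ^ (?d - 1)"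
        using d r by (simp add: algebra_simps)
      ultimately show ?thesis by (simp only:)
    qed
  qed (use dim B T l deriv deriv1 deriv2 cont1 \<phi>1_0 in auto)
  moreover have "grad u x = (\<phi>1 (norm x) / norm x) *\<^sub>R x" if x: "x \<in> cball 0 1" for x
  proof (cases "x = 0")
    case False
    have "(\<phi> has_real_derivative \<phi>1 (norm x)) (at (norm x) within norm ` cball (0::'a) 1)"
      by (rule has_field_derivative_subset[OF deriv]) (use x in auto)
    from has_derivative_radial[OF this False]
    have "(u has_derivative (\<lambda>h. (\<phi>1 (norm x) / norm x) * (x \<bullet> h))) (at x within cball 0 1)"
      by (rule has_derivative_transform[rotated 2]) (use x u_\<phi> in auto)
    then show ?thesis by (intro grad_eqI[OF _ x]) simp
  qed (simp add: grad0)
  ultimately show thesis using that unfolding \<phi>_def by blast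
qed

section \<open>Convergence of profiles at touchdown\<close>

text \<open>
  The estimates for a single profile, with the constants chosen in the order in which they depend on
  each other: first the radius \<open>\<delta>\<close> of the ball that carries the load, then the size of the parameter
  that makes the density at \<open>\<delta>\<close> negligible, and last the distance to touchdown that forces the
  parameter to be so small. Since \<open>\<Gamma>\<close> is a primitive of \<open>G\<close>, integrating the approximation of \<open>\<phi>1\<close>
  over the unit interval identifies \<open>M\<close> up to a small error as \<open>1 / \<Gamma> 1\<close>.
\<close>

lemma profile_convergence:
  fixes G G1 G2 \<Gamma> :: "real \<Rightarrow> real"
  assumes d: "d = 1 \<or> d = 2" and B: "0 < B" and T: "0 \<le> T"
    and G: "continuous_on {0..1} G" "G 0 = 0" "G 1 = 0"
      "\<And>r. 0 < r \<Longrightarrow> r < 1 \<Longrightarrow> (G has_real_derivative G1 r) (at r)"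
      "\<And>r. 0 < r \<Longrightarrow> r < 1 \<Longrightarrow> (G1 has_real_derivative G2 r) (at r)"
      "\<And>r. 0 < r \<Longrightarrow> r < 1 \<Longrightarrow> radial_op d B T r (G r) (G1 r) (G2 r) = 1 / r ^ (d - 1)"
    and \<Gamma>: "continuous_on {0..1} \<Gamma>" "\<Gamma> 0 = 0" "0 < \<Gamma> 1"
      "\<And>r. 0 < r \<Longrightarrow> r < 1 \<Longrightarrow> (\<Gamma> has_real_derivative G r) (at r)"
    and \<epsilon>: "0 < \<epsilon>"
  shows "\<exists>\<eta>>0. \<forall>l \<phi> \<phi>1 \<phi>2 \<phi>3 m. radial_profile d B T l \<phi> \<phi>1 \<phi>2 \<phi>3 m \<longrightarrow> 1 + \<phi> 0 \<le> \<eta> \<longrightarrow>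
    l \<le> \<epsilon> \<and> (\<forall>r\<in>{0..1}. \<bar>\<phi>1 r - G r / \<Gamma> 1\<bar> \<le> \<epsilon> \<and> \<bar>\<phi> r - (\<Gamma> r / \<Gamma> 1 - 1)\<bar> \<le> \<epsilon>)"
proof -
  define \<delta>0 where "\<delta>0 = subsolution_radius B T"
  define K where "K = mass_bound B T"
  have \<delta>0: "0 < \<delta>0" "\<delta>0 < 1" using B T by (auto simp: \<delta>0_def subsolution_radius_def)
  have K: "0 < K" using B T \<delta>0 by (simp add: K_def mass_bound_def \<delta>0_def)
  obtain N where N: "0 < N" "\<And>r. r \<in> {0..1} \<Longrightarrow> \<bar>G r\<bar> \<le> N"
  proof -
    have "bounded (G ` {0..1})"
      by (intro compact_imp_bounded compact_continuous_image G) simp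
    then obtain N where "0 < N" "\<forall>x\<in>G ` {0..1}. norm x \<le> N" by (auto simp: bounded_pos)
    then show thesis by (intro that[of N]) auto
  qed
  \<comment> \<open>If \<open>\<phi>1\<close> is \<open>e\<close>-close to \<open>M * G\<close> and \<open>1 + \<phi> 0 \<le> e\<close>, then \<open>M\<close> is \<open>2 * e / \<Gamma> 1\<close>-close to \<open>1 / \<Gamma> 1\<close>.\<close>
  define e where "e = \<epsilon> / (1 + 2 * N / \<Gamma> 1)"
  have den: "0 < 1 + 2 * N / \<Gamma> 1" using N \<Gamma> by (simp add: add_pos_pos)
  have e: "0 < e" "e * (1 + 2 * N / \<Gamma> 1) = \<epsilon>"
    using \<epsilon> den unfolding e_def by (simp_all only: divide_pos_pos) simp
  define \<delta> where "\<delta> = min \<delta>0 ((e * B / (8 * K))\<^sup>2)"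
  have \<delta>: "0 < \<delta>" "\<delta> \<le> \<delta>0" using \<delta>0 e B K by (auto simp: \<delta>_def)
  have "sqrt \<delta> \<le> sqrt ((e * B / (8 * K))\<^sup>2)" unfolding \<delta>_def by (rule real_sqrt_le_mono) simp
  also have "\<dots> = e * B / (8 * K)" using e B K by simp
  finally have K\<delta>: "K * sqrt \<delta> \<le> e * B / 8" using K by (simp add: field_simps)
  \<comment> \<open>A lower bound for the distance of a nearly touching profile from \<open>-1\<close> at radius \<open>\<delta>\<close>.\<close>
  define \<kappa> where "\<kappa> = B * \<delta>0\<^sup>2 / 8 / (8 * B + T) * (\<delta>^3 / 12)"
  have \<kappa>: "0 < \<kappa>" using B T \<delta>0 \<delta> unfolding \<kappa>_def by (intro mult_pos_pos divide_pos_pos) auto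
  define l0 where "l0 = min \<epsilon> (e * B * \<kappa>\<^sup>2 / 8)"
  have l0: "0 < l0" "l0 \<le> \<epsilon>" "l0 \<le> e * B * \<kappa>\<^sup>2 / 8" using \<epsilon> e B \<kappa> by (auto simp: l0_def)
  define c where "c = 2 * K * (1 + 4 * K / B)\<^sup>2"
  have "0 < 1 + 4 * K / B" using K B by (simp add: add_pos_pos)
  then have c: "0 < c" unfolding c_def using K by (intro mult_pos_pos zero_less_power) auto
  define \<rho> where "\<rho> = min (1 / 2) (l0 / c)"
  have \<rho>: "0 < \<rho>" "\<rho> < 1" using c l0 by (auto simp: \<rho>_def)
  have "c * \<rho> \<le> c * (l0 / c)" unfolding \<rho>_def using c by (intro mult_left_mono) auto
  then have c\<rho>: "c * \<rho> \<le> l0" using c by simp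
  define \<eta> where "\<eta> = min (1 / 2) (min (\<rho> * sqrt \<rho>) e)"
  have \<eta>: "0 < \<eta>" "\<eta> \<le> 1 / 2" "\<eta> \<le> \<rho> * sqrt \<rho>" "\<eta> \<le> e" using \<rho> e by (auto simp: \<eta>_def)
  show ?thesis
  proof (intro exI[of _ \<eta>] conjI allI impI \<eta>(1))
    fix l \<phi> \<phi>1 \<phi>2 \<phi>3 m
    assume "radial_profile d B T l \<phi> \<phi>1 \<phi>2 \<phi>3 m" and small: "1 + \<phi> 0 \<le> \<eta>"
    then interpret radial_profile d B T l \<phi> \<phi>1 \<phi>2 \<phi>3 m by simp
    have "l \<le> c * \<rho>"
      using parameter_le[OF \<rho>] small \<eta>(3) by (simp add: c_def K_def)
    then have ll0: "l \<le> l0" using c\<rho> by simp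
    then show "l \<le> \<epsilon>" using l0 by simp
    have "\<kappa> \<le> M / (8 * B + T) * (\<delta>^3 / 12)"
      unfolding \<kappa>_def using M_lower small \<eta>(2) B T \<delta>
      by (intro mult_right_mono divide_right_mono) (auto simp: \<delta>0_def)
    also have "\<dots> \<le> \<phi> \<delta> - \<phi> 0" by (rule phi_lower) (use \<delta> \<delta>0 in simp)
    finally have "\<kappa> \<le> 1 + \<phi> \<delta>" using above[of 0] by simp
    then have "g (\<phi> \<delta>) \<le> 1 / \<kappa>\<^sup>2"
      unfolding g_def using \<kappa> by (intro divide_left_mono power_mono) auto
    then have "l * g (\<phi> \<delta>) \<le> (e * B * \<kappa>\<^sup>2 / 8) * (1 / \<kappa>\<^sup>2)"
      using ll0 l0 l g_pos[OF above[of \<delta>]] \<delta> \<delta>0 by (intro mult_mono) auto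
    also have "\<dots> = e * B / 8" using \<kappa> by simp
    finally have "K * sqrt \<delta> + l * g (\<phi> \<delta>) \<le> e * B / 4" using K\<delta> by simp
    then have bound: "4 * (K * sqrt \<delta> + l * g (\<phi> \<delta>)) / B \<le> e" using B by (simp add: field_simps)
    have near: "\<bar>\<phi>1 r - M * G r\<bar> \<le> e" if "r \<in> {0..1}" for r
      using order_trans[OF phi1_approx[OF G \<delta>(1) _ that, folded K_def] bound] \<delta> by (simp add: \<delta>0_def)
    have "\<bar>(\<phi> 1 - M * \<Gamma> 1) - (\<phi> 0 - M * \<Gamma> 0)\<bar> \<le> e * (1 - 0)"
    proof (rule abs_increment_le[where f = "\<lambda>r. \<phi> r - M * \<Gamma> r" and f' = "\<lambda>r. \<phi>1 r - M * G r"])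
      show "continuous_on {0..1} (\<lambda>r. \<phi> r - M * \<Gamma> r)" by (intro continuous_intros cont \<Gamma>)
      show "((\<lambda>r. \<phi> r - M * \<Gamma> r) has_real_derivative \<phi>1 r - M * G r) (at r)" if "0 < r" "r < 1" for r
        by (intro DERIV_diff DERIV_cmult deriv_at \<Gamma>(4) that)
    qed (use near in auto)
    then have "\<bar>- \<phi> 0 - M * \<Gamma> 1\<bar> \<le> e" using bc \<Gamma>(2) by simp
    then have "\<bar>M * \<Gamma> 1 - 1\<bar> \<le> 2 * e" using small \<eta>(4) above[of 0] by (simp add: abs_le_iff)
    then have "\<bar>M * \<Gamma> 1 - 1\<bar> / \<Gamma> 1 \<le> 2 * e / \<Gamma> 1" using \<Gamma>(3) by (simp add: divide_right_mono)
    moreover have "\<bar>M * \<Gamma> 1 - 1\<bar> / \<Gamma> 1 = \<bar>M - 1 / \<Gamma> 1\<bar>"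
      using \<Gamma>(3) abs_divide[of "M * \<Gamma> 1 - 1" "\<Gamma> 1"] by (simp add: diff_divide_distrib)
    ultimately have M\<Gamma>: "\<bar>M - 1 / \<Gamma> 1\<bar> \<le> 2 * e / \<Gamma> 1" by simp
    have close1: "\<bar>\<phi>1 r - G r / \<Gamma> 1\<bar> \<le> \<epsilon>" if r: "r \<in> {0..1}" for r
    proof -
      have "\<bar>M - 1 / \<Gamma> 1\<bar> * \<bar>G r\<bar> \<le> 2 * e / \<Gamma> 1 * N"
        using M\<Gamma> N r e \<Gamma>(3) by (intro mult_mono) auto
      moreover have "\<phi>1 r - G r / \<Gamma> 1 = (\<phi>1 r - M * G r) + (M - 1 / \<Gamma> 1) * G r"
        by (simp add: algebra_simps)
      then have "\<bar>\<phi>1 r - G r / \<Gamma> 1\<bar> \<le> \<bar>\<phi>1 r - M * G r\<bar> + \<bar>M - 1 / \<Gamma> 1\<bar> * \<bar>G r\<bar>"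
        using abs_triangle_ineq[of "\<phi>1 r - M * G r" "(M - 1 / \<Gamma> 1) * G r"] by (simp only: abs_mult)
      moreover have "e + 2 * e / \<Gamma> 1 * N = \<epsilon>" unfolding e(2)[symmetric] by (simp add: distrib_left)
      ultimately show ?thesis using near[OF r] by linarith
    qed
    show "\<forall>r\<in>{0..1}. \<bar>\<phi>1 r - G r / \<Gamma> 1\<bar> \<le> \<epsilon> \<and> \<bar>\<phi> r - (\<Gamma> r / \<Gamma> 1 - 1)\<bar> \<le> \<epsilon>"
    proof (intro ballI conjI close1)
      fix r :: real assume r: "r \<in> {0..1}"
      have "\<bar>(\<phi> 1 - (\<Gamma> 1 / \<Gamma> 1 - 1)) - (\<phi> r - (\<Gamma> r / \<Gamma> 1 - 1))\<bar> \<le> \<epsilon> * (1 - r)"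
      proof (rule abs_increment_le[where f = "\<lambda>r. \<phi> r - (\<Gamma> r / \<Gamma> 1 - 1)" and f' = "\<lambda>r. \<phi>1 r - (G r / \<Gamma> 1 - 0)"])
        show "continuous_on {r..1} (\<lambda>r. \<phi> r - (\<Gamma> r / \<Gamma> 1 - 1))"
          using r \<Gamma>(3) by (intro continuous_intros continuous_on_subset[OF cont] continuous_on_subset[OF \<Gamma>(1)]) auto
        show "((\<lambda>r. \<phi> r - (\<Gamma> r / \<Gamma> 1 - 1)) has_real_derivative \<phi>1 x - (G x / \<Gamma> 1 - 0)) (at x)"
          if "r < x" "x < 1" for x
          using that r by (intro DERIV_diff DERIV_cdivide deriv_at \<Gamma>(4) DERIV_const) auto
      qed (use r close1 in auto)
      also have "\<epsilon> * (1 - r) \<le> \<epsilon>" using r \<epsilon> by simp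
      finally show "\<bar>\<phi> r - (\<Gamma> r / \<Gamma> 1 - 1)\<bar> \<le> \<epsilon>" using bc \<Gamma>(3) by simp
    qed
  qed
qed

lemma has_derivative_radial_0:
  fixes W :: "real \<Rightarrow> real"
  assumes "(W has_real_derivative 0) (at 0 within {0..1})"
  shows "((\<lambda>x::'a::euclidean_space. W (norm x)) has_derivative (\<lambda>h. 0)) (at 0 within cball 0 1)"
  unfolding has_derivative_within_alt
proof (intro conjI allI impI)
  fix \<epsilon> :: real assume "0 < \<epsilon>"
  then obtain d where d: "0 < d"
    "\<And>r. r \<in> {0..1} \<Longrightarrow> norm (r - 0) < d \<Longrightarrow> norm (W r - W 0 - 0 * (r - 0)) \<le> \<epsilon> * norm (r - 0)"
    using assms unfolding has_field_derivative_def has_derivative_within_alt by metis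
  show "\<exists>d>0. \<forall>y\<in>cball (0::'a) 1. norm (y - 0) < d \<longrightarrow> norm (W (norm y) - W (norm (0::'a)) - 0) \<le> \<epsilon> * norm (y - 0)"
    using d(1) d(2)[of "norm (_::'a)"] by (intro exI[of _ d]) auto
qed simp

text \<open>
  A radial function is \<open>C\<^sup>1\<close> across the centre once the derivative of its profile vanishes
  there, because the angular factor \<open>x / norm x\<close> of the gradient is bounded.
\<close>

lemma radial_extension:
  fixes W W1 :: "real \<Rightarrow> real"
  assumes W: "\<And>r. r \<in> {0..1} \<Longrightarrow> (W has_real_derivative W1 r) (at r within {0..1})"
    and W1: "continuous_on {0..1} W1" "W1 0 = 0"
  shows "Ck_on 1 (cball 0 1) (\<lambda>x::'a::euclidean_space. W (norm x))"
    and "x \<in> cball 0 1 \<Longrightarrow> grad (\<lambda>x::'a. W (norm x)) x = (W1 (norm x) / norm x) *\<^sub>R x"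
proof -
  have D: "((\<lambda>x. W (norm x)) has_derivative (\<lambda>h. (W1 (norm x) / norm x) *\<^sub>R x \<bullet> h)) (at x within cball 0 1)"
    if x: "x \<in> cball 0 1" for x :: 'a
  proof (cases "x = 0")
    case True
    then show ?thesis using has_derivative_radial_0[where W = W] W[of 0] W1(2) by simp
  next
    case False
    have "(W has_real_derivative W1 (norm x)) (at (norm x) within norm ` cball (0::'a) 1)"
      by (rule has_field_derivative_subset[OF W]) (use x in auto)
    from has_derivative_radial[OF this False] show ?thesis by simp
  qed
  show "grad (\<lambda>x::'a. W (norm x)) x = (W1 (norm x) / norm x) *\<^sub>R x" if "x \<in> cball 0 1"
    by (rule grad_eqI[OF D[OF that] that])
  let ?p = "\<lambda>i x::'a. (W1 (norm x) / norm x) *\<^sub>R x \<bullet> i"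
  have "((\<lambda>x. W (norm x)) has_derivative (\<lambda>h. \<Sum>i\<in>Basis. (h \<bullet> i) * ?p i x)) (at x within cball 0 1)"
    if x: "x \<in> cball 0 1" for x :: 'a
  proof -
    have "(\<Sum>i\<in>Basis. (h \<bullet> i) * ?p i x) = (W1 (norm x) / norm x) *\<^sub>R x \<bullet> h" for h
      by (subst inner_commute) (rule euclidean_inner[symmetric])
    with D[OF x] show ?thesis by (simp only:)
  qed
  moreover have "continuous_on (cball 0 1) (?p i)" if i: "i \<in> Basis" for i
  proof (rule continuous_on_eq_continuous_within[THEN iffD2], rule ballI)
    fix x :: 'a assume x: "x \<in> cball 0 1"
    have cW1: "continuous_on (cball 0 1) (\<lambda>x::'a. W1 (norm x))"
      by (rule continuous_on_compose2[OF W1(1)]) (auto intro: continuous_intros)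
    then have c: "continuous (at x within cball 0 1) (\<lambda>x. W1 (norm x))"
      using x by (simp add: continuous_on_eq_continuous_within)
    show "continuous (at x within cball 0 1) (?p i)"
    proof (cases "x = 0")
      case False
      then show ?thesis by (intro continuous_intros c) auto
    next
      case True
      have "((\<lambda>x. \<bar>W1 (norm x)\<bar>) \<longlongrightarrow> 0) (at 0 within cball (0::'a) 1)"
        using tendsto_rabs[OF c[unfolded continuous_within]] True W1(2) by simp
      moreover have "norm (?p i y) \<le> \<bar>W1 (norm y)\<bar>" for y
        using Basis_le_norm[OF i, of y] by (cases "y = 0") (auto simp: abs_mult field_simps intro!: mult_right_mono)
      ultimately have "(?p i \<longlongrightarrow> 0) (at 0 within cball 0 1)"
        by (intro Lim_null_comparison[of "?p i" "\<lambda>x. \<bar>W1 (norm x)\<bar>"]) (auto intro: always_eventually)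
      then show ?thesis using True by (simp add: continuous_within)
    qed
  qed
  ultimately show "Ck_on 1 (cball 0 1) (\<lambda>x::'a. W (norm x))"
    unfolding One_nat_def Ck_on.simps by (intro exI[of _ ?p]) blast
qed

section \<open>The limit function and the solution curve\<close>

text \<open>
  Away from the centre, \<open>\<omega>\<close> solves the homogeneous equation because the right-hand side
  \<open>1 / r ^ (d - 1)\<close> of the equation for \<open>G\<close> is, up to a factor, the derivative of the radial fundamental
  solution of the Laplacian.
\<close>

lemma limit_profile_exists:
  assumes dim: "DIM('a::euclidean_space) = 1 \<or> DIM('a::euclidean_space) = 2" and B: "0 < B" and T: "0 \<le> T"
  obtains G G1 G2 \<Gamma> :: "real \<Rightarrow> real" and \<omega> :: "'a::euclidean_space \<Rightarrow> real" where
    "continuous_on {0..1} G" "G 0 = 0" "G 1 = 0"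
    "\<And>r. 0 < r \<Longrightarrow> (G has_real_derivative G1 r) (at r)"
    "\<And>r. 0 < r \<Longrightarrow> (G1 has_real_derivative G2 r) (at r)"
    "\<And>r. 0 < r \<Longrightarrow> radial_op DIM('a::euclidean_space) B T r (G r) (G1 r) (G2 r) = 1 / r ^ (DIM('a::euclidean_space) - 1)"
    "continuous_on {0..1} \<Gamma>" "\<Gamma> 0 = 0" "\<And>r. 0 < r \<Longrightarrow> r \<le> 1 \<Longrightarrow> 0 < \<Gamma> r"
    "\<And>r. 0 < r \<Longrightarrow> (\<Gamma> has_real_derivative G r) (at r)"
    "\<And>x. \<omega> x = \<Gamma> (norm x) / \<Gamma> 1 - 1"
    "\<And>x. x \<in> cball 0 1 \<Longrightarrow> grad \<omega> x = (G (norm x) / \<Gamma> 1 / norm x) *\<^sub>R x"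
    "Ck_on 4 (cball 0 1 - {0}) \<omega>" "Ck_on 1 (cball 0 1) \<omega>"
    "\<And>x. x \<in> ball 0 1 - {0} \<Longrightarrow> B * laplacian (laplacian \<omega>) x - T * laplacian \<omega> x = 0"
proof -
  let ?d = "DIM('a)"
  obtain G G1 G2 where G: "continuous_on {0..} G" "G 0 = 0" "G 1 = 0"
      "\<And>r. 0 < r \<Longrightarrow> r < 1 \<Longrightarrow> 0 < G r"
      "\<And>r. 0 < r \<Longrightarrow> (G has_real_derivative G1 r) (at r)"
      "\<And>r. 0 < r \<Longrightarrow> (G1 has_real_derivative G2 r) (at r)"
      "\<And>r. 0 < r \<Longrightarrow> radial_op ?d B T r (G r) (G1 r) (G2 r) = 1 / r ^ (?d - 1)"
      "\<And>k. Ck_on k {0<..} G"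
    by (fact green_profile_exists[OF dim B T])
  define \<Gamma> where "\<Gamma> = (\<lambda>r. integral {0..r} G)"
  have \<Gamma>w: "(\<Gamma> has_real_derivative G r) (at r within {0..b})" if "r \<in> {0..b}" for r b
    unfolding \<Gamma>_def
    by (rule integral_has_real_derivative[OF continuous_on_subset[OF G(1)] that]) auto
  have \<Gamma>d: "(\<Gamma> has_real_derivative G r) (at r)" if "0 < r" for r
    using \<Gamma>w[of r "r + 1"] at_within_Icc_at[of 0 r "r + 1"] that by simp
  have c\<Gamma>: "continuous_on {0..1} \<Gamma>" by (rule DERIV_continuous_on[OF \<Gamma>w])
  have \<Gamma>0: "\<Gamma> 0 = 0" by (simp add: \<Gamma>_def)
  have \<Gamma>_pos: "0 < \<Gamma> r" if "0 < r" "r \<le> 1" for r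
  proof -
    have "\<Gamma> 0 < \<Gamma> r"
    proof (rule DERIV_pos_imp_increasing_open[OF that(1)])
      show "\<exists>y. (\<Gamma> has_real_derivative y) (at x) \<and> 0 < y" if "0 < x" "x < r" for x
        using \<Gamma>d[OF that(1)] G(4)[OF that(1)] that(2) \<open>r \<le> 1\<close> by auto
      show "continuous_on {0..r} \<Gamma>" by (rule continuous_on_subset[OF c\<Gamma>]) (use that in auto)
    qed
    then show ?thesis by (simp add: \<Gamma>0)
  qed
  define c where "c = 1 / \<Gamma> 1"
  define W where "W = (\<lambda>r. \<Gamma> r / \<Gamma> 1 - 1)"
  define \<omega> where "\<omega> = (\<lambda>x::'a. W (norm x))"
  have W1: "(W has_real_derivative G r / \<Gamma> 1) (at r within {0..1})" if "r \<in> {0..1}" for r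
    unfolding W_def using DERIV_diff[OF DERIV_cdivide[OF \<Gamma>w[OF that]] DERIV_const] by simp
  have W1_at: "(W has_real_derivative c * G r) (at r)" if "0 < r" for r
    unfolding W_def c_def using DERIV_diff[OF DERIV_cdivide[OF \<Gamma>d[OF that]] DERIV_const] by simp
  have cG: "continuous_on {0..1} (\<lambda>r. G r / \<Gamma> 1)"
    using \<Gamma>_pos[of 1] by (intro continuous_intros continuous_on_subset[OF G(1)]) auto
  have "Ck_on (Suc 3) {0<..} W"
    by (rule Ck_on_SucI_real[OF W1_at]) (auto intro!: Ck_on_cmult G(8))
  then have "Ck_on (Suc 3) (cball 0 1 - {0}) \<omega>"
    unfolding \<omega>_def by (rule Ck_on_radial[rotated]) simp
  moreover have "Suc 3 = 4" by simp
  ultimately have C4: "Ck_on 4 (cball 0 1 - {0}) \<omega>" by (simp only:)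
  have C1: "Ck_on 1 (cball 0 1) \<omega>"
    unfolding \<omega>_def by (rule radial_extension(1)[OF W1 cG]) (simp_all add: G(2))
  have gr: "grad \<omega> x = (G (norm x) / \<Gamma> 1 / norm x) *\<^sub>R x" if "x \<in> cball 0 1" for x
    unfolding \<omega>_def by (rule radial_extension(2)[OF W1 cG _ that]) (simp_all add: G(2))
  have pde: "B * laplacian (laplacian \<omega>) x - T * laplacian \<omega> x = 0" if x: "x \<in> ball 0 1 - {0}" for x
  proof -
    define \<psi> where "\<psi> = (\<lambda>r. c * G1 r + (real ?d - 1) * (c * G r / r))"
    define \<psi>1 where "\<psi>1 = (\<lambda>r. (T * (c * G r) - c / r ^ (?d - 1)) / B)"
    have lap: "laplacian \<omega> y = \<psi> (norm y)" if "y \<in> - {0}" for y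
      unfolding \<psi>_def
      by (rule laplacian_radial[of "- {0}" y \<omega> W "\<lambda>r. c * G r"])
        (use that in \<open>auto simp: \<omega>_def intro!: W1_at DERIV_cmult G(5)\<close>)
    have \<psi>d: "(\<psi> has_real_derivative \<psi>1 r) (at r)" if r: "0 < r" for r
    proof -
      have "(\<psi> has_real_derivative c * (G2 r + (real ?d - 1) * (G1 r / r - G r / r\<^sup>2))) (at r)"
        unfolding \<psi>_def using r
        by (auto intro!: derivative_eq_intros G(5,6) simp: field_simps power2_eq_square)
      moreover have "B * (G2 r + (real ?d - 1) * (G1 r / r - G r / r\<^sup>2)) = T * G r - 1 / r ^ (?d - 1)"
        using G(7)[OF r] unfolding radial_op_def by simp
      then have "G2 r + (real ?d - 1) * (G1 r / r - G r / r\<^sup>2) = (T * G r - 1 / r ^ (?d - 1)) / B"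
        using B by (simp add: nonzero_eq_divide_eq mult.commute)
      ultimately show ?thesis by (simp add: \<psi>1_def right_diff_distrib mult_ac)
    qed
    let ?r = "norm x"
    have r: "0 < ?r" using x by auto
    have \<psi>1d: "(\<psi>1 has_real_derivative (T * (c * G1 ?r) + (real ?d - 1) * (c / ?r ^ ?d)) / B) (at ?r)"
      using dim
    proof
      assume d: "?d = 1"
      show ?thesis unfolding \<psi>1_def d
        using r B by (auto intro!: derivative_eq_intros G(5))
    next
      assume d: "?d = 2"
      show ?thesis unfolding \<psi>1_def d
        using r B by (auto intro!: derivative_eq_intros G(5) simp: field_simps power2_eq_square)
    qed
    have "laplacian (laplacian \<omega>) x =
        (T * (c * G1 ?r) + (real ?d - 1) * (c / ?r ^ ?d)) / B + (real ?d - 1) * (\<psi>1 ?r / ?r)"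
      by (rule laplacian_radial[of "- {0}" x "laplacian \<omega>" \<psi> \<psi>1]) (use x lap \<psi>d \<psi>1d in auto)
    moreover have "B * (X / B + k * (Y / B / ?r)) = X + k * (Y / ?r)" for X Y k
      using B r by (simp add: field_simps)
    ultimately have "B * laplacian (laplacian \<omega>) x = T * (c * G1 ?r) + (real ?d - 1) * (c / ?r ^ ?d)
        + (real ?d - 1) * ((T * (c * G ?r) - c / ?r ^ (?d - 1)) / ?r)"
      unfolding \<psi>1_def by simp
    moreover have "(real ?d - 1) * (c / ?r ^ ?d) = (real ?d - 1) * (c / ?r ^ (?d - 1) / ?r)"
      using dim by (auto simp: power2_eq_square)
    ultimately have "B * laplacian (laplacian \<omega>) x =
        T * (c * G1 ?r) + (real ?d - 1) * (T * (c * G ?r) / ?r)"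
      by (simp only: diff_divide_distrib right_diff_distrib[of "real ?d - 1" "T * (c * G ?r) / ?r"])
    also have "\<dots> = T * \<psi> ?r" by (simp add: \<psi>_def distrib_left mult.left_commute)
    also have "\<psi> ?r = laplacian \<omega> x" using lap x by simp
    finally show ?thesis by simp
  qed
  have \<omega>_eq: "\<omega> x = \<Gamma> (norm x) / \<Gamma> 1 - 1" for x by (simp add: \<omega>_def W_def)
  show thesis
    by (rule that[OF continuous_on_subset[OF G(1)] G(2,3,5,6,7) c\<Gamma> \<Gamma>0 \<Gamma>_pos \<Gamma>d \<omega>_eq gr C4 C1 pde]) auto
qed

text \<open>
  Touchdown anywhere is touchdown at the centre, because profiles are nondecreasing; the
  estimates for profiles then apply, and they do not depend on the parameter.
\<close>

lemma solutions_converge: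
  fixes u :: "real \<Rightarrow> 'a::euclidean_space \<Rightarrow> real" and \<Lambda> :: "real \<Rightarrow> real"
  assumes dim: "DIM('a) = 1 \<or> DIM('a) = 2" and B: "0 < B" and T: "0 \<le> T"
    and sol: "\<forall>\<^sub>F s in F. 0 < \<Lambda> s \<and> u s \<in> solutions B T (\<Lambda> s)"
    and touch: "((\<lambda>s. INF x\<in>cball 0 1. u s x) \<longlongrightarrow> -1) F"
  obtains \<omega> :: "'a \<Rightarrow> real" where
    "Ck_on 4 (cball 0 1 - {0}) \<omega>" "Ck_on 1 (cball 0 1) \<omega>" "radial \<omega>"
    "\<And>x. x \<in> ball 0 1 - {0} \<Longrightarrow> B * laplacian (laplacian \<omega>) x - T * laplacian \<omega> x = 0"
    "\<And>x. x \<in> sphere 0 1 \<Longrightarrow> \<omega> x = 0 \<and> normal_deriv \<omega> x = 0"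
    "\<omega> 0 = -1" "grad \<omega> 0 = 0" "\<And>x. 0 < norm x \<Longrightarrow> norm x \<le> 1 \<Longrightarrow> -1 < \<omega> x"
    "(\<Lambda> \<longlongrightarrow> 0) F" "uniform_limit (cball 0 1) u \<omega> F"
    "uniform_limit (cball 0 1) (\<lambda>s. grad (u s)) (grad \<omega>) F"
proof -
  obtain G G1 G2 \<Gamma> :: "real \<Rightarrow> real" and \<omega> :: "'a \<Rightarrow> real" where
    G: "continuous_on {0..1} G" "G 0 = 0" "G 1 = 0"
      "\<And>r. 0 < r \<Longrightarrow> (G has_real_derivative G1 r) (at r)"
      "\<And>r. 0 < r \<Longrightarrow> (G1 has_real_derivative G2 r) (at r)"
      "\<And>r. 0 < r \<Longrightarrow> radial_op DIM('a) B T r (G r) (G1 r) (G2 r) = 1 / r ^ (DIM('a) - 1)"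
    and \<Gamma>: "continuous_on {0..1} \<Gamma>" "\<Gamma> 0 = 0" "\<And>r. 0 < r \<Longrightarrow> r \<le> 1 \<Longrightarrow> 0 < \<Gamma> r"
      "\<And>r. 0 < r \<Longrightarrow> (\<Gamma> has_real_derivative G r) (at r)"
    and \<omega>: "\<And>x. \<omega> x = \<Gamma> (norm x) / \<Gamma> 1 - 1"
      "\<And>x. x \<in> cball 0 1 \<Longrightarrow> grad \<omega> x = (G (norm x) / \<Gamma> 1 / norm x) *\<^sub>R x"
    and C: "Ck_on 4 (cball 0 1 - {0}) \<omega>" "Ck_on 1 (cball 0 1) \<omega>"
    and pde: "\<And>x. x \<in> ball 0 1 - {0} \<Longrightarrow> B * laplacian (laplacian \<omega>) x - T * laplacian \<omega> x = 0"
    by (fact limit_profile_exists[OF dim B T])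
  have \<Gamma>1: "0 < \<Gamma> 1" using \<Gamma>(3) by simp
  have close: "\<forall>\<^sub>F s in F. \<bar>\<Lambda> s\<bar> \<le> \<epsilon> \<and> (\<forall>x\<in>cball 0 1. \<bar>u s x - \<omega> x\<bar> \<le> \<epsilon> \<and> norm (grad (u s) x - grad \<omega> x) \<le> \<epsilon>)"
    if \<epsilon>: "0 < \<epsilon>" for \<epsilon>
  proof -
    have "\<exists>\<eta>>0. \<forall>l \<phi> \<phi>1 \<phi>2 \<phi>3 m. radial_profile DIM('a) B T l \<phi> \<phi>1 \<phi>2 \<phi>3 m \<longrightarrow> 1 + \<phi> 0 \<le> \<eta> \<longrightarrow>
        l \<le> \<epsilon> \<and> (\<forall>r\<in>{0..1}. \<bar>\<phi>1 r - G r / \<Gamma> 1\<bar> \<le> \<epsilon> \<and> \<bar>\<phi> r - (\<Gamma> r / \<Gamma> 1 - 1)\<bar> \<le> \<epsilon>)"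
      by (rule profile_convergence[OF dim B T G(1-3) _ _ _ \<Gamma>(1,2) \<Gamma>1 _ \<epsilon>]) (rule G \<Gamma>; assumption)+
    then obtain \<eta> where \<eta>: "0 < \<eta>" and conv: "\<forall>l \<phi> \<phi>1 \<phi>2 \<phi>3 m.
        radial_profile DIM('a) B T l \<phi> \<phi>1 \<phi>2 \<phi>3 m \<longrightarrow> 1 + \<phi> 0 \<le> \<eta> \<longrightarrow>
        l \<le> \<epsilon> \<and> (\<forall>r\<in>{0..1}. \<bar>\<phi>1 r - G r / \<Gamma> 1\<bar> \<le> \<epsilon> \<and> \<bar>\<phi> r - (\<Gamma> r / \<Gamma> 1 - 1)\<bar> \<le> \<epsilon>)"
      by (elim exE conjE)
    have "\<forall>\<^sub>F s in F. (INF x\<in>cball 0 1. u s x) < -1 + \<eta>"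
      using order_tendstoD(2)[OF touch, of "-1 + \<eta>"] \<eta> by simp
    with sol show ?thesis
    proof eventually_elim
      case (elim s)
      obtain e :: 'a where e: "e \<in> Basis" using nonempty_Basis by blast
      from elim have l: "0 < \<Lambda> s" and us: "u s \<in> solutions B T (\<Lambda> s)" by auto
      obtain \<phi>1 \<phi>2 \<phi>3 m where
        prof: "radial_profile DIM('a) B T (\<Lambda> s) (\<lambda>r. u s (r *\<^sub>R e)) \<phi>1 \<phi>2 \<phi>3 m"
        and gr: "\<And>x. x \<in> cball 0 1 \<Longrightarrow> grad (u s) x = (\<phi>1 (norm x) / norm x) *\<^sub>R x"
        by (fact radial_profile_of_solution[OF dim B T l us e])
      have us_rad: "u s x = u s (norm x *\<^sub>R e)" if "x \<in> cball 0 1" for x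
      proof -
        have "norm x *\<^sub>R e \<in> cball 0 1" "norm x = norm (norm x *\<^sub>R e)" using that e by auto
        with us that show ?thesis unfolding solutions_def radial_def by blast
      qed
      have "u s 0 \<le> (INF x\<in>cball 0 1. u s x)"
      proof (rule cINF_greatest)
        fix x :: 'a assume x: "x \<in> cball 0 1"
        have "u s (0 *\<^sub>R e) \<le> u s (norm x *\<^sub>R e)"
          by (rule radial_profile.phi_mono[OF prof]) (use x in auto)
        then show "u s 0 \<le> u s x" using us_rad[OF x] by simp
      qed simp
      then have "1 + u s (0 *\<^sub>R e) \<le> \<eta>" using elim by simp
      from conv[rule_format, OF prof this] have l\<epsilon>: "\<Lambda> s \<le> \<epsilon>"
        and near: "\<And>r. r \<in> {0..1} \<Longrightarrow> \<bar>\<phi>1 r - G r / \<Gamma> 1\<bar> \<le> \<epsilon>"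
          "\<And>r. r \<in> {0..1} \<Longrightarrow> \<bar>u s (r *\<^sub>R e) - (\<Gamma> r / \<Gamma> 1 - 1)\<bar> \<le> \<epsilon>" by blast+
      have "norm (grad (u s) x - grad \<omega> x) \<le> \<epsilon>" if x: "x \<in> cball 0 1" for x
      proof -
        have "grad (u s) x - grad \<omega> x = ((\<phi>1 (norm x) - G (norm x) / \<Gamma> 1) / norm x) *\<^sub>R x"
          unfolding gr[OF x] \<omega>(2)[OF x] diff_divide_distrib scaleR_left_diff_distrib ..
        then have "norm (grad (u s) x - grad \<omega> x) \<le> \<bar>\<phi>1 (norm x) - G (norm x) / \<Gamma> 1\<bar>"
          by (cases "x = 0") auto
        also have "\<dots> \<le> \<epsilon>" by (rule near(1)) (use x in auto)
        finally show ?thesis .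
      qed
      moreover have "\<bar>u s x - \<omega> x\<bar> \<le> \<epsilon>" if x: "x \<in> cball 0 1" for x
        using near(2)[of "norm x"] x unfolding \<omega>(1) us_rad[OF x] by simp
      ultimately show ?case using l l\<epsilon> by auto
    qed
  qed
  have lim\<Lambda>: "(\<Lambda> \<longlongrightarrow> 0) F"
  proof (rule tendstoI)
    fix \<epsilon> :: real assume "0 < \<epsilon>"
    then show "\<forall>\<^sub>F s in F. dist (\<Lambda> s) 0 < \<epsilon>"
      by (intro eventually_mono[OF close[of "\<epsilon> / 2"]]) auto
  qed
  have lim_u: "uniform_limit (cball 0 1) u \<omega> F"
    unfolding uniform_limit_iff
  proof (intro allI impI)
    fix \<epsilon> :: real assume "0 < \<epsilon>"
    then show "\<forall>\<^sub>F s in F. \<forall>x\<in>cball 0 1. dist (u s x) (\<omega> x) < \<epsilon>"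
      by (intro eventually_mono[OF close[of "\<epsilon> / 2"]]) (force simp: dist_real_def)+
  qed
  have lim_grad: "uniform_limit (cball 0 1) (\<lambda>s. grad (u s)) (grad \<omega>) F"
    unfolding uniform_limit_iff
  proof (intro allI impI)
    fix \<epsilon> :: real assume "0 < \<epsilon>"
    then show "\<forall>\<^sub>F s in F. \<forall>x\<in>cball 0 1. dist (grad (u s) x) (grad \<omega> x) < \<epsilon>"
      by (intro eventually_mono[OF close[of "\<epsilon> / 2"]]) (force simp: dist_norm)+
  qed
  have rad: "radial \<omega>" unfolding radial_def by (simp add: \<omega>(1))
  have bc: "\<omega> x = 0 \<and> normal_deriv \<omega> x = 0" if "x \<in> sphere 0 1" for x
    using that \<Gamma>1 \<omega>(1)[of x] \<omega>(2)[of x] G(3) by (simp add: normal_deriv_def)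
  have at0: "\<omega> 0 = -1" by (simp add: \<omega>(1) \<Gamma>(2))
  have grad0: "grad \<omega> 0 = 0" by (simp add: \<omega>(2))
  have above: "-1 < \<omega> x" if "0 < norm x" "norm x \<le> 1" for x
    using \<Gamma>(3)[OF that] \<Gamma>1 by (simp add: \<omega>(1))
  show thesis by (rule that[OF C rad pde bc at0 grad0 above lim\<Lambda> lim_u lim_grad])
qed

theorem theorem2p20:
  fixes B T :: real
    and sol :: "real \<Rightarrow> 'a::euclidean_space \<Rightarrow> real"
    and lam0 :: ereal and V :: "real \<Rightarrow> 'a C1Dr"
    and \<Lambda> :: "real \<Rightarrow> real" and U :: "real \<Rightarrow> 'a C1Dr"
    and s_star :: real
  defines "lam_star \<equiv> lambda_star TYPE('a) B T"
    and "S \<equiv> (nonsingular_zeros B T :: (real \<times> 'a C1Dr) set)"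
    and "P \<equiv> (\<lambda>s. (\<Lambda> s, U s))"
    and "A0 \<equiv> branch_graph lam0 V"
  defines "hits_star \<equiv> (\<lambda>s. 1 \<le> s \<and> \<Lambda> s = lam_star \<and>
             (\<forall>x\<in>cball 0 1. c1fun (U s) x = (INF l\<in>{0<..<lam_star}. sol l x)) \<and>
             A0 = P ` {0<..<s})"
  assumes dim: "DIM('a) = 1 \<or> DIM('a) = 2"
    and B: "0 < B" and T: "0 \<le> T"
    and lam_star_in_0_infinity:
      "admissible TYPE('a) B T \<noteq> {}" "bdd_above (admissible TYPE('a) B T)"
    and sol: "\<And>l. l \<in> {0<..<lam_star} \<Longrightarrow> maximal_solution B T l (sol l)"
    and primary_branch: "maximal_branch B T lam0 V"
    and primary_branch_maximal_solutions: "lam0 = ereal lam_star"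
      "\<And>l x. l \<in> {0<..<lam_star} \<Longrightarrow> x \<in> cball 0 1 \<Longrightarrow> c1fun (V l) x = sol l x"
    and curve: "continuous_on {0<..} P" "\<And>s. 0 < s \<Longrightarrow> 0 < \<Lambda> s"
    and curve_a: "\<And>s. 0 < s \<Longrightarrow> c1fun (U s) \<in> solutions B T (\<Lambda> s)"
    and curve_b: "P ` {0<..<1} \<subseteq> A0" "(P \<longlongrightarrow> (0, 0)) (at_right 0)"
    and curve_c: "inj_on P {s. 0 < s \<and> P s \<in> S}"
      "((\<lambda>s. INF x\<in>cball 0 1. c1fun (U s) x) \<longlongrightarrow> -1) at_top"
    and curve_d: "\<And>s. 0 < s \<Longrightarrow> P s \<in> S \<Longrightarrow> real_analytic_at P {0<..} s \<and> deriv \<Lambda> s \<noteq> 0"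
    and curve_e: "discrete {s. 0 < s \<and> P s \<in> closure S - S}"
      "\<And>s0. 0 < s0 \<Longrightarrow> P s0 \<in> closure S - S \<Longrightarrow>
         \<exists>\<epsilon>>0. \<exists>\<zeta>. continuous_on {-\<epsilon><..<\<epsilon>} \<zeta> \<and> inj_on \<zeta> {-\<epsilon><..<\<epsilon>} \<and>
           \<zeta> ` {-\<epsilon><..<\<epsilon>} \<subseteq> {0<..} \<and> \<zeta> 0 = s0 \<and>
           real_analytic_on (P \<circ> \<zeta>) {-\<epsilon><..<\<epsilon>} \<and>
           (\<forall>t\<in>{-\<epsilon><..<\<epsilon>}. t \<noteq> 0 \<longrightarrow> vector_derivative (P \<circ> \<zeta>) (at t) \<noteq> 0)"
    and s_star: "hits_star s_star" "\<And>s. hits_star s \<Longrightarrow> s_star \<le> s"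
  shows
    "(\<exists>\<omega> :: 'a \<Rightarrow> real.
        Ck_on 4 (cball 0 1 - {0}) \<omega> \<and> Ck_on 1 (cball 0 1) \<omega> \<and> radial \<omega> \<and>
        (\<forall>x\<in>ball 0 1 - {0}. B * laplacian (laplacian \<omega>) x - T * laplacian \<omega> x = 0) \<and>
        (\<forall>x\<in>sphere 0 1. \<omega> x = 0 \<and> normal_deriv \<omega> x = 0) \<and>
        \<omega> 0 + 1 = 0 \<and> grad \<omega> 0 = 0 \<and>
        (\<forall>x. 0 < norm x \<and> norm x < 1 \<longrightarrow> \<omega> x > -1) \<and>
        (\<Lambda> \<longlongrightarrow> 0) at_top \<and>
        uniform_limit (cball 0 1) (\<lambda>s. c1fun (U s)) \<omega> at_top \<and>
        (\<forall>\<rho>\<in>{0<..<1}.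
           uniform_limit (cball 0 1 - ball 0 \<rho>) (\<lambda>s. grad (c1fun (U s))) (grad \<omega>) at_top))
     \<and>
     (\<forall>l\<in>{0<..<lam_star}. \<exists>s1 s2. 0 < s1 \<and> s1 < s_star \<and> s_star < s2 \<and>
        \<Lambda> s1 = l \<and> \<Lambda> s2 = l \<and>
        c1fun (U s1) \<in> solutions B T l \<and> c1fun (U s2) \<in> solutions B T l \<and>
        (\<forall>x\<in>ball 0 1. c1fun (U s2) x \<le> c1fun (U s1) x) \<and> U s2 \<noteq> U s1)"
proof -
  have \<Lambda>_cont: "continuous_on {0<..} \<Lambda>"
    using continuous_on_fst[OF curve(1)] by (simp add: P_def)
  have ev: "\<forall>\<^sub>F s in at_top. 0 < \<Lambda> s \<and> c1fun (U s) \<in> solutions B T (\<Lambda> s)"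
    using eventually_gt_at_top[of "0::real"] by eventually_elim (auto intro: curve(2) curve_a)
  obtain \<omega> :: "'a \<Rightarrow> real" where \<omega>:
    "Ck_on 4 (cball 0 1 - {0}) \<omega>" "Ck_on 1 (cball 0 1) \<omega>" "radial \<omega>"
    "\<And>x. x \<in> ball 0 1 - {0} \<Longrightarrow> B * laplacian (laplacian \<omega>) x - T * laplacian \<omega> x = 0"
    "\<And>x. x \<in> sphere 0 1 \<Longrightarrow> \<omega> x = 0 \<and> normal_deriv \<omega> x = 0"
    "\<omega> 0 = -1" "grad \<omega> 0 = 0" "\<And>x. 0 < norm x \<Longrightarrow> norm x \<le> 1 \<Longrightarrow> -1 < \<omega> x"
    and \<Lambda>0: "(\<Lambda> \<longlongrightarrow> 0) at_top"
    and lim: "uniform_limit (cball 0 1) (\<lambda>s. c1fun (U s)) \<omega> at_top"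
      "uniform_limit (cball 0 1) (\<lambda>s. grad (c1fun (U s))) (grad \<omega>) at_top"
    by (fact solutions_converge[OF dim B T ev curve_c(2)])
  have limit: "\<forall>\<rho>\<in>{0<..<1}.
      uniform_limit (cball 0 1 - ball 0 \<rho>) (\<lambda>s. grad (c1fun (U s))) (grad \<omega>) at_top"
    by (intro ballI uniform_limit_on_subset[OF lim(2)]) auto
  have multiplicity: "\<exists>s1 s2. 0 < s1 \<and> s1 < s_star \<and> s_star < s2 \<and> \<Lambda> s1 = l \<and> \<Lambda> s2 = l \<and>
      c1fun (U s1) \<in> solutions B T l \<and> c1fun (U s2) \<in> solutions B T l \<and>
      (\<forall>x\<in>ball 0 1. c1fun (U s2) x \<le> c1fun (U s1) x) \<and> U s2 \<noteq> U s1"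
    if l: "l \<in> {0<..<lam_star}" for l
  proof -
    from s_star(1) have star: "1 \<le> s_star" "\<Lambda> s_star = lam_star" "A0 = P ` {0<..<s_star}"
      unfolding hits_star_def by auto
    have "(l, V l) \<in> A0"
      using l unfolding A0_def branch_graph_def primary_branch_maximal_solutions(1) by auto
    then obtain s1 where s1: "0 < s1" "s1 < s_star" "P s1 = (l, V l)"
      unfolding star(3) by auto
    then have s1_eq: "\<Lambda> s1 = l" "U s1 = V l" by (auto simp: P_def)
    have "\<forall>\<^sub>F s in at_top. \<Lambda> s < l \<and> s_star < s"
      using order_tendstoD(2)[OF \<Lambda>0, of l] eventually_gt_at_top[of s_star] l
      by (simp add: eventually_conj_iff)
    then obtain s' where s': "\<Lambda> s' < l" "s_star < s'"
      using eventually_happens'[OF trivial_limit_at_top_linorder] by blast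
    have "continuous_on {s_star..s'} \<Lambda>"
      by (rule continuous_on_subset[OF \<Lambda>_cont]) (use star in auto)
    then obtain s2 where s2: "s_star \<le> s2" "s2 \<le> s'" "\<Lambda> s2 = l"
      using IVT2'[of \<Lambda> s' l s_star] s' star l by auto
    have s2_gt: "s_star < s2" using s2 star l by (cases "s2 = s_star") auto
    have sols: "c1fun (U s1) \<in> solutions B T l" "c1fun (U s2) \<in> solutions B T l"
      using curve_a[of s1] curve_a[of s2] s1 s1_eq s2 star by auto
    have below: "c1fun (U s2) x \<le> c1fun (U s1) x" if "x \<in> ball 0 1" for x
    proof -
      have x: "x \<in> cball 0 1" using that by auto
      have "c1fun (U s2) \<in> subsolutions B T l"
        using sols(2) unfolding solutions_def subsolutions_def by auto
      then have "c1fun (U s2) x \<le> sol l x"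
        using sol[OF l] x unfolding maximal_solution_def by blast
      then show ?thesis using primary_branch_maximal_solutions(2)[OF l x] s1_eq by simp
    qed
    have "V l \<in> dom_O \<and> F_map B T l (V l) = 0 \<and> boundedly_invertible (F_u B T l (V l))"
      using primary_branch l
      unfolding maximal_branch_def branch_on_def primary_branch_maximal_solutions(1) by auto
    then have "P s1 \<in> S" unfolding s1(3) S_def nonsingular_zeros_def using l by auto
    \<comment> \<open>On the nonsingular part the curve is injective, so the branch cannot be met a second time.\<close>
    have "U s2 \<noteq> U s1"
    proof
      assume "U s2 = U s1"
      then have "P s2 = P s1" using s1_eq s2(3) by (simp add: P_def)
      with curve_c(1) \<open>P s1 \<in> S\<close> s1(1) s2_gt star(1) have "s2 = s1"
        by (intro inj_onD[OF curve_c(1)]) auto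
      then show False using s1 s2_gt by simp
    qed
    with s1 s1_eq s2 s2_gt sols below show ?thesis by blast
  qed
  show ?thesis
  proof (intro conjI exI[of _ \<omega>] ballI allI impI)
    show "\<omega> 0 + 1 = 0" using \<omega>(6) by simp
    show "-1 < \<omega> x" if "0 < norm x \<and> norm x < 1" for x using \<omega>(8) that by simp
    show "\<omega> x = 0" "normal_deriv \<omega> x = 0" if "x \<in> sphere 0 1" for x using \<omega>(5)[OF that] by auto
  qed (rule \<omega> \<Lambda>0 lim limit[rule_format] multiplicity; assumption)+
qed

end
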